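(* Consider the forward complete differential inclusion $\dot x(t)\in F(x(t))$ on $\mathbb{R}^n$, where $F$ is a locally Lipschitz set-valued map with nonempty compact values, with locally Lipschitz output maps $h:\mathbb{R}^n\to\mathbb{R}^{p_y}$ and $g:\mathbb{R}^n\to\mathbb{R}^{p_w}$ and continuous proper map $\omega:\mathbb{R}^n\to\mathbb{R}_{\ge 0}$. Let $\rho\in\mathcal{K}$ be given. The following are equivalent. (1) The system satisfies the SIT property with gain $\rho$. (2) The system admits a lower semicontinuous SIT-Lyapunov function with gain $\rho$. (3) The system admits a lower semicontinuous exponential decay SIT-Lyapunov function with gain $\rho$.
   Context: Setting. $F$ maps points of $\mathbb{R}^n$ to nonempty compact subsets of $\mathbb{R}^n$. $F$ is locally Lipschitz: every $\xi\in\mathbb{R}^n$ has a neighbourhood $U$ and $L>0$ with $F(\eta)\subseteq F(\zeta)+L|\eta-\zeta|\mathcal{B}$ for all $\eta,\zeta\in U$, where $\mathcal{B}$ is the closed Euclidean unit ball and $|\cdot|$ is the Euclidean norm. A solution of $\dot x\in F(x)$ on $[0,T)$, $0<T\le\infty$, is a function $x:[0,T)\to\mathbb{R}^n$, absolutely continuous on compact subintervals, with $\dot x(t)\in F(x(t))$ for almost every $t$. It is maximal if it has no extension to a solution on $[0,T_+)$ with $T_+>T$. Forward completeness means that every maximal solution is defined for all $t\ge0$. $\mathbf{S}$ is the set of all maximal solutions. Write $|\xi|_\omega:=\omega(\xi)$, $y(t):=h(x(t))$, $w(t):=g(x(t))$. Comparison functions. $\gamma:\mathbb{R}_{\ge0}\to\mathbb{R}_{\ge0}$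 is of class $\mathcal{K}$ if it is continuous, strictly increasing, zero at $0$ and positive elsewhere; it is of class $\mathcal{K}_\infty$ if in addition it is unbounded. $\beta:\mathbb{R}_{\ge0}\times\mathbb{R}_{\ge0}\to\mathbb{R}_{\ge0}$ is of class $\mathcal{KL}$ if $\beta(\cdot,t)\in\mathcal{K}$ for each fixed $t\ge 0$ and, for each fixed $s\ge 0$, $\beta(s,t)$ decreases (is nonincreasing) to $0$ as $t\to\infty$. Stability in three measures (SIT) with gain $\rho\in\mathcal{K}$: there exists $\beta\in\mathcal{KL}$ such that for every $x(\cdot)\in\mathbf{S}$ and every $t_1>0$ with $|y(t)|>\rho(|w(t)|)$ for all $t\in[0,t_1]$, one has $|y(t)|\le\beta(|x(0)|_\omega,t)$ for all $t\in[0,t_1]$. Viscosity subdifferential: $\zeta\in\partial_D V(\xi)$ for $V:\mathbb{R}^n\to\mathbb{R}$ iff there are a function $r:\mathbb{R}^n\to\mathbb{R}$ with $\lim_{k\to0} r(k)/|k|=0$ and a neighbourhood $\mathcal{O}$ of the origin such that $V(\xi+k)-V(\xi)-\zeta\cdot k\ge r(k)$ for all $k\in\mathcal{O}$. (This set may be empty.) Lower semicontinuous SIT-Lyapunov function with gain $\rho$: a lower semicontinuous $V:\mathbb{R}^n\to\mathbb{R}_{\ge0}$ such that (i) there exist $\alpha_1,\alpha_2\in\mathcal{K}_\infty$ with $\alpha_1(|h(\xi)|)\le V(\xi)\le\alpha_2(|\xi|_\omega)$ for all $\xi$ with $|h(\xi)|>\rho(|g(\xi)|)$; (ii) there exists a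 continuous positive definite $\alpha_3:\mathbb{R}_{\ge0}\to\mathbb{R}_{\ge0}$ (zero at $0$, positive elsewhere) such that for each $\xi$ with $|h(\xi)|>\rho(|g(\xi)|)$, $\zeta\cdot v\le-\alpha_3(V(\xi))$ for all $\zeta\in\partial_D V(\xi)$ and all $v\in F(\xi)$. It is an exponential decay SIT-Lyapunov function with gain $\rho$ if in addition (ii) holds with $\alpha_3(r)=r$. *)

theory Defs
  imports "HOL-Analysis.Analysis"
begin

section \<open>Comparison functions\<close>

text \<open>Functions on the nonnegative reals are represented by total functions on \<open>real\<close>
  of which only the restriction to \<open>{0..}\<close> matters.\<close>

definition class_K :: "(real \<Rightarrow> real) \<Rightarrow> bool" where
  "class_K \<gamma> \<longleftrightarrow> continuous_on {0..} \<gamma> \<and> strict_mono_on {0..} \<gamma> \<and> \<gamma> 0 = 0 \<and> (\<forall>s>0. \<gamma> s > 0)"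

definition class_K_inf :: "(real \<Rightarrow> real) \<Rightarrow> bool" where
  "class_K_inf \<gamma> \<longleftrightarrow> class_K \<gamma> \<and> (\<forall>M. \<exists>s\<ge>0. \<gamma> s > M)"

definition class_KL :: "(real \<Rightarrow> real \<Rightarrow> real) \<Rightarrow> bool" where
  "class_KL \<beta> \<longleftrightarrow>
     (\<forall>t\<ge>0. class_K (\<lambda>s. \<beta> s t)) \<and>
     (\<forall>s\<ge>0. antimono_on {0..} (\<beta> s) \<and> (\<beta> s \<longlongrightarrow> 0) at_top)"

definition cont_pos_def :: "(real \<Rightarrow> real) \<Rightarrow> bool" where
  "cont_pos_def \<alpha> \<longleftrightarrow> continuous_on {0..} \<alpha> \<and> \<alpha> 0 = 0 \<and> (\<forall>s>0. \<alpha> s > 0)"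

section \<open>Regularity of maps\<close>

definition locally_lipschitz_map :: "('a::metric_space \<Rightarrow> 'b::metric_space) \<Rightarrow> bool" where
  "locally_lipschitz_map f \<longleftrightarrow> (\<forall>\<xi>. \<exists>U L. open U \<and> \<xi> \<in> U \<and> L-lipschitz_on U f)"

definition locally_lipschitz_setvalued ::
  "('a::real_normed_vector \<Rightarrow> 'b::real_normed_vector set) \<Rightarrow> bool" where
  "locally_lipschitz_setvalued F \<longleftrightarrow>
     (\<forall>\<xi>. \<exists>U L. open U \<and> \<xi> \<in> U \<and> L > 0 \<and>
        (\<forall>\<eta>\<in>U. \<forall>\<zeta>\<in>U.
           F \<eta> \<subseteq> {z + (L * norm (\<eta> - \<zeta>)) *\<^sub>R b | z b. z \<in> F \<zeta> \<and> b \<in> cball 0 1}))"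

definition lower_semicontinuous :: "('a::topological_space \<Rightarrow> real) \<Rightarrow> bool" where
  "lower_semicontinuous V \<longleftrightarrow> (\<forall>\<xi>. \<forall>c < V \<xi>. \<forall>\<^sub>F \<eta> in nhds \<xi>. c < V \<eta>)"

text \<open>A pair \<open>(c, d)\<close> in \<open>I\<close> stands for the interval from \<open>c\<close> to \<open>d\<close>; the intervals of the
  family may share endpoints only.\<close>

definition abs_cont_on :: "real \<Rightarrow> real \<Rightarrow> (real \<Rightarrow> 'a::real_normed_vector) \<Rightarrow> bool" where
  "abs_cont_on a b f \<longleftrightarrow>
     (\<forall>\<epsilon>>0. \<exists>\<delta>>0. \<forall>I :: (real \<times> real) set.
        finite I \<and>
        (\<forall>(c, d)\<in>I. a \<le> c \<and> c \<le> d \<and> d \<le> b) \<and>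
        pairwise (\<lambda>p q. {fst p<..<snd p} \<inter> {fst q<..<snd q} = {}) I \<and>
        (\<Sum>(c, d)\<in>I. d - c) < \<delta>
        \<longrightarrow> (\<Sum>(c, d)\<in>I. norm (f d - f c)) < \<epsilon>)"

section \<open>Solutions of differential inclusions\<close>

definition time_dom :: "ereal \<Rightarrow> real set" where
  "time_dom T = {t. 0 \<le> t \<and> ereal t < T}"

text \<open>A solution on \<open>[0, T)\<close> is represented by the pair of \<open>T\<close> and a total function whose values
  outside \<open>time_dom T\<close> are irrelevant.\<close>

definition solution ::
  "('a::euclidean_space \<Rightarrow> 'a set) \<Rightarrow> ereal \<Rightarrow> (real \<Rightarrow> 'a) \<Rightarrow> bool" where
  "solution F T x \<longleftrightarrow>
     0 < T \<and>
     (\<forall>a b. 0 \<le> a \<and> a \<le> b \<and> ereal b < T \<longrightarrow> abs_cont_on a b x) \<and>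
     (AE t in lebesgue. t \<in> time_dom T \<longrightarrow>
        (\<exists>v \<in> F (x t). (x has_vector_derivative v) (at t within time_dom T)))"

definition maximal_solution ::
  "('a::euclidean_space \<Rightarrow> 'a set) \<Rightarrow> ereal \<Rightarrow> (real \<Rightarrow> 'a) \<Rightarrow> bool" where
  "maximal_solution F T x \<longleftrightarrow>
     solution F T x \<and>
     \<not> (\<exists>T' x'. T < T' \<and> solution F T' x' \<and> (\<forall>t\<in>time_dom T. x' t = x t))"

definition forward_complete :: "('a::euclidean_space \<Rightarrow> 'a set) \<Rightarrow> bool" where
  "forward_complete F \<longleftrightarrow> (\<forall>T x. maximal_solution F T x \<longrightarrow> T = \<infinity>)"

section \<open>Stability in three measures\<close>

definition SIT ::
  "('a::euclidean_space \<Rightarrow> 'a set) \<Rightarrow> ('a \<Rightarrow> 'b::real_normed_vector) \<Rightarrow>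
   ('a \<Rightarrow> 'c::real_normed_vector) \<Rightarrow> ('a \<Rightarrow> real) \<Rightarrow> (real \<Rightarrow> real) \<Rightarrow> bool" where
  "SIT F h g \<omega> \<rho> \<longleftrightarrow>
     (\<exists>\<beta>. class_KL \<beta> \<and>
       (\<forall>T x t1. maximal_solution F T x \<and> 0 < t1 \<and> ereal t1 < T \<and>
          (\<forall>t\<in>{0..t1}. norm (h (x t)) > \<rho> (norm (g (x t)))) \<longrightarrow>
          (\<forall>t\<in>{0..t1}. norm (h (x t)) \<le> \<beta> (\<omega> (x 0)) t)))"

section \<open>Lyapunov functions\<close>

definition viscosity_subdifferential ::
  "('a::real_inner \<Rightarrow> real) \<Rightarrow> 'a \<Rightarrow> 'a set" where
  "viscosity_subdifferential V \<xi> =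
     {\<zeta>. \<exists>r U. ((\<lambda>k. r k / norm k) \<longlongrightarrow> 0) (at 0) \<and> open U \<and> 0 \<in> U \<and>
            (\<forall>k\<in>U. V (\<xi> + k) - V \<xi> - \<zeta> \<bullet> k \<ge> r k)}"

definition SIT_decrease ::
  "('a::euclidean_space \<Rightarrow> 'a set) \<Rightarrow> ('a \<Rightarrow> 'b::real_normed_vector) \<Rightarrow>
   ('a \<Rightarrow> 'c::real_normed_vector) \<Rightarrow> (real \<Rightarrow> real) \<Rightarrow> (real \<Rightarrow> real) \<Rightarrow> ('a \<Rightarrow> real) \<Rightarrow> bool" where
  "SIT_decrease F h g \<rho> \<alpha> V \<longleftrightarrow>
     (\<forall>\<xi>. norm (h \<xi>) > \<rho> (norm (g \<xi>)) \<longrightarrow>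
        (\<forall>\<zeta>\<in>viscosity_subdifferential V \<xi>. \<forall>v\<in>F \<xi>. \<zeta> \<bullet> v \<le> - \<alpha> (V \<xi>)))"

definition lsc_SIT_lyapunov ::
  "('a::euclidean_space \<Rightarrow> 'a set) \<Rightarrow> ('a \<Rightarrow> 'b::real_normed_vector) \<Rightarrow>
   ('a \<Rightarrow> 'c::real_normed_vector) \<Rightarrow> ('a \<Rightarrow> real) \<Rightarrow> (real \<Rightarrow> real) \<Rightarrow> ('a \<Rightarrow> real) \<Rightarrow> bool" where
  "lsc_SIT_lyapunov F h g \<omega> \<rho> V \<longleftrightarrow>
     lower_semicontinuous V \<and> (\<forall>\<xi>. 0 \<le> V \<xi>) \<and>
     (\<exists>\<alpha>1 \<alpha>2. class_K_inf \<alpha>1 \<and> class_K_inf \<alpha>2 \<and>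
        (\<forall>\<xi>. norm (h \<xi>) > \<rho> (norm (g \<xi>)) \<longrightarrow>
           \<alpha>1 (norm (h \<xi>)) \<le> V \<xi> \<and> V \<xi> \<le> \<alpha>2 (\<omega> \<xi>))) \<and>
     (\<exists>\<alpha>3. cont_pos_def \<alpha>3 \<and> SIT_decrease F h g \<rho> \<alpha>3 V)"

definition lsc_exp_SIT_lyapunov ::
  "('a::euclidean_space \<Rightarrow> 'a set) \<Rightarrow> ('a \<Rightarrow> 'b::real_normed_vector) \<Rightarrow>
   ('a \<Rightarrow> 'c::real_normed_vector) \<Rightarrow> ('a \<Rightarrow> real) \<Rightarrow> (real \<Rightarrow> real) \<Rightarrow> ('a \<Rightarrow> real) \<Rightarrow> bool" where
  "lsc_exp_SIT_lyapunov F h g \<omega> \<rho> V \<longleftrightarrow>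
     lsc_SIT_lyapunov F h g \<omega> \<rho> V \<and> SIT_decrease F h g \<rho> (\<lambda>r. r) V"

end

theory Submission
  imports Defs "HOL-Complex_Analysis.Great_Picard"
begin

text \<open>Rescaling \<open>V\<close> by a suitable class \<open>\<K>\<^sub>\<infinity>\<close> function turns any decay rate into exponential decay,
  so it remains to relate SIT to exponential decay Lyapunov functions.
  If \<open>V\<close> has exponential decay, then \<open>exp t * V (x t)\<close> is nonincreasing along every solution: this is
  shown for a quadratic inf-convolution of \<open>V\<close>, whose minimisers carry subgradients of \<open>V\<close>.
  Conversely, Sontag's lemma bounds \<open>\<beta> s t\<close> by \<open>\<theta>1\<inverse> (exp (- t) * \<theta>2 s)\<close>, and \<open>V \<xi>\<close> is
  the supremum of \<open>exp b * \<theta>1 (norm (h (x b)))\<close> over trajectories from \<open>\<xi>\<close> that stay in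
  the region \<open>norm (h \<xi>) > \<rho> (norm (g \<xi>))\<close> up to time \<open>b\<close>.
  Taking only piecewise continuously differentiable trajectories in this supremum avoids measurable
  selections and the Filippov--Wazewski theorem: \<open>F\<close> need not be convex-valued, but being Lipschitz it
  has continuously differentiable solutions with any admissible initial velocity, obtained from
  polygons by Arzela--Ascoli, and restarting such arcs often enough follows any given trajectory from
  nearby initial points, which makes \<open>V\<close> lower semicontinuous.\<close>

section \<open>Comparison functions\<close>

text \<open>Bounds and decrease of \<open>V\<close> are assumed only on the open set where
  \<open>norm (h \<xi>) > \<rho> (norm (g \<xi>))\<close>. Every auxiliary point, be it a minimiser
  of the penalty or a point of an approximating trajectory, must therefore stay close enough to a
  compact piece of trajectory to remain in that set; many of the constants below come from this. The
  exponential form serves both directions: prefixing a trajectory by an arc of length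
  \<open>s\<close> multiplies the weight \<open>exp b\<close> by \<open>exp s\<close>, so the
  supremum decays at rate 1 by construction. Non-convex values are the obstacle to constructing
  arcs: limits of positions alone would only have velocities in the convex hull. The polygons are
  therefore drawn for the velocity, with slopes bounded independently of the mesh, so that the
  velocities themselves converge. The supremum may be restricted to piecewise smooth trajectories
  because a subgradient has to be tested along just one arc for each admissible velocity; arbitrary
  absolutely continuous solutions are recovered through the decay estimate.\<close>

lemma class_K_inf_imp_class_K: "class_K_inf \<gamma> \<Longrightarrow> class_K \<gamma>"
  by (simp add: class_K_inf_def)

lemma class_K_less: "class_K \<gamma> \<Longrightarrow> 0 \<le> s \<Longrightarrow> s < t \<Longrightarrow> \<gamma> s < \<gamma> t"
  unfolding class_K_def by (auto intro: strict_mono_onD[of "{0..}"])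

lemma class_K_mono: "class_K \<gamma> \<Longrightarrow> 0 \<le> s \<Longrightarrow> s \<le> t \<Longrightarrow> \<gamma> s \<le> \<gamma> t"
  using class_K_less[of \<gamma> s t] by (cases "s = t") auto

lemma class_K_nonneg: "class_K \<gamma> \<Longrightarrow> 0 \<le> s \<Longrightarrow> 0 \<le> \<gamma> s"
  using class_K_mono[of \<gamma> 0 s] by (simp add: class_K_def)

lemma class_K_less_iff: "class_K \<gamma> \<Longrightarrow> 0 \<le> s \<Longrightarrow> 0 \<le> t \<Longrightarrow> \<gamma> s < \<gamma> t \<longleftrightarrow> s < t"
  by (meson class_K_less class_K_mono linorder_not_less)

lemma class_K_infI:
  assumes "continuous_on {0..} \<gamma>" and "\<And>s t. 0 \<le> s \<Longrightarrow> s < t \<Longrightarrow> \<gamma> s < \<gamma> t"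
    and "\<gamma> 0 = 0" and "\<And>M. \<exists>s\<ge>0. \<gamma> s > M"
  shows "class_K_inf \<gamma>"
  unfolding class_K_inf_def class_K_def using assms assms(2)[of 0]
  by (auto simp: strict_mono_on_def)

lemma class_K_inf_compose:
  assumes "class_K_inf \<alpha>" and "class_K_inf \<gamma>"
  shows "class_K_inf (\<alpha> \<circ> \<gamma>)"
proof (rule class_K_infI)
  note K = assms[THEN class_K_inf_imp_class_K]
  show "continuous_on {0..} (\<alpha> \<circ> \<gamma>)"
    using K class_K_nonneg[OF K(2)]
    by (intro continuous_on_compose) (auto simp: class_K_def elim!: continuous_on_subset)
  show "(\<alpha> \<circ> \<gamma>) s < (\<alpha> \<circ> \<gamma>) t" if "0 \<le> s" "s < t" for s t
    using that class_K_less[OF K(2)] class_K_nonneg[OF K(2)] by (simp add: class_K_less[OF K(1)])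
  show "(\<alpha> \<circ> \<gamma>) 0 = 0" using K by (simp add: class_K_def)
  show "\<exists>s\<ge>0. M < (\<alpha> \<circ> \<gamma>) s" for M
  proof -
    obtain r where r: "0 \<le> r" "M < \<alpha> r" using assms(1) by (auto simp: class_K_inf_def)
    obtain s where s: "0 \<le> s" "r < \<gamma> s" using assms(2) by (auto simp: class_K_inf_def)
    then show ?thesis using r class_K_less[OF K(1) r(1) s(2)] by (intro exI[of _ s]) auto
  qed
qed

lemma class_K_inf_inverse:
  assumes "class_K_inf \<alpha>"
  obtains \<psi> where "class_K_inf \<psi>" and "\<And>s. 0 \<le> s \<Longrightarrow> \<psi> (\<alpha> s) = s"
    and "\<And>s. 0 \<le> s \<Longrightarrow> \<alpha> (\<psi> s) = s"
proof -
  note K = class_K_inf_imp_class_K[OF assms]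
  have surj: "\<exists>s\<ge>0. \<alpha> s = y" if "0 \<le> y" for y
  proof -
    obtain b where "b \<ge> 0" "\<alpha> b > y"
      using assms by (auto simp: class_K_inf_def)
    moreover have "continuous_on {0..b} \<alpha>"
      using K by (auto simp: class_K_def intro: continuous_on_subset)
    ultimately show ?thesis
      using IVT'[of \<alpha> 0 y b] K that by (auto simp: class_K_def)
  qed
  \<comment> \<open>Taking the identity on negative arguments makes \<open>\<psi>\<close> strictly
    increasing with range all of \<open>UNIV\<close>; a monotone function with open range is
    continuous.\<close>
  define \<psi> where "\<psi> y = (if y < 0 then y else SOME s. 0 \<le> s \<and> \<alpha> s = y)" for y
  have \<psi>: "0 \<le> \<psi> y" "\<alpha> (\<psi> y) = y" if "0 \<le> y" for y
    using someI_ex[of "\<lambda>s. 0 \<le> s \<and> \<alpha> s = y"] surj[OF that] that by (auto simp: \<psi>_def)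
  have less: "\<psi> x < \<psi> y" if "x < y" for x y
  proof (cases "x < 0")
    case True
    then show ?thesis
      using \<psi>(1)[of y] that by (cases "y < 0") (auto simp: \<psi>_def)
  next
    case False
    then show ?thesis
      using \<psi>[of x] \<psi>[of y] that class_K_less_iff[OF K, of "\<psi> x" "\<psi> y"] by auto
  qed
  have inv: "\<psi> (\<alpha> s) = s" if "0 \<le> s" for s
    using \<psi>[of "\<alpha> s"] class_K_nonneg[OF K that] that class_K_less_iff[OF K]
    by (metis linorder_neqE_linordered_idom order_less_irrefl)
  have "range \<psi> = UNIV"
  proof -
    have "y \<in> range \<psi>" for y
    proof (cases "y < 0")
      case True
      then have "\<psi> y = y" by (simp add: \<psi>_def)
      then show ?thesis by (metis rangeI)
    next
      case False
      then show ?thesis using inv[of y] by (metis linorder_not_less rangeI)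
    qed
    then show ?thesis by auto
  qed
  then have "continuous_on UNIV \<psi>"
    using less by (intro continuous_onI_mono) (auto simp: le_less)
  moreover have "\<exists>s\<ge>0. \<psi> s > M" for M
  proof (intro exI conjI)
    show "0 \<le> \<alpha> (\<bar>M\<bar> + 1)" using class_K_nonneg[OF K] by simp
    show "M < \<psi> (\<alpha> (\<bar>M\<bar> + 1))" using inv[of "\<bar>M\<bar> + 1"] by simp
  qed
  moreover have "\<psi> 0 = 0"
    using inv[of 0] K by (simp add: class_K_def)
  ultimately have "class_K_inf \<psi>"
    using less by (intro class_K_infI) (auto intro: continuous_on_subset)
  then show ?thesis
    using inv \<psi>(2) by (intro that)
qed

text \<open>Integration replaces a possibly discontinuous monotone function by a continuous one.
  Both inequalities compare \<open>m\<close> on an interval with its value at one endpoint.\<close>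

lemma mono_primitive:
  fixes m :: "real \<Rightarrow> real"
  assumes "mono_on {0..} m"
  defines "P \<equiv> \<lambda>x. integral {0..x} m"
  shows "continuous_on {0..} P"
    and "\<And>r s. 0 \<le> r \<Longrightarrow> r \<le> s \<Longrightarrow> P r + (s - r) * m r \<le> P s"
    and "\<And>r. 0 \<le> r \<Longrightarrow> P r \<le> r * m r"
proof -
  note mono = mono_onD[OF assms(1)]
  have int: "m integrable_on {a..b}" if "0 \<le> a" for a b
    using that by (intro integrable_on_mono_on mono_on_subset[OF assms(1)]) auto
  have "continuous (at x within {0..}) P" if "0 \<le> x" for x
  proof -
    have "continuous_on {0..x+1} P"
      unfolding P_def by (intro indefinite_integral_continuous_1 int) simp
    then have "continuous (at x within {0..x+1}) P"
      using that by (auto simp: continuous_on_eq_continuous_within)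
    moreover have "at x within {0..x+1} = at x within {0..}"
      by (rule at_within_nhd[of x "{x-1<..<x+1}"]) auto
    ultimately show ?thesis by simp
  qed
  then show "continuous_on {0..} P"
    by (simp add: continuous_on_eq_continuous_within)
  show "P r + (s - r) * m r \<le> P s" if "0 \<le> r" "r \<le> s" for r s
  proof -
    have "P s = P r + integral {r..s} m"
      unfolding P_def using that Henstock_Kurzweil_Integration.integral_combine[of 0 r s m] int by auto
    moreover have "integral {r..s} (\<lambda>_. m r) \<le> integral {r..s} m"
      using that by (intro integral_le int mono) auto
    ultimately show ?thesis using that by simp
  qed
  show "P r \<le> r * m r" if "0 \<le> r" for r
  proof -
    have "P r \<le> integral {0..r} (\<lambda>_. m r)"
      unfolding P_def using that by (intro integral_le int mono) auto
    then show ?thesis using that by simp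
  qed
qed

text \<open>The minorant is \<open>P r / (1 + r)\<close> with \<open>P\<close> the primitive of
  \<open>m\<close>, essentially an average of \<open>m\<close>. The denominator \<open>1 + r\<close>
  instead of \<open>r\<close> avoids a singularity at 0 and also supplies strict
  monotonicity.\<close>

lemma class_K_inf_minorant:
  fixes m :: "real \<Rightarrow> real"
  assumes mono: "mono_on {0..} m" and "m 0 = 0"
    and pos: "\<And>r. 0 < r \<Longrightarrow> 0 < m r" and unbounded: "\<And>M. \<exists>r\<ge>0. M < m r"
  obtains \<theta> where "class_K_inf \<theta>" and "\<And>r. 0 \<le> r \<Longrightarrow> \<theta> r \<le> m r"
proof -
  have nonneg: "0 \<le> m r" if "0 \<le> r" for r
    using mono_onD[OF mono, of 0 r] that \<open>m 0 = 0\<close> by simp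
  define P where "P x = integral {0..x} m" for x
  note P = mono_primitive[of m, folded P_def, OF mono]
  have P0: "P 0 = 0" by (simp add: P_def)
  define \<theta> where "\<theta> r = P r / (1 + r)" for r
  have le: "\<theta> r \<le> m r" if "0 \<le> r" for r
    using P(3)[of r] nonneg[of r] that by (auto simp: \<theta>_def divide_simps algebra_simps)
  have "class_K_inf \<theta>"
  proof (rule class_K_infI)
    show "continuous_on {0..} \<theta>"
      unfolding \<theta>_def by (intro continuous_intros P(1)) auto
    show "\<theta> r < \<theta> s" if "0 \<le> r" "r < s" for r s
    proof (cases "r = 0")
      case True
      \<comment> \<open>The lower bound for the primitive is void at 0 because
        \<open>m 0 = 0\<close>, so growth is read off from the midpoint.\<close>
      have "0 < s/2 * m (s/2)" using pos[of "s/2"] that True by simp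
      also have "\<dots> \<le> P s" using P(2)[of 0 "s/2"] P(2)[of "s/2" s] that True \<open>m 0 = 0\<close> P0 by simp
      finally show ?thesis using that True by (simp add: \<theta>_def P0)
    next
      case False
      \<comment> \<open>This is \<open>\<theta> r < \<theta> s\<close> after cross-multiplication:
        of \<open>(s - r) * m r * (1 + r)\<close> the part \<open>r * m r * (s - r)\<close> is lost
        to the growing denominator, and the summand 1 leaves a positive rest.\<close>
      then have "0 < (s - r) * m r" using that pos[of r] by simp
      also have "\<dots> \<le> (P s - P r) * (1 + r) - P r * (s - r)"
      proof -
        have "(s - r) * m r * (1 + r) \<le> (P s - P r) * (1 + r)"
          using P(2)[of r s] that by (intro mult_right_mono) auto
        moreover have "P r * (s - r) \<le> r * m r * (s - r)"
          using P(3)[of r] that by (intro mult_right_mono) auto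
        ultimately show ?thesis by (simp add: algebra_simps)
      qed
      finally have "P r * (1 + s) < P s * (1 + r)" by (simp add: algebra_simps)
      then show ?thesis using that by (simp add: \<theta>_def divide_simps mult.commute)
    qed
    show "\<theta> 0 = 0" by (simp add: \<theta>_def P0)
    show "\<exists>s\<ge>0. M < \<theta> s" for M
    proof -
      obtain r where r: "r \<ge> 0" "4 * \<bar>M\<bar> < m r" using unbounded by blast
      define s where "s = max r 1"
      have "m r \<le> m s" using r by (intro mono_onD[OF mono]) (auto simp: s_def)
      then have s: "s \<ge> 1" "4 * \<bar>M\<bar> < m s" using r by (auto simp: s_def)
      have "s * (4 * \<bar>M\<bar>) < s * m s" using s by (intro mult_strict_left_mono) auto
      also have "\<dots> \<le> P (2 * s)"
        using P(2)[of s "2 * s"] P(2)[of "0" "s"] s P0 \<open>m 0 = 0\<close> by simp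
      finally have *: "4 * s * \<bar>M\<bar> < P (2 * s)" by (simp add: mult_ac)
      have "(1 + 2 * s) * \<bar>M\<bar> \<le> 4 * s * \<bar>M\<bar>" using s by (intro mult_right_mono) auto
      with * have "(1 + 2 * s) * \<bar>M\<bar> < P (2 * s)" by simp
      then have "\<bar>M\<bar> < \<theta> (2 * s)" using s by (simp add: \<theta>_def divide_simps mult.commute)
      then show ?thesis using s by (intro exI[of _ "2 * s"]) auto
    qed
  qed
  then show ?thesis using le that by blast
qed

text \<open>Sontag's lemma. The function \<open>\<theta>1\<close> is chosen so small that even \<open>exp (2 * t) * \<theta>1 (\<beta> s t)\<close> is bounded
  in \<open>t\<close>; the spare factor \<open>sqrt (\<theta>1 (\<beta> s t))\<close> then makes the bound vanish as \<open>s \<rightarrow> 0\<close>.\<close>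

lemma class_KL_exponential:
  assumes "class_KL \<beta>"
  obtains \<theta>1 \<theta>2 where "class_K_inf \<theta>1" and "class_K_inf \<theta>2"
    and "\<And>s t. 0 \<le> s \<Longrightarrow> 0 \<le> t \<Longrightarrow> exp t * \<theta>1 (\<beta> s t) \<le> \<theta>2 s"
proof -
  have K: "class_K (\<lambda>s. \<beta> s t)" if "0 \<le> t" for t
    using assms that by (simp add: class_KL_def)
  have mono: "\<beta> r t \<le> \<beta> s t" if "0 \<le> r" "r \<le> s" "0 \<le> t" for r s t
    using class_K_mono[OF K[OF that(3)] that(1,2)] .
  have nonneg: "0 \<le> \<beta> s t" if "0 \<le> s" "0 \<le> t" for s t
    using class_K_nonneg[OF K[OF that(2)] that(1)] .
  have decr: "\<beta> s t \<le> \<beta> s u" if "0 \<le> s" "0 \<le> u" "u \<le> t" for s t u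
    using assms that by (auto simp: class_KL_def monotone_on_def)
  \<comment> \<open>The times at which \<open>\<beta> s\<close> has not yet fallen below
    \<open>r\<close>. Time 0 is always included, so that suprema are over nonempty sets and
    nonnegative.\<close>
  define T where "T s r = {t. 0 \<le> t \<and> (t = 0 \<or> r \<le> \<beta> s t)}" for s r
  have bdd: "bdd_above (T s r)" if "0 \<le> s" "0 < r" for s r
  proof -
    have "\<forall>\<^sub>F t in at_top. \<beta> s t < r"
      using assms that by (intro order_tendstoD(2)[of "\<beta> s" 0]) (auto simp: class_KL_def)
    then obtain t0 where "\<And>t. t \<ge> t0 \<Longrightarrow> \<beta> s t < r" by (auto simp: eventually_at_top_linorder)
    then have "t \<le> max t0 0" if "t \<in> T s r" for t
      using that by (cases "t0 \<le> t") (auto simp: T_def dest: leD)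
    then show ?thesis by (rule bdd_aboveI)
  qed
  have ne: "0 \<in> T s r" for s r by (simp add: T_def)
  \<comment> \<open>Coupling \<open>s = 1/r\<close> gives a settling time in the one variable
    \<open>r\<close>, valid for all \<open>s\<close> up to \<open>1/r\<close>. It is nonincreasing,
    since a larger \<open>r\<close> both shrinks the initial size and raises the threshold.\<close>
  define \<tau> where "\<tau> r = Sup (T (1/r) r)" for r
  have \<tau>: "t \<le> \<tau> r" if "0 < r" "0 \<le> t" "r \<le> \<beta> (1/r) t" for r t
    unfolding \<tau>_def using that by (intro cSup_upper bdd) (auto simp: T_def)
  have \<tau>_nonneg: "0 \<le> \<tau> r" if "0 < r" for r
    unfolding \<tau>_def using that by (intro cSup_upper bdd ne) auto
  have \<tau>_mono: "\<tau> s \<le> \<tau> r" if "0 < r" "r \<le> s" for r s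
  proof -
    have "T (1/s) s \<subseteq> T (1/r) r"
      using that mono[of "1/s" "1/r"] by (force simp: T_def frac_le)
    then show ?thesis unfolding \<tau>_def
      using that ne by (intro cSup_subset_mono bdd) auto
  qed
  \<comment> \<open>The factor \<open>exp (- 2 * \<tau> r)\<close> cancels
    \<open>exp (2 * t)\<close> for \<open>t \<le> \<tau> r\<close>. Since \<open>\<tau>\<close> is
    nonincreasing, \<open>m\<close> is monotone, and unbounded because
    \<open>\<tau> r \<le> \<tau> 1\<close> for \<open>r \<ge> 1\<close>.\<close>
  define m where "m r = (if r \<le> 0 then 0 else r * exp (- 2 * \<tau> r))" for r
  obtain \<theta>1 where \<theta>1: "class_K_inf \<theta>1" "\<And>r. 0 \<le> r \<Longrightarrow> \<theta>1 r \<le> m r"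
  proof (rule class_K_inf_minorant[of m])
    show "mono_on {0..} m"
      by (intro mono_onI) (auto simp: m_def intro!: mult_mono \<tau>_mono)
    show "\<exists>r\<ge>0. M < m r" for M
    proof -
      define r where "r = max 1 ((\<bar>M\<bar> + 1) * exp (2 * \<tau> 1))"
      have "\<bar>M\<bar> + 1 = ((\<bar>M\<bar> + 1) * exp (2 * \<tau> 1)) * exp (- 2 * \<tau> 1)"
        by (simp add: mult.assoc flip: exp_add)
      also have "\<dots> \<le> r * exp (- 2 * \<tau> r)"
        using \<tau>_mono[of 1 r] by (intro mult_mono) (auto simp: r_def)
      finally show ?thesis by (intro exI[of _ r]) (auto simp: m_def r_def)
    qed
  qed (auto simp: m_def)
  note \<theta>1K = class_K_inf_imp_class_K[OF \<theta>1(1)]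
  define \<sigma> where "\<sigma> s = Sup (T s (1/s))" for s
  have bound: "exp (2 * t) * \<theta>1 (\<beta> s t) \<le> exp (2 * \<sigma> s) * \<beta> s 0" if "0 < s" "0 \<le> t" for s t
  proof -
    define r where "r = \<beta> s t"
    have r: "0 < r" "r \<le> \<beta> s 0"
      using K[OF that(2)] that decr[of s 0 t] by (auto simp: r_def class_K_def)
    have \<sigma>: "0 \<le> \<sigma> s"
      unfolding \<sigma>_def using that by (intro cSup_upper bdd ne) auto
    \<comment> \<open>Either \<open>s \<le> 1/r\<close>, and monotonicity in \<open>s\<close> puts
      \<open>t\<close> below \<open>\<tau> r\<close>; or \<open>r > 1/s\<close>, and then
      \<open>\<beta> s\<close> is still above \<open>1/s\<close> at time \<open>t\<close>, which
      \<open>\<sigma> s\<close> bounds.\<close>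
    have "t \<le> \<tau> r + \<sigma> s"
    proof (cases "s \<le> 1/r")
      case True
      then have "r \<le> \<beta> (1/r) t" using mono[of s "1/r" t] that by (simp add: r_def)
      then show ?thesis using \<tau>[of r t] r that \<sigma> by simp
    next
      case False
      then have "1/s \<le> \<beta> s t" using r that by (simp add: r_def divide_simps mult.commute)
      then have "t \<le> \<sigma> s" unfolding \<sigma>_def using that by (intro cSup_upper bdd) (auto simp: T_def)
      then show ?thesis using \<tau>_nonneg[OF r(1)] by simp
    qed
    have "exp (2 * t) * \<theta>1 r \<le> exp (2 * t) * (r * exp (- 2 * \<tau> r))"
      using \<theta>1(2)[of r] r by (simp add: m_def)
    also have "\<dots> = exp (2 * t - 2 * \<tau> r) * r" by (simp add: exp_diff exp_minus field_simps)
    also have "\<dots> \<le> exp (2 * \<sigma> s) * \<beta> s 0"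
      using \<open>t \<le> \<tau> r + \<sigma> s\<close> r by (intro mult_mono) auto
    finally show ?thesis by (simp add: r_def)
  qed
  define q where "q s t = exp t * sqrt (\<theta>1 (\<beta> s t))" for s t
  define k where "k s = (SUP t\<in>{0..}. q s t)" for s
  have q_bdd: "bdd_above (q s ` {0..})" if "0 \<le> s" for s
  proof (cases "s = 0")
    case True
    then show ?thesis using K \<theta>1K by (auto simp: q_def class_K_def intro!: bdd_aboveI[of _ 0])
  next
    case False
    have "q s t \<le> sqrt (exp (2 * \<sigma> s) * \<beta> s 0)" if "0 \<le> t" for t
    proof -
      have "q s t = sqrt (exp (2 * t) * \<theta>1 (\<beta> s t))"
        by (simp add: q_def real_sqrt_mult exp_double)
      then show ?thesis using bound[of s t] False \<open>0 \<le> s\<close> that by simp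
    qed
    then show ?thesis by (intro bdd_aboveI) auto
  qed
  have q_le: "q s t \<le> k s" if "0 \<le> s" "0 \<le> t" for s t
    unfolding k_def using that by (intro cSUP_upper q_bdd) auto
  have q_nonneg: "0 \<le> q s t" if "0 \<le> s" "0 \<le> t" for s t
    using that nonneg class_K_nonneg[OF \<theta>1K] by (simp add: q_def)
  have k_nonneg: "0 \<le> k s" if "0 \<le> s" for s
    using q_le[of s 0] q_nonneg[of s 0] that by simp
  have k_mono: "k r \<le> k s" if "0 \<le> r" "r \<le> s" for r s
    unfolding k_def
  proof (rule cSUP_mono)
    show "\<exists>t'\<in>{0..}. q r t \<le> q s t'" if "t \<in> {0..}" for t
      using that \<open>0 \<le> r\<close> \<open>r \<le> s\<close>
      by (intro bexI[of _ t]) (auto simp: q_def intro!: mult_left_mono class_K_mono[OF \<theta>1K] mono nonneg)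
  qed (use that q_bdd in auto)
  \<comment> \<open>The supremum \<open>k\<close> is monotone but possibly discontinuous;
    \<open>P (s + 1)\<close> is a continuous majorant of \<open>k s\<close>.\<close>
  define P where "P x = integral {0..x} k" for x
  have "mono_on {0..} k" by (intro mono_onI k_mono) auto
  note P = mono_primitive[OF this, folded P_def]
  have P_mono: "P r \<le> P s" if "0 \<le> r" "r \<le> s" for r s
    using P(2)[OF that] k_nonneg that by (smt (verit) mult_nonneg_nonneg)
  have P_ge: "k s \<le> P (s + 1)" if "0 \<le> s" for s
    using P(2)[of s "s+1"] P_mono[of 0 s] that by (simp add: P_def)
  \<comment> \<open>\<open>P (s + 1)\<close> bounds one factor
    \<open>exp t * sqrt (\<theta>1 (\<beta> s t))\<close>, the other square root vanishes with
    \<open>s\<close>, and the summand \<open>s\<close> enforces strict growth and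
    unboundedness.\<close>
  define \<theta>2 where "\<theta>2 s = P (s + 1) * sqrt (\<theta>1 (\<beta> s 0)) + s" for s
  have "class_K_inf \<theta>2"
  proof (rule class_K_infI)
    have "continuous_on {0..} (\<lambda>s. P (s + 1))"
      by (rule continuous_on_compose2[OF P(1)]) (auto intro!: continuous_intros)
    moreover have "continuous_on {0..} (\<lambda>s. \<theta>1 (\<beta> s 0))"
    proof (rule continuous_on_compose2[of "{0..}" \<theta>1 "{0..}" "\<lambda>s. \<beta> s 0"])
      show "continuous_on {0..} \<theta>1" using \<theta>1K by (simp add: class_K_def)
      show "continuous_on {0..} (\<lambda>s. \<beta> s 0)" using K[of 0] by (simp add: class_K_def)
      show "(\<lambda>s. \<beta> s 0) ` {0..} \<subseteq> {0..}" using nonneg by auto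
    qed
    ultimately show "continuous_on {0..} \<theta>2"
      unfolding \<theta>2_def by (intro continuous_on_add continuous_on_mult continuous_on_real_sqrt continuous_on_id)
    show "\<theta>2 r < \<theta>2 s" if "0 \<le> r" "r < s" for r s
    proof -
      have "P (r + 1) * sqrt (\<theta>1 (\<beta> r 0)) \<le> P (s + 1) * sqrt (\<theta>1 (\<beta> s 0))"
      proof (rule mult_mono)
        show "P (r + 1) \<le> P (s + 1)" using that by (intro P_mono) auto
        show "sqrt (\<theta>1 (\<beta> r 0)) \<le> sqrt (\<theta>1 (\<beta> s 0))"
          using that by (intro real_sqrt_le_mono class_K_mono[OF \<theta>1K] mono nonneg) auto
        show "0 \<le> P (s + 1)" using that P_ge[of s] k_nonneg[of s] by simp
        show "0 \<le> sqrt (\<theta>1 (\<beta> r 0))"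
          using that nonneg class_K_nonneg[OF \<theta>1K] by simp
      qed
      then show ?thesis using that by (simp add: \<theta>2_def)
    qed
    show "\<theta>2 0 = 0" using \<theta>1K K[of 0] by (simp add: \<theta>2_def class_K_def)
    show "\<exists>s\<ge>0. M < \<theta>2 s" for M
    proof (intro exI conjI)
      have "0 \<le> P (\<bar>M\<bar> + 1 + 1)" using P_ge[of "\<bar>M\<bar> + 1"] k_nonneg[of "\<bar>M\<bar> + 1"] by simp
      then have "0 \<le> P (\<bar>M\<bar> + 1 + 1) * sqrt (\<theta>1 (\<beta> (\<bar>M\<bar> + 1) 0))"
        using class_K_nonneg[OF \<theta>1K] nonneg by simp
      then show "M < \<theta>2 (\<bar>M\<bar> + 1)" by (simp add: \<theta>2_def)
    qed simp
  qed
  moreover have "exp t * \<theta>1 (\<beta> s t) \<le> \<theta>2 s" if "0 \<le> s" "0 \<le> t" for s t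
  proof -
    have "exp t * \<theta>1 (\<beta> s t) = q s t * sqrt (\<theta>1 (\<beta> s t))"
      using that by (simp add: q_def nonneg class_K_nonneg[OF \<theta>1K])
    also have "\<dots> \<le> P (s + 1) * sqrt (\<theta>1 (\<beta> s 0))"
    proof (rule mult_mono)
      show "q s t \<le> P (s + 1)" using q_le[of s t] P_ge[of s] that by simp
      show "sqrt (\<theta>1 (\<beta> s t)) \<le> sqrt (\<theta>1 (\<beta> s 0))"
        using that by (intro real_sqrt_le_mono class_K_mono[OF \<theta>1K] decr nonneg) auto
      show "0 \<le> P (s + 1)" using P_ge[of s] k_nonneg[of s] that by simp
      show "0 \<le> sqrt (\<theta>1 (\<beta> s t))"
        using that nonneg class_K_nonneg[OF \<theta>1K] by simp
    qed
    finally show ?thesis using that by (simp add: \<theta>2_def)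
  qed
  ultimately show ?thesis using \<theta>1(1) that by blast
qed

section \<open>Viscosity subdifferentials and the rescaling to exponential decay\<close>

text \<open>The remainder \<open>r\<close> is absorbed into a test function touching
  \<open>V\<close> from below and differentiable at the touching point. In this form the chain rule
  applies, both to a rescaling of the values and to a trajectory through
  \<open>\<xi>\<close>.\<close>

lemma viscosity_subdifferential_has_derivative:
  fixes V :: "'a::real_inner \<Rightarrow> real"
  shows "\<zeta> \<in> viscosity_subdifferential V \<xi> \<longleftrightarrow>
    (\<exists>\<phi>. (\<phi> has_derivative (\<lambda>k. \<zeta> \<bullet> k)) (at 0) \<and> \<phi> 0 = 0 \<and>
         (\<forall>\<^sub>F k in nhds 0. \<phi> k \<le> V (\<xi> + k) - V \<xi>))" (is "_ \<longleftrightarrow> ?R")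
proof
  assume "\<zeta> \<in> viscosity_subdifferential V \<xi>"
  then obtain r U where r: "((\<lambda>k. r k / norm k) \<longlongrightarrow> 0) (at 0)" and U: "open U" "0 \<in> U"
    and ge: "\<And>k. k \<in> U \<Longrightarrow> V (\<xi> + k) - V \<xi> - \<zeta> \<bullet> k \<ge> r k"
    by (auto simp: viscosity_subdifferential_def)
  \<comment> \<open>The limit of \<open>r k / norm k\<close> says nothing about \<open>r 0\<close>,
    which may be negative; the value at 0 has to be reset for \<open>\<phi>\<close> to be
    differentiable there.\<close>
  define \<phi> where "\<phi> k = (if k = 0 then 0 else \<zeta> \<bullet> k + r k)" for k
  have "((\<lambda>k. norm (r k / norm k)) \<longlongrightarrow> 0) (at 0)"
    using r by (rule tendsto_norm_zero)
  then have "((\<lambda>k. norm (\<phi> (0 + k) - \<phi> 0 - \<zeta> \<bullet> k) / norm k) \<longlongrightarrow> 0) (at 0)"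
    by (rule Lim_transform_eventually) (auto simp: \<phi>_def eventually_at_filter)
  then have "(\<phi> has_derivative (\<lambda>k. \<zeta> \<bullet> k)) (at 0)"
    by (simp add: has_derivative_at bounded_linear_inner_right)
  moreover have "\<forall>\<^sub>F k in nhds 0. \<phi> k \<le> V (\<xi> + k) - V \<xi>"
    unfolding eventually_nhds using U ge by (intro exI[of _ U]) (force simp: \<phi>_def)
  ultimately show ?R by (auto simp: \<phi>_def)
next
  assume ?R
  then obtain \<phi> U where \<phi>: "(\<phi> has_derivative (\<lambda>k. \<zeta> \<bullet> k)) (at 0)" "\<phi> 0 = 0" and U: "open U" "0 \<in> U"
    and ge: "\<And>k. k \<in> U \<Longrightarrow> \<phi> k \<le> V (\<xi> + k) - V \<xi>"
    unfolding eventually_nhds by blast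
  have "((\<lambda>k. (\<phi> k - \<zeta> \<bullet> k) / norm k) \<longlongrightarrow> 0) (at 0)"
  proof (rule tendsto_norm_zero_cancel)
    show "((\<lambda>k. norm ((\<phi> k - \<zeta> \<bullet> k) / norm k)) \<longlongrightarrow> 0) (at 0)"
      using \<phi> by (simp add: has_derivative_at)
  qed
  then show "\<zeta> \<in> viscosity_subdifferential V \<xi>"
    unfolding viscosity_subdifferential_def using U ge
    by (intro CollectI exI[of _ "\<lambda>k. \<phi> k - \<zeta> \<bullet> k"] exI[of _ U]) auto
qed

text \<open>\<open>\<phi>\<close> solves \<open>\<phi>' = \<phi> / a\<close> with
  \<open>a \<le> \<alpha>\<close>, so a quantity decaying at rate \<open>\<alpha>\<close> is mapped
  to one decaying at rate at least the identity. The derivative is stated for the inverse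
  \<open>\<psi>\<close>, because test functions for \<open>\<phi> \<circ> V\<close> have to be
  pulled back to \<open>V\<close>.\<close>

lemma exponential_rescaling:
  assumes "cont_pos_def \<alpha>"
  obtains \<phi> \<psi> d where "class_K_inf \<phi>" and "class_K_inf \<psi>"
    and "\<And>s. 0 \<le> s \<Longrightarrow> \<psi> (\<phi> s) = s" and "\<And>s. 0 \<le> s \<Longrightarrow> \<phi> (\<psi> s) = s"
    and "\<And>s. 0 < s \<Longrightarrow> 0 < d s" and "\<And>s. 0 < s \<Longrightarrow> (\<psi> has_real_derivative d s) (at (\<phi> s))"
    and "\<And>s. 0 < s \<Longrightarrow> d s * \<phi> s \<le> \<alpha> s"
proof -
  \<comment> \<open>The minimum with the identity makes \<open>G - ln\<close> nondecreasing. Hence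
    \<open>\<phi> s \<le> s\<close> on \<open>{0..1}\<close> and \<open>\<phi> s \<ge> s\<close>
    beyond 1, which yields continuity at 0 and unboundedness whatever \<open>\<alpha>\<close> looks
    like.\<close>
  define a where "a s = min (\<alpha> s) s" for s
  have a_pos: "0 < a s" if "0 < s" for s
    using assms that by (auto simp: a_def cont_pos_def_def)
  have a_cont: "continuous_on {0..} a"
    unfolding a_def using assms by (intro continuous_intros) (auto simp: cont_pos_def_def)
  define G where "G s = (LBINT y=ereal 1..ereal s. 1 / a y)" for s
  have G: "(G has_real_derivative 1 / a s) (at s)" if "0 < s" for s
  proof -
    have pos: "0 < y" if "y \<in> {min (s/2) 1..max (2 * s) 1}" for y
      using that \<open>0 < s\<close> by (auto simp: min_def split: if_splits)
    have "continuous_on {min (s/2) 1..max (2 * s) 1} (\<lambda>y. 1 / a y)"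
      using pos a_pos \<open>0 < s\<close> by (intro continuous_intros continuous_on_subset[OF a_cont]) (auto simp: less_imp_le less_imp_neq[symmetric])
    then have "(G has_vector_derivative 1 / a s) (at s within {min (s/2) 1..max (2 * s) 1})"
      unfolding G_def using that by (intro interval_integral_FTC2) (auto simp: min_def max_def)
    moreover have "at s within {min (s/2) 1..max (2 * s) 1} = at s"
      using that by (intro at_within_interior) (auto simp: min_def max_def)
    ultimately show ?thesis by (simp add: has_real_derivative_iff_has_vector_derivative)
  qed
  have G1: "G 1 = 0" by (simp add: G_def)
  have G_ln: "G r - ln r \<le> G s - ln s" if "0 < r" "r \<le> s" for r s
  proof (rule DERIV_nonneg_imp_nondecreasing[OF that(2)])
    fix x assume x: "r \<le> x" "x \<le> s"
    then have "((\<lambda>x. G x - ln x) has_real_derivative 1 / a x - 1 / x) (at x)"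
      using that by (auto intro!: derivative_eq_intros G)
    moreover have "1 / x \<le> 1 / a x"
      using x that a_pos[of x] by (intro divide_left_mono) (auto simp: a_def)
    ultimately show "\<exists>y. ((\<lambda>x. G x - ln x) has_real_derivative y) (at x) \<and> 0 \<le> y"
      by (intro exI[of _ "1 / a x - 1 / x"]) auto
  qed
  define \<phi> where "\<phi> s = (if s \<le> 0 then 0 else exp (G s))" for s
  have \<phi>_deriv: "(\<phi> has_real_derivative \<phi> s / a s) (at s)" if "0 < s" for s
  proof -
    have "((\<lambda>s. exp (G s)) has_real_derivative exp (G s) / a s) (at s)"
      by (auto intro!: derivative_eq_intros G[OF that])
    moreover have "\<forall>\<^sub>F x in nhds s. exp (G x) = \<phi> x"
      using that by (intro eventually_mono[OF eventually_nhds_in_open[of "{0<..}" s]]) (auto simp: \<phi>_def)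
    ultimately show ?thesis
      using that DERIV_cong_ev[of s s "\<lambda>x. exp (G x)" \<phi>] by (simp add: \<phi>_def)
  qed
  have \<phi>_nonneg: "0 \<le> \<phi> s" for s by (simp add: \<phi>_def)
  have \<phi>_ge: "s \<le> \<phi> s" if "1 \<le> s" for s
    using G_ln[of 1 s] that ln_le_cancel_iff[of s "exp (G s)"] by (simp add: \<phi>_def G1)
  have \<phi>_le: "\<phi> s \<le> s" if "0 \<le> s" "s \<le> 1" for s
    using G_ln[of s 1] that ln_ge_iff[of s "G s"] by (auto simp: \<phi>_def G1)
  have \<phi>_less: "\<phi> r < \<phi> s" if "0 \<le> r" "r < s" for r s
  proof (cases "r = 0")
    case True then show ?thesis using that by (simp add: \<phi>_def)
  next
    case False
    show ?thesis
    proof (rule DERIV_pos_imp_increasing[OF that(2)])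
      fix x assume "r \<le> x" "x \<le> s"
      then have "0 < x" using that False by simp
      then show "\<exists>y. (\<phi> has_real_derivative y) (at x) \<and> 0 < y"
        using a_pos[of x] by (intro exI[of _ "\<phi> x / a x"] conjI \<phi>_deriv) (auto simp: \<phi>_def)
    qed
  qed
  have "class_K_inf \<phi>"
  proof (rule class_K_infI)
    have "continuous (at x within {0..}) \<phi>" if "0 \<le> x" for x
    proof (cases "x = 0")
      case True
      have "(\<phi> \<longlongrightarrow> 0) (at 0 within {0..})"
      proof (rule tendsto_sandwich[where f = "\<lambda>_. 0" and h = "\<lambda>s. s"])
        show "\<forall>\<^sub>F s in at 0 within {0..}. \<phi> s \<le> s"
          unfolding eventually_at by (rule exI[of _ 1]) (auto intro: \<phi>_le)
      qed (auto simp: \<phi>_nonneg)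
      then show ?thesis using True by (simp add: continuous_within \<phi>_def)
    next
      case False
      then show ?thesis
        using that by (simp add: continuous_at_imp_continuous_at_within DERIV_isCont[OF \<phi>_deriv])
    qed
    then show "continuous_on {0..} \<phi>" by (simp add: continuous_on_eq_continuous_within)
    show "\<exists>s\<ge>0. M < \<phi> s" for M
      using \<phi>_ge[of "\<bar>M\<bar> + 1"] by (intro exI[of _ "\<bar>M\<bar> + 1"]) auto
    show "\<phi> 0 = 0" by (simp add: \<phi>_def)
  qed (rule \<phi>_less)
  then obtain \<psi> where \<psi>: "class_K_inf \<psi>" "\<And>s. 0 \<le> s \<Longrightarrow> \<psi> (\<phi> s) = s" "\<And>s. 0 \<le> s \<Longrightarrow> \<phi> (\<psi> s) = s"
    using class_K_inf_inverse by blast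
  have \<phi>_pos: "0 < \<phi> s" if "0 < s" for s using that by (simp add: \<phi>_def)
  have "(\<psi> has_real_derivative inverse (\<phi> s / a s)) (at (\<phi> s))" if "0 < s" for s
  proof (rule DERIV_inverse_function[where f = \<phi> and a = 0 and b = "\<phi> s + 1"])
    show "(\<phi> has_real_derivative \<phi> s / a s) (at (\<psi> (\<phi> s)))"
      using \<psi>(2)[of s] \<phi>_deriv[OF that] that by simp
    show "\<phi> s / a s \<noteq> 0" using \<phi>_pos[OF that] a_pos[OF that] by simp
    show "isCont \<psi> (\<phi> s)"
      using \<psi>(1) \<phi>_pos[OF that] by (intro continuous_on_interior[of "{0..}"]) (auto simp: class_K_inf_def class_K_def)
  qed (use \<phi>_pos[OF that] \<psi>(3) in auto)
  moreover have "inverse (\<phi> s / a s) * \<phi> s \<le> \<alpha> s" if "0 < s" for s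
    using \<phi>_pos[OF that] a_pos[OF that] by (simp add: a_def)
  moreover have "0 < inverse (\<phi> s / a s)" if "0 < s" for s
    using \<phi>_pos[OF that] a_pos[OF that] by simp
  ultimately show ?thesis
    using \<open>class_K_inf \<phi>\<close> \<psi> that[of \<phi> \<psi> "\<lambda>s. inverse (\<phi> s / a s)"] by blast
qed

text \<open>\<open>V\<close> need not be differentiable, so the chain rule is applied to test
  functions: composing a test function for \<open>\<phi> \<circ> V\<close> with the increasing map
  \<open>\<psi>\<close> gives one for \<open>V\<close>, with gradient scaled by
  \<open>d (V \<xi>)\<close>. This takes place where \<open>V\<close> is positive, as
  \<open>\<psi>\<close> has a derivative only there.\<close>

lemma lsc_lyapunov_imp_exp_lyapunov:
  assumes "class_K \<rho>" and "lsc_SIT_lyapunov F h g \<omega> \<rho> V" and \<omega>: "\<And>\<xi>. 0 \<le> \<omega> \<xi>"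
  shows "\<exists>W. lsc_exp_SIT_lyapunov F h g \<omega> \<rho> W"
proof -
  have lsc: "lower_semicontinuous V" and nonneg: "\<And>\<xi>. 0 \<le> V \<xi>"
    using assms(2) by (auto simp: lsc_SIT_lyapunov_def)
  obtain \<alpha>1 \<alpha>2 where \<alpha>: "class_K_inf \<alpha>1" "class_K_inf \<alpha>2"
    and bounds: "\<And>\<xi>. norm (h \<xi>) > \<rho> (norm (g \<xi>)) \<Longrightarrow> \<alpha>1 (norm (h \<xi>)) \<le> V \<xi> \<and> V \<xi> \<le> \<alpha>2 (\<omega> \<xi>)"
    using assms(2) by (auto simp: lsc_SIT_lyapunov_def)
  obtain \<alpha>3 where \<alpha>3: "cont_pos_def \<alpha>3" "SIT_decrease F h g \<rho> \<alpha>3 V"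
    using assms(2) by (auto simp: lsc_SIT_lyapunov_def)
  obtain \<phi> \<psi> d where \<phi>: "class_K_inf \<phi>" and \<psi>: "class_K_inf \<psi>"
    and inv: "\<And>s. 0 \<le> s \<Longrightarrow> \<psi> (\<phi> s) = s" "\<And>s. 0 \<le> s \<Longrightarrow> \<phi> (\<psi> s) = s"
    and d: "\<And>s. 0 < s \<Longrightarrow> 0 < d s" "\<And>s. 0 < s \<Longrightarrow> (\<psi> has_real_derivative d s) (at (\<phi> s))"
      "\<And>s. 0 < s \<Longrightarrow> d s * \<phi> s \<le> \<alpha>3 s"
    using exponential_rescaling[OF \<alpha>3(1)] by metis
  note K = \<phi>[THEN class_K_inf_imp_class_K] \<psi>[THEN class_K_inf_imp_class_K]
    \<alpha>[THEN class_K_inf_imp_class_K]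
  have pos: "0 < norm (h \<xi>)" if "norm (h \<xi>) > \<rho> (norm (g \<xi>))" for \<xi>
    using that class_K_nonneg[OF assms(1) norm_ge_zero, of "g \<xi>"] by linarith
  have V_pos: "0 < V \<xi>" if "norm (h \<xi>) > \<rho> (norm (g \<xi>))" for \<xi>
  proof -
    have "0 < \<alpha>1 (norm (h \<xi>))" using class_K_less[OF K(3), of 0] pos[OF that] K(3) by (simp add: class_K_def)
    then show ?thesis using bounds[OF that] by simp
  qed
  define W where "W \<xi> = \<phi> (V \<xi>)" for \<xi>
  have W_nonneg: "0 \<le> W \<xi>" for \<xi> using class_K_nonneg[OF K(1) nonneg] by (simp add: W_def)
  have W_lsc: "lower_semicontinuous W"
    unfolding lower_semicontinuous_def
  proof (intro allI impI)
    fix \<xi> c assume c: "c < W \<xi>"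
    show "\<forall>\<^sub>F \<eta> in nhds \<xi>. c < W \<eta>"
    proof (cases "c < 0")
      case True
      then have "c < W \<eta>" for \<eta> using W_nonneg[of \<eta>] by simp
      then show ?thesis by simp
    next
      case False
      then have "\<psi> c < V \<xi>"
        using c class_K_less_iff[OF K(2), of c "W \<xi>"] W_nonneg[of \<xi>] inv(1)[OF nonneg] by (simp add: W_def)
      then have "\<forall>\<^sub>F \<eta> in nhds \<xi>. \<psi> c < V \<eta>"
        using lsc by (simp add: lower_semicontinuous_def)
      then show ?thesis
      proof eventually_elim
        case (elim \<eta>)
        then show ?case
          using False class_K_less[OF K(1), of "\<psi> c" "V \<eta>"] class_K_nonneg[OF K(2), of c] inv(2)[of c]
          by (simp add: W_def)
      qed
    qed
  qed
  have "SIT_decrease F h g \<rho> (\<lambda>r. r) W"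
    unfolding SIT_decrease_def
  proof (intro allI impI ballI)
    fix \<xi> \<zeta> v
    assume D: "norm (h \<xi>) > \<rho> (norm (g \<xi>))" and \<zeta>: "\<zeta> \<in> viscosity_subdifferential W \<xi>" and v: "v \<in> F \<xi>"
    note V = V_pos[OF D]
    obtain u where u: "(u has_derivative (\<lambda>k. \<zeta> \<bullet> k)) (at 0)" "u 0 = 0"
      and le: "\<forall>\<^sub>F k in nhds 0. u k \<le> W (\<xi> + k) - W \<xi>"
      using \<zeta> unfolding viscosity_subdifferential_has_derivative by blast
    define u' where "u' k = \<psi> (W \<xi> + u k) - V \<xi>" for k
    have "(\<psi> has_derivative (\<lambda>x. d (V \<xi>) * x)) (at (W \<xi> + u 0))"
      using d(2)[OF V] u(2) by (simp add: W_def has_field_derivative_def)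
    moreover have "((\<lambda>k. W \<xi> + u k) has_derivative (\<lambda>k. \<zeta> \<bullet> k)) (at 0)"
      using u(1) by (auto intro!: derivative_eq_intros)
    ultimately have "((\<lambda>k. \<psi> (W \<xi> + u k)) has_derivative (\<lambda>k. d (V \<xi>) * (\<zeta> \<bullet> k))) (at 0)"
      by (rule has_derivative_compose[rotated])
    then have "(u' has_derivative (\<lambda>k. (d (V \<xi>) *\<^sub>R \<zeta>) \<bullet> k)) (at 0)"
      unfolding u'_def by (auto intro!: derivative_eq_intros)
    moreover have "u' 0 = 0" using u(2) inv(1)[OF nonneg] by (simp add: u'_def W_def)
    moreover have "\<forall>\<^sub>F k in nhds 0. u' k \<le> V (\<xi> + k) - V \<xi>"
    proof -
      \<comment> \<open>Monotonicity of \<open>\<psi>\<close> is known on \<open>{0..}\<close> only,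
        so the test function must be kept nonnegative near 0.\<close>
      have "0 < W \<xi> + u 0" using class_K_less[OF K(1), of 0 "V \<xi>"] V K(1) u(2) by (simp add: W_def class_K_def)
      moreover have "isCont (\<lambda>k. W \<xi> + u k) 0"
        using has_derivative_continuous[OF u(1)] by (intro continuous_intros)
      ultimately have "\<forall>\<^sub>F k in nhds 0. 0 < W \<xi> + u k"
        by (metis continuous_at eventually_nhds_conv_at order_tendstoD(1))
      with le show ?thesis
      proof eventually_elim
        case (elim k)
        then have "\<psi> (W \<xi> + u k) \<le> \<psi> (W (\<xi> + k))" by (intro class_K_mono[OF K(2)]) auto
        then show ?case using inv(1)[OF nonneg] by (simp add: u'_def W_def)
      qed
    qed
    ultimately have "d (V \<xi>) *\<^sub>R \<zeta> \<in> viscosity_subdifferential V \<xi>"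
      unfolding viscosity_subdifferential_has_derivative by blast
    then have "d (V \<xi>) * (\<zeta> \<bullet> v) \<le> - \<alpha>3 (V \<xi>)"
      using \<alpha>3(2) D v unfolding SIT_decrease_def by fastforce
    then have "d (V \<xi>) * (\<zeta> \<bullet> v + W \<xi>) \<le> 0" using d(3)[OF V] by (simp add: W_def algebra_simps)
    then show "\<zeta> \<bullet> v \<le> - W \<xi>" using d(1)[OF V] by (simp add: mult_le_0_iff)
  qed
  moreover have "cont_pos_def (\<lambda>r. r)" by (auto simp: cont_pos_def_def continuous_on_id)
  moreover have "class_K_inf (\<phi> \<circ> \<alpha>1)" "class_K_inf (\<phi> \<circ> \<alpha>2)"
    using class_K_inf_compose \<phi> \<alpha> by blast+
  moreover have "(\<phi> \<circ> \<alpha>1) (norm (h \<xi>)) \<le> W \<xi> \<and> W \<xi> \<le> (\<phi> \<circ> \<alpha>2) (\<omega> \<xi>)"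
    if "norm (h \<xi>) > \<rho> (norm (g \<xi>))" for \<xi>
    using bounds[OF that] nonneg class_K_nonneg[OF K(3)]
    by (auto simp: W_def intro!: class_K_mono[OF K(1)])
  ultimately show ?thesis
    using W_lsc W_nonneg unfolding lsc_exp_SIT_lyapunov_def lsc_SIT_lyapunov_def by blast
qed

section \<open>Absolutely continuous functions\<close>

lemma abs_cont_onE:
  assumes "abs_cont_on a b f" and "0 < e"
  obtains \<delta> where "0 < \<delta>" and "\<And>I :: (real \<times> real) set. finite I \<Longrightarrow> \<forall>(c, d)\<in>I. a \<le> c \<and> c \<le> d \<and> d \<le> b \<Longrightarrow>
      pairwise (\<lambda>p q. {fst p<..<snd p} \<inter> {fst q<..<snd q} = {}) I \<Longrightarrow>
      (\<Sum>(c, d)\<in>I. d - c) < \<delta> \<Longrightarrow> (\<Sum>(c, d)\<in>I. norm (f d - f c)) < e"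
  using assms unfolding abs_cont_on_def by auto

text \<open>Intended for the penalised values along a solution, whose increments are controlled by
  elapsed time and by the increment of the solution. Lipschitz functions are covered by taking
  \<open>f\<close> constant.\<close>

lemma abs_cont_on_dominated:
  fixes f :: "real \<Rightarrow> 'a::real_normed_vector" and u :: "real \<Rightarrow> 'b::real_normed_vector"
  assumes f: "abs_cont_on a b f" and "0 \<le> C"
    and le: "\<And>s t. a \<le> s \<Longrightarrow> s \<le> t \<Longrightarrow> t \<le> b \<Longrightarrow> norm (u t - u s) \<le> C * (t - s) + C * norm (f t - f s)"
  shows "abs_cont_on a b u"
  unfolding abs_cont_on_def
proof (intro allI impI)
  fix e :: real assume "0 < e"
  define e' where "e' = e / (2 * (C + 1))"
  have "0 < e'" using \<open>0 < e\<close> \<open>0 \<le> C\<close> by (simp add: e'_def)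
  then obtain d where d: "0 < d" and small: "\<And>I :: (real \<times> real) set. finite I \<Longrightarrow> \<forall>(c, d)\<in>I. a \<le> c \<and> c \<le> d \<and> d \<le> b \<Longrightarrow>
      pairwise (\<lambda>p q. {fst p<..<snd p} \<inter> {fst q<..<snd q} = {}) I \<Longrightarrow>
      (\<Sum>(c, d)\<in>I. d - c) < d \<Longrightarrow> (\<Sum>(c, d)\<in>I. norm (f d - f c)) < e'"
    by - (rule abs_cont_onE[OF f \<open>0 < e'\<close>], blast)
  show "\<exists>\<delta>>0. \<forall>I :: (real \<times> real) set. finite I \<and> (\<forall>(c, d)\<in>I. a \<le> c \<and> c \<le> d \<and> d \<le> b) \<and>
      pairwise (\<lambda>p q. {fst p<..<snd p} \<inter> {fst q<..<snd q} = {}) I \<and> (\<Sum>(c, d)\<in>I. d - c) < \<delta>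
        \<longrightarrow> (\<Sum>(c, d)\<in>I. norm (u d - u c)) < e"
  proof (intro exI[of _ "min d e'"] conjI allI impI)
    show "0 < min d e'" using d \<open>0 < e'\<close> by simp
    fix I :: "(real \<times> real) set"
    assume "finite I \<and> (\<forall>(c, d)\<in>I. a \<le> c \<and> c \<le> d \<and> d \<le> b) \<and>
      pairwise (\<lambda>p q. {fst p<..<snd p} \<inter> {fst q<..<snd q} = {}) I \<and> (\<Sum>(c, d)\<in>I. d - c) < min d e'"
    then have I: "finite I" "\<forall>(c, d)\<in>I. a \<le> c \<and> c \<le> d \<and> d \<le> b"
      "pairwise (\<lambda>p q. {fst p<..<snd p} \<inter> {fst q<..<snd q} = {}) I"
      and len: "(\<Sum>(c, d)\<in>I. d - c) < d" "(\<Sum>(c, d)\<in>I. d - c) < e'" by auto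
    have "(\<Sum>(c, d)\<in>I. norm (u d - u c)) \<le> (\<Sum>(c, d)\<in>I. C * (d - c) + C * norm (f d - f c))"
      using I(2) le by (intro sum_mono) auto
    also have "\<dots> = C * (\<Sum>(c, d)\<in>I. d - c) + C * (\<Sum>(c, d)\<in>I. norm (f d - f c))"
      by (simp add: sum.distrib sum_distrib_left case_prod_unfold)
    also have "\<dots> \<le> C * e' + C * e'"
      using len(2) small[OF I len(1)] \<open>0 \<le> C\<close> by (intro add_mono mult_left_mono) auto
    also have "\<dots> < (C + 1) * e' + (C + 1) * e'"
      using \<open>0 < e'\<close> by (simp add: algebra_simps)
    also have "\<dots> = e' * (2 * (C + 1))" by (simp add: algebra_simps)
    also have "\<dots> = e" using \<open>0 \<le> C\<close> by (simp add: e'_def)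
    finally show "(\<Sum>(c, d)\<in>I. norm (u d - u c)) < e" .
  qed
qed

lemma abs_cont_on_const: "abs_cont_on a b (\<lambda>_. c)"
  unfolding abs_cont_on_def by (auto intro!: exI[of _ 1] simp: case_prod_unfold)

lemma lipschitz_on_imp_abs_cont_on:
  fixes f :: "real \<Rightarrow> 'a::real_normed_vector"
  assumes "L-lipschitz_on {a..b} f"
  shows "abs_cont_on a b f"
  using abs_cont_on_const[of a b "0::real"] lipschitz_on_nonneg[OF assms]
proof (rule abs_cont_on_dominated)
  fix s t assume "a \<le> s" "s \<le> t" "t \<le> b"
  then show "norm (f t - f s) \<le> L * (t - s) + L * norm ((0::real) - 0)"
    using lipschitz_onD[OF assms, of t s] by (simp add: dist_norm)
qed

lemma abs_cont_on_imp_continuous_on: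
  assumes "abs_cont_on a b f"
  shows "continuous_on {a..b} f"
  unfolding continuous_on_iff
proof (intro ballI allI impI)
  fix t and e :: real assume t: "t \<in> {a..b}" and "0 < e"
  then obtain d where d: "0 < d" and small: "\<And>I :: (real \<times> real) set. finite I \<Longrightarrow> \<forall>(c, d)\<in>I. a \<le> c \<and> c \<le> d \<and> d \<le> b \<Longrightarrow>
      pairwise (\<lambda>p q. {fst p<..<snd p} \<inter> {fst q<..<snd q} = {}) I \<Longrightarrow>
      (\<Sum>(c, d)\<in>I. d - c) < d \<Longrightarrow> (\<Sum>(c, d)\<in>I. norm (f d - f c)) < e"
    by - (rule abs_cont_onE[OF assms \<open>0 < e\<close>], blast)
  show "\<exists>d>0. \<forall>s\<in>{a..b}. dist s t < d \<longrightarrow> dist (f s) (f t) < e"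
  proof (intro exI[of _ d] conjI ballI impI d)
    fix s assume "s \<in> {a..b}" "dist s t < d"
    then show "dist (f s) (f t) < e"
      using small[of "{(min s t, max s t)}"] t
      by (cases "s \<le> t") (auto simp: min_def max_def dist_norm norm_minus_commute split: if_splits)
  qed
qed

text \<open>The exceptional null set is covered by a small open set \<open>G\<close>; the inequality
  \<open>f t \<le> f a + \<eta> (t - a) + (variation of f over G)\<close> then propagates to the right by continuous induction.\<close>

lemma abs_cont_on_nonincreasing:
  fixes f :: "real \<Rightarrow> real"
  assumes f: "abs_cont_on a b f" and "a \<le> b" and N: "negligible N"
    and dini: "\<And>t \<eta>. t \<in> {a..<b} - N \<Longrightarrow> 0 < \<eta> \<Longrightarrow> \<forall>\<^sub>F s in at_right t. f s - f t \<le> \<eta> * (s - t)"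
  shows "f b \<le> f a"
proof (rule field_le_epsilon)
  fix e :: real assume "0 < e"
  \<comment> \<open>The error \<open>e\<close> is split in three: the slope term over the whole
    interval, the slack in the induction, and the variation over the exceptional set. Adding 1
    covers \<open>a = b\<close>.\<close>
  define \<eta> where "\<eta> = e / 3 / (b - a + 1)"
  have \<eta>: "0 < \<eta>" "\<eta> * (b - a) \<le> e / 3"
    using \<open>0 < e\<close> \<open>a \<le> b\<close> by (auto simp: \<eta>_def field_simps)
  obtain d where d: "0 < d" and small: "\<And>I :: (real \<times> real) set. finite I \<Longrightarrow> \<forall>(c, d)\<in>I. a \<le> c \<and> c \<le> d \<and> d \<le> b \<Longrightarrow>
      pairwise (\<lambda>p q. {fst p<..<snd p} \<inter> {fst q<..<snd q} = {}) I \<Longrightarrow>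
      (\<Sum>(c, d)\<in>I. d - c) < d \<Longrightarrow> (\<Sum>(c, d)\<in>I. norm (f d - f c)) < e / 3"
    using \<open>0 < e\<close> by - (rule abs_cont_onE[OF f, of "e / 3"], simp, blast)
  obtain G where G: "open G" "N \<subseteq> G" "G - N \<in> lmeasurable" "emeasure lebesgue (G - N) < ennreal d"
    using sets_lebesgue_outer_open[OF negligible_imp_sets[OF N] d] by blast
  then have "measure lebesgue (G - N) < d" by (simp add: emeasure_eq_measure2 ennreal_less_iff)
  have N': "N \<in> lmeasurable" "measure lebesgue N = 0"
    using N by (simp_all add: negligible_iff_measure)
  have "G = (G - N) \<union> N" using G by auto
  then have G_meas: "G \<in> lmeasurable" "measure lebesgue G < d"
    using \<open>measure lebesgue (G - N) < d\<close> G(3) N' fmeasurable.Un[OF G(3) N'(1)] measure_Un_le[of "G - N" lebesgue N]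
    by (auto simp: fmeasurableD)
  have f_cont: "continuous_on {a..b} f" by (rule abs_cont_on_imp_continuous_on[OF f])
  \<comment> \<open>Families of admissible intervals ending by \<open>t\<close>. Because all of them
    end by \<open>t\<close>, an interval starting at \<open>t\<close> can be appended without
    overlap.\<close>
  define ok where "ok t I \<longleftrightarrow> finite I \<and> (\<forall>(c, d)\<in>I. a \<le> c \<and> c < d \<and> d \<le> t \<and> {c..d} \<subseteq> G) \<and>
    pairwise (\<lambda>p q. {fst p<..<snd p} \<inter> {fst q<..<snd q} = {}) I" for t :: real and I :: "(real \<times> real) set"
  define var where "var I = (\<Sum>(c, d)\<in>I. \<bar>f d - f c\<bar>)" for I
  \<comment> \<open>The slack \<open>\<kappa>\<close> lets the property pass to a limit from the
    left: continuity of \<open>f\<close> uses up part of it, and the family may depend on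
    it.\<close>
  define P where "P t \<longleftrightarrow> (\<forall>\<kappa>>0. \<exists>I. ok t I \<and> f t \<le> f a + \<eta> * (t - a) + \<kappa> + var I)" for t
  have ok_mono: "ok t I" if "ok s I" "s \<le> t" for s t I
    using that unfolding ok_def by fastforce
  have P_a: "P a"
    unfolding P_def by (intro allI impI exI[of _ "{}"]) (auto simp: ok_def var_def)
  have P_left: "P t" if t: "a < t" "t \<le> b" and approx: "\<And>r. r < t \<Longrightarrow> \<exists>s>r. s < t \<and> a \<le> s \<and> P s" for t
    unfolding P_def
  proof (intro allI impI)
    fix \<kappa> :: real assume "0 < \<kappa>"
    then obtain \<delta> where \<delta>: "0 < \<delta>" "\<And>s. s \<in> {a..b} \<Longrightarrow> \<bar>s - t\<bar> < \<delta> \<Longrightarrow> \<bar>f s - f t\<bar> < \<kappa> / 2"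
      using f_cont t unfolding continuous_on_iff dist_real_def by (metis atLeastAtMost_iff half_gt_zero less_eq_real_def)
    obtain s where s: "t - \<delta> < s" "s < t" "a \<le> s" "P s" using approx[of "t - \<delta>"] \<delta>(1) by auto
    then obtain I where I: "ok s I" "f s \<le> f a + \<eta> * (s - a) + \<kappa> / 2 + var I"
      using \<open>0 < \<kappa>\<close> unfolding P_def by (meson half_gt_zero)
    have "\<bar>f s - f t\<bar> < \<kappa> / 2" using \<delta>(2)[of s] s t by auto
    then have "f t < f s + \<kappa> / 2" by linarith
    moreover have "\<eta> * (s - a) \<le> \<eta> * (t - a)" using \<eta> s by (intro mult_left_mono) auto
    ultimately have "f t \<le> f a + \<eta> * (t - a) + \<kappa> + var I" using I(2) by linarith
    then show "\<exists>I. ok t I \<and> f t \<le> f a + \<eta> * (t - a) + \<kappa> + var I"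
      using ok_mono[OF I(1)] s by (intro exI[of _ I]) auto
  qed
  have P_right: "\<exists>s>t. s \<le> b \<and> (\<forall>r\<in>{t..s}. P r)" if t: "a \<le> t" "t < b" "P t" for t
  proof (cases "t \<in> N")
    case True
    then obtain \<delta> where \<delta>: "0 < \<delta>" "cball t \<delta> \<subseteq> G"
      using G open_contains_cball by blast
    have "P r" if r: "t < r" "r \<le> t + \<delta>" for r
      unfolding P_def
    proof (intro allI impI)
      fix \<kappa> :: real assume "0 < \<kappa>"
      then obtain I where I: "ok t I" "f t \<le> f a + \<eta> * (t - a) + \<kappa> + var I"
        using t(3) unfolding P_def by blast
      have "{t..r} \<subseteq> G" using \<delta>(2) r by (auto simp: cball_def dist_real_def subset_eq)
      moreover have "(t, r) \<notin> I" using I(1) r by (auto simp: ok_def)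
      moreover have "ok r (insert (t, r) I)"
        using I(1) r t \<open>{t..r} \<subseteq> G\<close> unfolding ok_def pairwise_insert by fastforce
      moreover have "var (insert (t, r) I) = \<bar>f r - f t\<bar> + var I"
        using I(1) \<open>(t, r) \<notin> I\<close> by (simp add: ok_def var_def)
      moreover have "\<eta> * (t - a) \<le> \<eta> * (r - a)" using \<eta> r by (intro mult_left_mono) auto
      ultimately show "\<exists>I. ok r I \<and> f r \<le> f a + \<eta> * (r - a) + \<kappa> + var I"
        using I(2) by (intro exI[of _ "insert (t, r) I"]) auto
    qed
    then have "P r" if "r \<in> {t..min b (t + \<delta>)}" for r
      using that t(3) by (cases "r = t") auto
    then show ?thesis
      using t \<delta>(1) by (intro exI[of _ "min b (t + \<delta>)"]) auto
  next
    case False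
    then obtain s where s: "t < s" "\<And>r. t < r \<Longrightarrow> r < s \<Longrightarrow> f r - f t \<le> \<eta> * (r - t)"
      using dini[of t \<eta>] t \<eta> unfolding eventually_at_right[OF t(2)] by auto
    have "P r" if r: "t < r" "r < s" for r
      unfolding P_def
    proof (intro allI impI)
      fix \<kappa> :: real assume "0 < \<kappa>"
      then obtain I where I: "ok t I" "f t \<le> f a + \<eta> * (t - a) + \<kappa> + var I"
        using t(3) unfolding P_def by blast
      then have "f r \<le> f a + \<eta> * (r - a) + \<kappa> + var I" using s(2)[OF r] by (simp add: algebra_simps)
      then show "\<exists>I. ok r I \<and> f r \<le> f a + \<eta> * (r - a) + \<kappa> + var I"
        using ok_mono[OF I(1)] r by (intro exI[of _ I]) auto
    qed
    then have "P r" if "r \<in> {t..min b ((t + s) / 2)}" for r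
      using that t(3) s(1) by (cases "r = t") auto
    then show ?thesis
      using t s(1) by (intro exI[of _ "min b ((t + s) / 2)"]) auto
  qed
  define S where "S = {t. a \<le> t \<and> t \<le> b \<and> P t}"
  have S: "a \<in> S" "bdd_above S" using P_a \<open>a \<le> b\<close> by (auto simp: S_def intro!: bdd_aboveI[of _ b])
  define m where "m = Sup S"
  have m: "a \<le> m" "m \<le> b"
    unfolding m_def using S by (auto intro!: cSup_upper cSup_least simp: S_def)
  have "P m"
  proof (cases "m \<in> S")
    case False
    then have "a < m" using m P_a S by (cases "a = m") auto
    moreover have "\<exists>s>r. s < m \<and> a \<le> s \<and> P s" if "r < m" for r
    proof -
      obtain s where "s \<in> S" "r < s"
        using less_cSup_iff[of S r] S \<open>r < m\<close> unfolding m_def by blast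
      moreover have "s \<le> m" using S \<open>s \<in> S\<close> by (auto simp: m_def intro: cSup_upper)
      ultimately show ?thesis using False by (intro exI[of _ s]) (auto simp: S_def le_less)
    qed
    ultimately show ?thesis using P_left m by blast
  qed (simp add: S_def)
  moreover have "m = b"
  proof (rule ccontr)
    assume "m \<noteq> b"
    then obtain s where "m < s" "s \<le> b" "P s" using P_right[of m] m \<open>P m\<close> by fastforce
    then have "s \<in> S" using m by (simp add: S_def)
    then have "s \<le> m" unfolding m_def using S by (intro cSup_upper)
    then show False using \<open>m < s\<close> by simp
  qed
  ultimately obtain I where I: "ok b I" "f b \<le> f a + \<eta> * (b - a) + e / 3 + var I"
    using \<open>0 < e\<close> unfolding P_def by (meson divide_pos_pos zero_less_numeral)
  \<comment> \<open>The intervals are disjoint up to endpoints and lie in \<open>G\<close>, so their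
    total length is below \<open>d\<close>, and absolute continuity bounds the variation collected
    in \<open>var I\<close>.\<close>
  have "(\<Sum>(c, d)\<in>I. d - c) = (\<Sum>p\<in>I. measure lebesgue {fst p<..<snd p})"
    using I(1) by (intro sum.cong) (auto simp: ok_def)
  also have "\<dots> = measure lebesgue (\<Union>p\<in>I. {fst p<..<snd p})"
    using I(1) by (intro measure_UNION'[symmetric]) (auto simp: ok_def pairwise_def disjnt_def)
  also have "\<dots> \<le> measure lebesgue G"
  proof (rule measure_mono_fmeasurable)
    have "{fst p<..<snd p} \<subseteq> G" if "p \<in> I" for p
    proof -
      have "{fst p..snd p} \<subseteq> G" using I(1) that by (auto simp: ok_def case_prod_unfold)
      then show ?thesis using greaterThanLessThan_subseteq_atLeastAtMost_iff by blast
    qed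
    then show "(\<Union>p\<in>I. {fst p<..<snd p}) \<subseteq> G" by blast
    show "(\<Union>p\<in>I. {fst p<..<snd p}) \<in> sets lebesgue"
      using I(1) by (intro sets.finite_UN) (auto simp: ok_def)
  qed (rule G_meas(1))
  also have "\<dots> < d" by (rule G_meas(2))
  finally have "(\<Sum>(c, d)\<in>I. norm (f d - f c)) < e / 3"
    using I(1) by (intro small) (auto simp: ok_def less_imp_le)
  then have "var I < e / 3" by (simp add: var_def)
  then show "f b \<le> f a + e" using I(2) \<eta>(2) by linarith
qed

section \<open>Lower semicontinuous functions\<close>

lemma lower_semicontinuous_closed_sublevel:
  assumes "lower_semicontinuous V"
  shows "closed {z. V z \<le> a}"
proof -
  have "open {z. a < V z}"
    unfolding open_subopen[of "{z. a < V z}"]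
    using assms by (fastforce simp: lower_semicontinuous_def eventually_nhds)
  moreover have "{z. V z \<le> a} = - {z. a < V z}" by auto
  ultimately show ?thesis by (simp add: closed_def)
qed

lemma lower_semicontinuous_scale_add:
  fixes V :: "'a::topological_space \<Rightarrow> real"
  assumes "lower_semicontinuous V" and "0 < A" and "continuous_on UNIV f"
  shows "lower_semicontinuous (\<lambda>z. A * V z + f z)"
  unfolding lower_semicontinuous_def
proof (intro allI impI)
  fix z c assume c: "c < A * V z + f z"
  define e where "e = (A * V z + f z - c) / 2"
  have "e > 0" using c by (simp add: e_def)
  have "V z - e / A < V z" using \<open>0 < A\<close> \<open>0 < e\<close> by simp
  then have "\<forall>\<^sub>F y in nhds z. V z - e / A < V y"
    using assms(1) unfolding lower_semicontinuous_def by blast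
  moreover have "(f \<longlongrightarrow> f z) (at z)"
    using assms(3) by (simp add: continuous_on_def)
  then have "\<forall>\<^sub>F y in at z. f z - e < f y"
    using \<open>0 < e\<close> by (intro order_tendstoD(1)) auto
  then have "\<forall>\<^sub>F y in nhds z. f z - e < f y"
    using \<open>0 < e\<close> by (simp add: eventually_nhds_conv_at)
  ultimately show "\<forall>\<^sub>F y in nhds z. c < A * V y + f y"
  proof eventually_elim
    case (elim y)
    have "A * V z - e < A * V y" using elim(1) \<open>0 < A\<close> by (simp add: field_simps)
    then show ?case using elim(2) by (simp add: e_def field_simps)
  qed
qed

text \<open>As \<open>V\<close> is nonnegative, the quadratic term bounds the sublevel sets and
  lower semicontinuity closes them. Sublevels at heights decreasing to the infimum are nested
  nonempty compact sets, and a common point is a minimiser.\<close>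

lemma lower_semicontinuous_penalty_attains_min:
  fixes V :: "'a::euclidean_space \<Rightarrow> real"
  assumes "lower_semicontinuous V" and "\<And>z. 0 \<le> V z" and "0 < A" and "0 < c"
  shows "\<exists>z. \<forall>z'. A * V z + c * (norm (z - p))\<^sup>2 \<le> A * V z' + c * (norm (z' - p))\<^sup>2"
proof -
  define q where "q z = A * V z + c * (norm (z - p))\<^sup>2" for z
  have q: "lower_semicontinuous q"
    unfolding q_def by (intro lower_semicontinuous_scale_add assms continuous_intros)
  have q_ge: "c * (norm (z - p))\<^sup>2 \<le> q z" for z using assms by (simp add: q_def)
  have q_nonneg: "0 \<le> q z" for z using assms by (simp add: q_def)
  define m where "m = Inf (range q)"
  have m_le: "m \<le> q z" for z
    unfolding m_def using q_nonneg by (intro cInf_lower) (auto intro!: bdd_belowI[of _ 0])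
  define S where "S n = {z. q z \<le> m + 1 / real (Suc n)}" for n
  have "\<Inter> (range S) \<noteq> {}"
  proof (rule compact_nest)
    fix n
    have "\<exists>y\<in>range q. y < m + 1 / real (Suc n)"
      unfolding m_def by (rule cInf_lessD) auto
    then show "S n \<noteq> {}" by (auto simp: S_def intro: less_imp_le)
    have "bounded (S n)"
    proof (rule boundedI)
      fix z assume "z \<in> S n"
      then have "q z \<le> m + 1" by (simp add: S_def) (smt (verit) divide_le_eq_1 of_nat_0_le_iff)
      then have "(norm (z - p))\<^sup>2 \<le> (m + 1) / c"
        using q_ge[of z] \<open>0 < c\<close> by (simp add: field_simps)
      then have "norm (z - p) \<le> sqrt ((m + 1) / c)" by (simp add: real_le_rsqrt)
      then show "norm z \<le> norm p + sqrt ((m + 1) / c)"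
        using norm_triangle_ineq[of "z - p" p] by simp
    qed
    then show "compact (S n)"
      using lower_semicontinuous_closed_sublevel[OF q] by (simp add: S_def compact_eq_bounded_closed)
  next
    fix k n :: nat assume "k \<le> n"
    then have "1 / real (Suc n) \<le> 1 / real (Suc k)" by (simp add: frac_le)
    then show "S n \<subseteq> S k" by (auto simp: S_def)
  qed
  then obtain z where z: "\<And>n. q z \<le> m + 1 / real (Suc n)" by (auto simp: S_def)
  have "q z \<le> m"
  proof (rule field_le_epsilon)
    fix e :: real assume "0 < e"
    then obtain n where "1 / real (Suc n) < e" by (metis nat_approx_posE)
    then show "q z \<le> m + e" using z[of n] by simp
  qed
  then show ?thesis using m_le unfolding q_def by (meson order_trans)
qed

section \<open>Lipschitz set-valued maps\<close>

text \<open>Uniform constants on a tube around \<open>N\<close>. Half a Lebesgue number of a finite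
  subcover serves as radius, so that each closed ball fits into one member of the cover.\<close>

lemma locally_lipschitz_setvalued_compact:
  fixes F :: "'a::euclidean_space \<Rightarrow> 'a set"
  assumes F: "locally_lipschitz_setvalued F" "\<And>\<xi>. compact (F \<xi>)" and "compact N"
  obtains r L M where "0 < r" and "0 < L" and "0 < M"
    and "\<And>c \<eta> \<zeta> w. c \<in> N \<Longrightarrow> \<eta> \<in> cball c r \<Longrightarrow> \<zeta> \<in> cball c r \<Longrightarrow> w \<in> F \<eta> \<Longrightarrow>
           \<exists>w'\<in>F \<zeta>. norm (w - w') \<le> L * norm (\<eta> - \<zeta>)"
    and "\<And>c \<eta> w. c \<in> N \<Longrightarrow> \<eta> \<in> cball c r \<Longrightarrow> w \<in> F \<eta> \<Longrightarrow> norm w \<le> M"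
proof -
  have "\<exists>e K. 0 < e \<and> 0 < K \<and> (\<forall>\<eta>\<in>ball \<xi> e. \<forall>w\<in>F \<eta>. norm w \<le> K \<and>
      (\<forall>\<zeta>\<in>ball \<xi> e. \<exists>w'\<in>F \<zeta>. norm (w - w') \<le> K * norm (\<eta> - \<zeta>)))" for \<xi>
  proof -
    obtain U L where UL: "open U \<and> \<xi> \<in> U \<and> L > 0 \<and> (\<forall>\<eta>\<in>U. \<forall>\<zeta>\<in>U.
        F \<eta> \<subseteq> {z + (L * norm (\<eta> - \<zeta>)) *\<^sub>R b | z b. z \<in> F \<zeta> \<and> b \<in> cball 0 1})"
      using F(1)[unfolded locally_lipschitz_setvalued_def, rule_format, of \<xi>] by (elim exE)
    then have U: "open U" "\<xi> \<in> U" "L > 0" by auto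
    have near: "\<exists>w'\<in>F \<zeta>. norm (w - w') \<le> L * norm (\<eta> - \<zeta>)" if mem: "\<eta> \<in> U" "\<zeta> \<in> U" "w \<in> F \<eta>" for \<eta> \<zeta> w
    proof -
      obtain z b where zb: "w = z + (L * norm (\<eta> - \<zeta>)) *\<^sub>R b" "z \<in> F \<zeta>" "norm b \<le> 1"
        using mem(3) bspec[OF bspec[OF conjunct2[OF conjunct2[OF conjunct2[OF UL]]] mem(1)] mem(2)] by auto
      have "norm (w - z) = (L * norm (\<eta> - \<zeta>)) * norm b"
        using zb(1) \<open>L > 0\<close> by simp
      also have "\<dots> \<le> L * norm (\<eta> - \<zeta>)"
        using zb(3) \<open>L > 0\<close> by (intro mult_left_le) auto
      finally show ?thesis using zb(2) by blast
    qed
    obtain e where e: "0 < e" "ball \<xi> e \<subseteq> U" using U open_contains_ball by blast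
    obtain B where B: "0 < B" "\<And>w. w \<in> F \<xi> \<Longrightarrow> norm w \<le> B"
      using compact_imp_bounded[OF F(2)] unfolding bounded_pos by blast
    \<comment> \<open>One constant for two purposes: \<open>B + L * e\<close> bounds the values over
      the ball of radius \<open>e\<close>, and \<open>L\<close> is the local Lipschitz
      constant.\<close>
    define K where "K = B + L * e + L"
    have "0 < K" using B(1) \<open>L > 0\<close> e(1) by (simp add: K_def add_pos_pos)
    moreover have "norm w \<le> K" if mem: "\<eta> \<in> ball \<xi> e" "w \<in> F \<eta>" for \<eta> w
    proof -
      obtain w' where w': "w' \<in> F \<xi>" "norm (w - w') \<le> L * norm (\<eta> - \<xi>)"
        using near[of \<eta> \<xi> w] mem e U(2) by blast
      have "L * norm (\<eta> - \<xi>) \<le> L * e"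
        using that \<open>L > 0\<close> by (intro mult_left_mono) (auto simp: dist_norm norm_minus_commute)
      then show ?thesis
        using w' B(2)[of w'] norm_triangle_ineq[of "w - w'" w'] \<open>L > 0\<close> unfolding K_def diff_add_cancel by linarith
    qed
    moreover have "\<exists>w'\<in>F \<zeta>. norm (w - w') \<le> K * norm (\<eta> - \<zeta>)"
      if "\<eta> \<in> ball \<xi> e" "\<zeta> \<in> ball \<xi> e" "w \<in> F \<eta>" for \<eta> \<zeta> w
    proof -
      have "L * norm (\<eta> - \<zeta>) \<le> K * norm (\<eta> - \<zeta>)"
        using B(1) \<open>L > 0\<close> e(1) by (intro mult_right_mono) (auto simp: K_def)
      then show ?thesis using near[of \<eta> \<zeta> w] that subsetD[OF e(2)] order_trans by blast
    qed
    ultimately show ?thesis using e(1) by (intro exI[of _ e] exI[of _ K]) simp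
  qed
  then obtain e K where e: "\<And>\<xi>. 0 < e \<xi>" "\<And>\<xi>. 0 < K \<xi>"
    and eK: "\<And>\<xi> \<eta> w. \<eta> \<in> ball \<xi> (e \<xi>) \<Longrightarrow> w \<in> F \<eta> \<Longrightarrow> norm w \<le> K \<xi>"
      "\<And>\<xi> \<eta> w \<zeta>. \<eta> \<in> ball \<xi> (e \<xi>) \<Longrightarrow> w \<in> F \<eta> \<Longrightarrow> \<zeta> \<in> ball \<xi> (e \<xi>) \<Longrightarrow>
        \<exists>w'\<in>F \<zeta>. norm (w - w') \<le> K \<xi> * norm (\<eta> - \<zeta>)"
    by metis
  have "N \<subseteq> (\<Union>\<xi>\<in>N. ball \<xi> (e \<xi>))" using e(1) by auto
  then obtain C where C: "C \<subseteq> N" "finite C" "N \<subseteq> (\<Union>\<xi>\<in>C. ball \<xi> (e \<xi>))"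
    using compactE_image[OF \<open>compact N\<close>, of N "\<lambda>\<xi>. ball \<xi> (e \<xi>)"] by auto
  obtain \<epsilon> where \<epsilon>: "0 < \<epsilon>" "\<And>x. x \<in> N \<Longrightarrow> \<exists>G\<in>(\<lambda>\<xi>. ball \<xi> (e \<xi>)) ` C. ball x \<epsilon> \<subseteq> G"
    using Heine_Borel_lemma[OF \<open>compact N\<close> C(3)] by auto
  define L where "L = 1 + (\<Sum>\<xi>\<in>C. K \<xi>)"
  have K_le: "K \<xi> \<le> L" if "\<xi> \<in> C" for \<xi>
    using member_le_sum[OF that, of K] e(2) C(2) by (simp add: L_def less_imp_le)
  have "0 \<le> (\<Sum>\<xi>\<in>C. K \<xi>)" using e(2) by (intro sum_nonneg) (simp add: less_imp_le)
  then have "0 < L" by (simp add: L_def)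
  have cover: "\<exists>\<xi>\<in>C. cball c (\<epsilon> / 2) \<subseteq> ball \<xi> (e \<xi>)" if "c \<in> N" for c
  proof -
    have "cball c (\<epsilon> / 2) \<subseteq> ball c \<epsilon>" using \<epsilon>(1) by auto
    then show ?thesis using \<epsilon>(2)[OF that] by blast
  qed
  show ?thesis
  proof (rule that[of "\<epsilon> / 2" L L])
    fix c \<eta> \<zeta> w assume *: "c \<in> N" "\<eta> \<in> cball c (\<epsilon> / 2)" "\<zeta> \<in> cball c (\<epsilon> / 2)" "w \<in> F \<eta>"
    then obtain \<xi> where "\<xi> \<in> C" "cball c (\<epsilon> / 2) \<subseteq> ball \<xi> (e \<xi>)" using cover by blast
    moreover have "K \<xi> * norm (\<eta> - \<zeta>) \<le> L * norm (\<eta> - \<zeta>)"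
      using K_le[OF \<open>\<xi> \<in> C\<close>] by (intro mult_right_mono) auto
    ultimately show "\<exists>w'\<in>F \<zeta>. norm (w - w') \<le> L * norm (\<eta> - \<zeta>)"
      using eK(2)[of \<eta> \<xi> w \<zeta>] * order_trans by blast
  next
    fix c \<eta> w assume *: "c \<in> N" "\<eta> \<in> cball c (\<epsilon> / 2)" "w \<in> F \<eta>"
    then obtain \<xi> where "\<xi> \<in> C" "cball c (\<epsilon> / 2) \<subseteq> ball \<xi> (e \<xi>)" using cover by blast
    then show "norm w \<le> L" using eK(1)[of \<eta> \<xi> w] K_le[of \<xi>] * order_trans by blast
  qed (use \<epsilon>(1) \<open>0 < L\<close> in auto)
qed

section \<open>Decay of lower semicontinuous Lyapunov functions along solutions\<close>

lemma penalty_diff_bound: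
  fixes z p q :: "'a::real_normed_vector"
  assumes "norm (z - p) \<le> R" and "norm (z - q) \<le> R"
  shows "(norm (z - p))\<^sup>2 - (norm (z - q))\<^sup>2 \<le> 2 * R * norm (p - q)"
proof -
  have "norm (z - p) - norm (z - q) \<le> norm (p - q)"
    using norm_triangle_ineq3[of "z - p" "z - q"] by (simp add: norm_minus_commute)
  then have "(norm (z - p) + norm (z - q)) * (norm (z - p) - norm (z - q)) \<le> (norm (z - p) + norm (z - q)) * norm (p - q)"
    by (rule mult_left_mono) simp
  also have "\<dots> \<le> (2 * R) * norm (p - q)"
    using assms by (intro mult_right_mono) auto
  finally have "(norm (z - p) + norm (z - q)) * (norm (z - p) - norm (z - q)) \<le> 2 * R * norm (p - q)" .
  then show ?thesis by (simp add: power2_eq_square algebra_simps)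
qed

lemma exp_diff_le: "exp a - exp b \<le> exp c * \<bar>a - b\<bar>" if "a \<le> c" "b \<le> c" for a b c :: real
proof (cases "a \<le> b")
  case True
  then have "exp a \<le> exp b" by simp
  moreover have "0 \<le> exp c * \<bar>a - b\<bar>" by simp
  ultimately show ?thesis by linarith
next
  case False
  have "exp a - exp b = exp a * (1 - exp (b - a))" by (simp add: right_diff_distrib flip: exp_add)
  also have "\<dots> \<le> exp a * (a - b)"
  proof (rule mult_left_mono)
    show "1 - exp (b - a) \<le> a - b" using exp_ge_add_one_self[of "b - a"] by linarith
  qed simp
  also have "\<dots> \<le> exp c * \<bar>a - b\<bar>" using that False by (intro mult_mono) auto
  finally show ?thesis .
qed

text \<open>Moving the penalty to the other side of the minimality inequality exhibits a smooth
  quadratic touching \<open>V\<close> from below at \<open>z\<close>; its gradient is minus that of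
  the penalty, divided by \<open>A\<close>.\<close>

lemma subdifferential_at_penalty_min:
  fixes V :: "'a::real_inner \<Rightarrow> real"
  assumes min: "\<And>z'. A * V z + c * (norm (z - p))\<^sup>2 \<le> A * V z' + c * (norm (z' - p))\<^sup>2" and "0 < A"
  shows "(2 * c / A) *\<^sub>R (p - z) \<in> viscosity_subdifferential V z"
  unfolding viscosity_subdifferential_has_derivative
proof (intro exI conjI)
  let ?\<phi> = "\<lambda>k. ((2 * c / A) *\<^sub>R (p - z)) \<bullet> k - (c / A) * (k \<bullet> k)"
  show "(?\<phi> has_derivative (\<lambda>k. ((2 * c / A) *\<^sub>R (p - z)) \<bullet> k)) (at 0)"
    using \<open>0 < A\<close> by (auto intro!: derivative_eq_intros)
  show "?\<phi> 0 = 0" by simp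
  have "?\<phi> k \<le> V (z + k) - V z" for k
  proof -
    have "A * ?\<phi> k = c * (norm (z - p))\<^sup>2 - c * (norm (z + k - p))\<^sup>2"
      using \<open>0 < A\<close> by (simp add: power2_norm_eq_inner inner_simps algebra_simps inner_commute)
    also have "\<dots> \<le> A * (V (z + k) - V z)" using min[of "z + k"] by (simp add: algebra_simps)
    finally show ?thesis using \<open>0 < A\<close> by simp
  qed
  then show "\<forall>\<^sub>F k in nhds 0. ?\<phi> k \<le> V (z + k) - V z" by simp
qed

text \<open>The penalised values \<open>u t = (INF z. exp t * V z + exp (- 2 * L * t) * (norm (z - x t))\<^sup>2 / (2 * \<epsilon>))\<close> are
  absolutely continuous in \<open>t\<close>. At a minimiser \<open>z\<close> the penalty yields an element of the
  subdifferential at \<open>z\<close>, and the factor \<open>exp (- 2 * L * t)\<close> absorbs the error made in replacing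
  \<open>F (x t)\<close> by \<open>F z\<close>; hence \<open>u\<close> is nonincreasing, and the claim follows as \<open>\<epsilon> \<rightarrow> 0\<close>.\<close>

lemma lsc_lyapunov_decay:
  fixes F :: "'a::euclidean_space \<Rightarrow> 'a set" and V :: "'a \<Rightarrow> real"
  assumes F: "locally_lipschitz_setvalued F" "\<And>\<xi>. compact (F \<xi>)"
    and V: "lower_semicontinuous V" "\<And>\<xi>. 0 \<le> V \<xi>"
    and "open D" and decrease: "\<And>\<xi> \<zeta> v. \<xi> \<in> D \<Longrightarrow> \<zeta> \<in> viscosity_subdifferential V \<xi> \<Longrightarrow> v \<in> F \<xi> \<Longrightarrow> \<zeta> \<bullet> v \<le> - V \<xi>"
    and sol: "solution F T x" and t1: "0 < t1" "ereal t1 < T"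
    and D: "\<And>t. t \<in> {0..t1} \<Longrightarrow> x t \<in> D" and B: "\<And>t. t \<in> {0..t1} \<Longrightarrow> V (x t) \<le> B"
  shows "exp t1 * V (x t1) \<le> V (x 0)"
proof (rule ccontr)
  assume neg: "\<not> exp t1 * V (x t1) \<le> V (x 0)"
  have ac: "abs_cont_on 0 t1 x" using sol t1 by (simp add: solution_def)
  then have cont: "continuous_on {0..t1} x" by (rule abs_cont_on_imp_continuous_on)
  define N where "N = x ` {0..t1}"
  have N: "compact N" "N \<subseteq> D" using cont D by (auto simp: N_def intro: compact_continuous_image)
  obtain X where X: "\<And>p. p \<in> N \<Longrightarrow> norm p \<le> X"
    using compact_imp_bounded[OF N(1)] by (auto simp: bounded_iff)
  obtain r0 L M where r0: "0 < r0" "0 < L"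
    and lip: "\<And>c \<eta> \<zeta> w. c \<in> N \<Longrightarrow> \<eta> \<in> cball c r0 \<Longrightarrow> \<zeta> \<in> cball c r0 \<Longrightarrow> w \<in> F \<eta> \<Longrightarrow>
           \<exists>w'\<in>F \<zeta>. norm (w - w') \<le> L * norm (\<eta> - \<zeta>)"
    by (rule locally_lipschitz_setvalued_compact[OF F N(1)]) blast
  obtain r1 where r1: "0 < r1" "(\<Union>c\<in>N. cball c r1) \<subseteq> D"
    using compact_subset_open_imp_cball_epsilon_subset[OF N(1) \<open>open D\<close> N(2)] by blast
  \<comment> \<open>By lower semicontinuity the assumed failure at \<open>x t1\<close> persists at
    all points within \<open>r2\<close>. One fixed small \<open>\<epsilon>\<close> that puts the
    minimiser there then suffices for the contradiction.\<close>
  obtain r2 where r2: "0 < r2" "\<And>z. norm (z - x t1) < r2 \<Longrightarrow> V (x 0) / exp t1 < V z"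
  proof -
    have "V (x 0) / exp t1 < V (x t1)" using neg by (simp add: field_simps)
    then have "\<forall>\<^sub>F z in nhds (x t1). V (x 0) / exp t1 < V z"
      using V(1) unfolding lower_semicontinuous_def by blast
    then show ?thesis using that unfolding eventually_nhds_metric dist_norm by blast
  qed
  define r where "r = Min {r0, r1, r2}"
  have r: "0 < r" "r \<le> r0" "r \<le> r1" "r \<le> r2" using r0 r1 r2 by (auto simp: r_def)
  have "0 \<le> B" using B[of 0] V(2)[of "x 0"] t1 by simp
  \<comment> \<open>Comparison with \<open>z = x t\<close> bounds the minimum by
    \<open>exp t1 * B\<close>. Dividing by the smallest penalty coefficient on
    \<open>{0..t1}\<close> gives squared distance at most \<open>K * \<epsilon>\<close>, which the
    choice of \<open>\<epsilon>\<close> keeps below \<open>r\<^sup>2\<close>.\<close>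
  define K where "K = 2 * exp (2 * L * t1) * (exp t1 * B)"
  have "0 \<le> K" using \<open>0 \<le> B\<close> by (simp add: K_def)
  define \<epsilon> where "\<epsilon> = r\<^sup>2 / (K + 1)"
  have \<epsilon>: "0 < \<epsilon>" "K * \<epsilon> < r\<^sup>2"
    using r(1) \<open>0 \<le> K\<close> by (simp_all add: \<epsilon>_def field_simps)
  define c where "c t = exp (- 2 * L * t) / (2 * \<epsilon>)" for t
  have c_pos: "0 < c t" for t using \<epsilon> by (simp add: c_def)
  define q where "q t z = exp t * V z + c t * (norm (z - x t))\<^sup>2" for t z
  have "\<exists>z. \<forall>z'. q t z \<le> q t z'" for t
    unfolding q_def using lower_semicontinuous_penalty_attains_min[OF V _ c_pos] by simp
  then obtain z where z: "\<And>t z'. q t (z t) \<le> q t z'" by metis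
  define u where "u t = q t (z t)" for t
  have u_diff: "u s - u t \<le> q s (z t) - q t (z t)" for s t using z[of s "z t"] by (simp add: u_def)
  have u_le: "u t \<le> exp t1 * B" if "t \<in> {0..t1}" for t
  proof -
    have "u t \<le> exp t * V (x t)" using z[of t "x t"] by (simp add: u_def q_def)
    also have "\<dots> \<le> exp t1 * B" using that V(2) B by (intro mult_mono) auto
    finally show ?thesis .
  qed
  have V_z: "V (z t) \<le> exp t1 * B" if "t \<in> {0..t1}" for t
  proof -
    have "V (z t) \<le> exp t * V (z t)" using that V(2)[of "z t"] by (intro mult_le_cancel_right1[THEN iffD2]) auto
    also have "\<dots> \<le> u t" using c_pos[of t] by (simp add: u_def q_def)
    finally show ?thesis using u_le[OF that] by simp
  qed
  have z_near: "norm (z t - x t) < r" if "t \<in> {0..t1}" for t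
  proof -
    have "exp (- 2 * L * t1) / (2 * \<epsilon>) * (norm (z t - x t))\<^sup>2 \<le> c t * (norm (z t - x t))\<^sup>2"
      unfolding c_def using that \<epsilon> r0 by (intro mult_right_mono divide_right_mono) auto
    also have "\<dots> \<le> u t" using V(2)[of "z t"] by (simp add: u_def q_def)
    also have "\<dots> \<le> exp t1 * B" by (rule u_le[OF that])
    finally have "exp (- 2 * L * t1) * (norm (z t - x t))\<^sup>2 \<le> 2 * \<epsilon> * (exp t1 * B)"
      using \<epsilon>(1) by (simp add: field_simps)
    then have "exp (2 * L * t1) * (exp (- 2 * L * t1) * (norm (z t - x t))\<^sup>2) \<le> exp (2 * L * t1) * (2 * \<epsilon> * (exp t1 * B))"
      by (rule mult_left_mono) simp
    moreover have "exp (2 * L * t1) * (exp (- 2 * L * t1) * (norm (z t - x t))\<^sup>2) = (norm (z t - x t))\<^sup>2"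
      unfolding mult.assoc[symmetric] exp_add[symmetric] by simp
    moreover have "exp (2 * L * t1) * (2 * \<epsilon> * (exp t1 * B)) = K * \<epsilon>"
      by (simp add: K_def)
    ultimately have "(norm (z t - x t))\<^sup>2 \<le> K * \<epsilon>" by linarith
    then have "(norm (z t - x t))\<^sup>2 < r\<^sup>2" using \<epsilon>(2) by simp
    then show ?thesis using r(1) by (simp add: power2_less_imp_less)
  qed
  define R where "R = r + 2 * X"
  have far: "norm (z t - x s) \<le> R" if "s \<in> {0..t1}" "t \<in> {0..t1}" for s t
  proof -
    have "norm (z t - x s) \<le> norm (z t - x t) + (norm (x t) + norm (x s))"
      using norm_triangle_ineq[of "z t - x t" "x t - x s"] norm_triangle_ineq4[of "x t" "x s"] by simp
    then show ?thesis using z_near[OF that(2)] X[of "x t"] X[of "x s"] that by (simp add: R_def N_def)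
  qed
  have "0 \<le> R" using order_trans[OF norm_ge_zero far[of 0 0]] t1 by simp
  define C1 where "C1 = exp t1 * (exp t1 * B) + L / \<epsilon> * R\<^sup>2"
  define C2 where "C2 = 1 / (2 * \<epsilon>) * (2 * R)"
  have C: "0 \<le> C1" "0 \<le> C2" using \<open>0 \<le> B\<close> \<epsilon>(1) r0 \<open>0 \<le> R\<close> by (auto simp: C1_def C2_def)
  \<comment> \<open>The minimiser for time \<open>t\<close> is a competitor at time
    \<open>s\<close>. The change of \<open>q\<close> is split into the changes of the weight
    \<open>exp\<close>, of the coefficient \<open>c\<close> and of the trajectory point; the bound
    is symmetric in \<open>s\<close> and \<open>t\<close>, so it controls both signs.\<close>
  have u_bound: "u s - u t \<le> C1 * \<bar>s - t\<bar> + C2 * norm (x s - x t)" if "s \<in> {0..t1}" "t \<in> {0..t1}" for s t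
  proof -
    have "(exp s - exp t) * V (z t) \<le> exp t1 * \<bar>s - t\<bar> * (exp t1 * B)"
      using V(2)[of "z t"] V_z that exp_diff_le[of s t1 t]
      by (intro order_trans[OF mult_right_mono mult_left_mono]) auto
    moreover have "(c s - c t) * (norm (z t - x s))\<^sup>2 \<le> L / \<epsilon> * \<bar>s - t\<bar> * R\<^sup>2"
    proof -
      have "exp (- 2 * L * s) - exp (- 2 * L * t) \<le> 1 * \<bar>- 2 * L * s - (- 2 * L * t)\<bar>"
        using exp_diff_le[of "- 2 * L * s" 0 "- 2 * L * t"] that r0 by simp
      also have "\<dots> = 2 * L * \<bar>s - t\<bar>"
      proof -
        have "- 2 * L * s - (- 2 * L * t) = - (2 * L) * (s - t)" by (simp add: algebra_simps)
        then show ?thesis using r0(2) by (simp only: abs_mult abs_minus_cancel abs_numeral abs_of_pos)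
      qed
      finally have "(exp (- 2 * L * s) - exp (- 2 * L * t)) / (2 * \<epsilon>) \<le> 2 * L * \<bar>s - t\<bar> / (2 * \<epsilon>)"
        using \<epsilon>(1) by (intro divide_right_mono) auto
      then have "c s - c t \<le> L / \<epsilon> * \<bar>s - t\<bar>" by (simp add: c_def diff_divide_distrib)
      moreover have "(norm (z t - x s))\<^sup>2 \<le> R\<^sup>2" using far[OF that] by (intro power_mono) auto
      ultimately show ?thesis
        using \<epsilon>(1) r0 by (intro order_trans[OF mult_right_mono mult_left_mono]) auto
    qed
    moreover have "c t * ((norm (z t - x s))\<^sup>2 - (norm (z t - x t))\<^sup>2) \<le> 1 / (2 * \<epsilon>) * (2 * R * norm (x s - x t))"
    proof -
      have "c t \<le> 1 / (2 * \<epsilon>)" using that \<epsilon>(1) r0 by (auto simp: c_def intro!: divide_right_mono)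
      moreover have "c t * ((norm (z t - x s))\<^sup>2 - (norm (z t - x t))\<^sup>2) \<le> c t * (2 * R * norm (x s - x t))"
        using c_pos[of t] that by (intro mult_left_mono penalty_diff_bound far) auto
      moreover have "c t * (2 * R * norm (x s - x t)) \<le> 1 / (2 * \<epsilon>) * (2 * R * norm (x s - x t))"
        using calculation(1) \<open>0 \<le> R\<close> by (intro mult_right_mono) auto
      ultimately show ?thesis by linarith
    qed
    moreover have "q s (z t) - q t (z t) = (exp s - exp t) * V (z t) + (c s - c t) * (norm (z t - x s))\<^sup>2
        + c t * ((norm (z t - x s))\<^sup>2 - (norm (z t - x t))\<^sup>2)"
      by (simp add: q_def algebra_simps)
    ultimately show ?thesis using u_diff[of s t] by (simp add: C1_def C2_def algebra_simps)
  qed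
  have "abs_cont_on 0 t1 u"
  proof (rule abs_cont_on_dominated[OF ac])
    show "0 \<le> C1 + C2" using C by simp
    fix s t assume st: "0 \<le> s" "s \<le> t" "t \<le> t1"
    then have "norm (u t - u s) \<le> C1 * (t - s) + C2 * norm (x t - x s)"
      using u_bound[of s t] u_bound[of t s] by (auto simp: abs_le_iff norm_minus_commute)
    also have "\<dots> \<le> (C1 + C2) * (t - s) + (C1 + C2) * norm (x t - x s)"
      using C st by (intro add_mono mult_right_mono) auto
    finally show "norm (u t - u s) \<le> (C1 + C2) * (t - s) + (C1 + C2) * norm (x t - x s)" .
  qed
  obtain Z where Z: "negligible Z"
    and deriv: "\<And>t. t \<in> time_dom T - Z \<Longrightarrow> \<exists>v\<in>F (x t). (x has_vector_derivative v) (at t within time_dom T)"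
  proof -
    have "AE t in lebesgue. t \<in> time_dom T \<longrightarrow> (\<exists>v\<in>F (x t). (x has_vector_derivative v) (at t within time_dom T))"
      using sol by (simp add: solution_def)
    then obtain Z where "Z \<in> null_sets lebesgue"
      "{t \<in> space lebesgue. \<not> (t \<in> time_dom T \<longrightarrow> (\<exists>v\<in>F (x t). (x has_vector_derivative v) (at t within time_dom T)))} \<subseteq> Z"
      by (auto simp: eventually_ae_filter)
    then show ?thesis by (intro that[of Z]) (auto simp: negligible_iff_null_sets)
  qed
  have "\<forall>\<^sub>F s in at_right t. u s - u t \<le> e * (s - t)" if t: "t \<in> {0..<t1} - Z" and "0 < e" for t e
  proof -
    have dom: "{t..t1} \<subseteq> time_dom T" using t le_less_trans[OF _ t1(2)] by (auto simp: time_dom_def)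
    have "t \<in> {t..t1}" using t by simp
    then have "t \<in> time_dom T - Z" using dom t by blast
    then obtain p where p: "p \<in> F (x t)" "(x has_vector_derivative p) (at t within time_dom T)"
      using deriv by blast
    have x': "(x has_derivative (\<lambda>h. h *\<^sub>R p)) (at t within {t..t1})"
      using has_vector_derivative_within_subset[OF p(2) dom] by (simp add: has_vector_derivative_def)
    \<comment> \<open>With \<open>y\<close> frozen, \<open>q s y\<close> dominates
      \<open>u s\<close> and equals it at \<open>s = t\<close>. The right growth of \<open>u\<close>
      is thus bounded by an ordinary derivative, although minimisers may depend discontinuously on
      time.\<close>
    define y where "y = z t"
    have y: "norm (y - x t) < r" using z_near[of t] t by (simp add: y_def)
    have "x t \<in> N" using t by (auto simp: N_def)
    have sub: "(2 * c t / exp t) *\<^sub>R (x t - y) \<in> viscosity_subdifferential V y"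
      using z[of t] by (intro subdifferential_at_penalty_min) (auto simp: q_def y_def)
    obtain v where v: "v \<in> F y" "norm (p - v) \<le> L * norm (x t - y)"
      using lip[of "x t" "x t" y p] \<open>x t \<in> N\<close> p(1) y r by (auto simp: dist_norm norm_minus_commute)
    have "y \<in> D" using r1(2) \<open>x t \<in> N\<close> y r by (force simp: dist_norm norm_minus_commute)
    from decrease[OF this sub v(1)] have "2 * c t / exp t * ((x t - y) \<bullet> v) \<le> - V y" by simp
    then have "2 * c t * ((x t - y) \<bullet> v) \<le> - V y * exp t" by (simp add: field_simps)
    moreover have "2 * c t * ((x t - y) \<bullet> (p - v)) \<le> 2 * c t * (L * (norm (x t - y))\<^sup>2)"
    proof (rule mult_left_mono)
      have "(x t - y) \<bullet> (p - v) \<le> norm (x t - y) * norm (p - v)" by (rule norm_cauchy_schwarz)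
      also have "\<dots> \<le> norm (x t - y) * (L * norm (x t - y))" using v(2) by (intro mult_left_mono) auto
      finally show "(x t - y) \<bullet> (p - v) \<le> L * (norm (x t - y))\<^sup>2" by (simp add: power2_eq_square mult_ac)
    qed (use c_pos[of t] in simp)
    moreover have "2 * c t * ((x t - y) \<bullet> p) = 2 * c t * ((x t - y) \<bullet> v) + 2 * c t * ((x t - y) \<bullet> (p - v))"
      by (simp add: inner_diff_right algebra_simps)
    \<comment> \<open>The decrease at \<open>y\<close> cancels \<open>exp t * V y\<close>. What
      remains is the error from comparing \<open>p\<close> with some \<open>v\<close> in
      \<open>F y\<close>, at most \<open>2 * L * c t * (norm (x t - y))\<^sup>2\<close>, exactly
      what the decaying coefficient \<open>c\<close> takes away.\<close>
    ultimately have D_le: "exp t * V y + (2 * c t * ((x t - y) \<bullet> p) - 2 * L * c t * (norm (x t - y))\<^sup>2) \<le> 0"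
      by (simp add: algebra_simps)
    have "((\<lambda>s. q s y) has_real_derivative
        exp t * V y + (2 * c t * ((x t - y) \<bullet> p) - 2 * L * c t * (norm (x t - y))\<^sup>2)) (at t within {t..t1})"
    proof -
      have "((\<lambda>s. (y - x s) \<bullet> (y - x s)) has_derivative (\<lambda>h. h * (2 * ((x t - y) \<bullet> p)))) (at t within {t..t1})"
        by (rule derivative_eq_intros x' refl)+ (auto simp: inner_simps algebra_simps inner_commute)
      then have n: "((\<lambda>s. (norm (y - x s))\<^sup>2) has_real_derivative 2 * ((x t - y) \<bullet> p)) (at t within {t..t1})"
        by (simp add: power2_norm_eq_inner has_field_derivative_def mult.commute[of _ "2 * _"])
      have c': "(c has_real_derivative - 2 * L * c t) (at t within {t..t1})"
        unfolding c_def using \<epsilon>(1) by (auto intro!: derivative_eq_intros)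
      show ?thesis
        unfolding q_def
        by (rule DERIV_cong[OF DERIV_add[OF DERIV_cmult_right[OF has_field_derivative_at_within[OF DERIV_exp]]
              DERIV_mult[OF c' n]]]) (simp add: norm_minus_commute algebra_simps)
    qed
    then have "((\<lambda>s. (q s y - q t y) / (s - t)) \<longlongrightarrow>
        exp t * V y + (2 * c t * ((x t - y) \<bullet> p) - 2 * L * c t * (norm (x t - y))\<^sup>2)) (at_right t)"
      using t by (simp add: has_field_derivative_iff at_within_Icc_at_right)
    then have "\<forall>\<^sub>F s in at_right t. (q s y - q t y) / (s - t) < e"
      by (rule order_tendstoD(2)) (use D_le \<open>0 < e\<close> in linarith)
    moreover have "\<forall>\<^sub>F s in at_right t. t < s" by (simp add: eventually_at_right_less)
    ultimately show ?thesis
    proof eventually_elim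
      case (elim s)
      then have "q s y - q t y \<le> e * (s - t)" by (simp add: pos_divide_less_eq less_imp_le)
      then show ?case using u_diff[of s t] by (simp add: y_def)
    qed
  qed
  then have "u t1 \<le> u 0"
  proof (intro abs_cont_on_nonincreasing[OF \<open>abs_cont_on 0 t1 u\<close> _ Z])
  qed (use t1 in auto)
  also have "u 0 \<le> V (x 0)" using z[of 0 "x 0"] by (simp add: u_def q_def)
  also have "V (x 0) < exp t1 * V (z t1)"
    using r2(2)[of "z t1"] z_near[of t1] r t1 by (simp add: field_simps)
  also have "\<dots> \<le> u t1" using c_pos[of t1] by (simp add: u_def q_def)
  finally show False by simp
qed

section \<open>Existence of continuously differentiable arcs\<close>

text \<open>A Lipschitz velocity, rather than a merely continuous one, is what the limit of polygons
  provides and what the step error estimate along a reference arc consumes. Derivatives at the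
  endpoints are one-sided.\<close>

definition arc_on :: "('a::euclidean_space \<Rightarrow> 'a set) \<Rightarrow> (real \<Rightarrow> 'a) \<Rightarrow> (real \<Rightarrow> 'a) \<Rightarrow> real \<Rightarrow> real \<Rightarrow> bool" where
  "arc_on F x v a b \<longleftrightarrow> (\<exists>K. K-lipschitz_on {a..b} v) \<and>
     (\<forall>t\<in>{a..b}. v t \<in> F (x t) \<and> (x has_vector_derivative v t) (at t within {a..b}))"

lemma integral_diff_norm_le:
  fixes v :: "real \<Rightarrow> 'a::euclidean_space"
  assumes v: "continuous_on {a..b} v" and M: "\<And>t. t \<in> {a..b} \<Longrightarrow> norm (v t) \<le> M"
    and "a \<le> s" "s \<le> t" "t \<le> b"
  shows "norm (integral {a..t} v - integral {a..s} v) \<le> M * (t - s)"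
proof -
  have "v integrable_on {a..t}"
    using assms by (intro integrable_continuous_real continuous_on_subset[OF v]) auto
  then have "integral {a..t} v - integral {a..s} v = integral {s..t} v"
    using Henstock_Kurzweil_Integration.integral_combine[of a s t v] assms by (simp add: algebra_simps)
  also have "norm \<dots> \<le> M * (t - s)"
    using assms by (intro integral_bound continuous_on_subset[OF v]) auto
  finally show ?thesis .
qed

text \<open>A polygonal approximation of the velocity. The node value at time \<open>j * \<delta>\<close> is admissible at the
  position one step earlier, so that it can be chosen once the trajectory up to that position is known.\<close>

lemma delayed_polygon:
  fixes F :: "'a::euclidean_space \<Rightarrow> 'a set"
  assumes r: "0 < L" "0 < M" "0 < \<delta>" and w: "w \<in> F \<xi>"
    and lip: "\<And>\<eta> \<zeta> w. \<eta> \<in> cball \<xi> r \<Longrightarrow> \<zeta> \<in> cball \<xi> r \<Longrightarrow> w \<in> F \<eta> \<Longrightarrow>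
           \<exists>w'\<in>F \<zeta>. norm (w - w') \<le> L * norm (\<eta> - \<zeta>)"
    and bound: "\<And>\<eta> w. \<eta> \<in> cball \<xi> r \<Longrightarrow> w \<in> F \<eta> \<Longrightarrow> norm w \<le> M"
    and small: "M * (n * \<delta>) \<le> r"
  shows "\<exists>v. v 0 = w \<and> (L * M)-lipschitz_on {0..real n * \<delta>} v \<and> (\<forall>t\<in>{0..real n * \<delta>}. norm (v t) \<le> M) \<and>
    (\<forall>j\<le>n. v (real j * \<delta>) \<in> F (\<xi> + integral {0..real (j - 1) * \<delta>} v))"
  using small
proof (induction n)
  case 0
  have "norm w \<le> M" using bound[of \<xi> w] w 0 by simp
  then show ?case
    using w r by (intro exI[of _ "\<lambda>_. w"]) (auto intro!: lipschitz_onI)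
next
  case (Suc k)
  define T where "T = real k * \<delta>"
  have T: "0 \<le> T" "M * T \<le> r" "real (Suc k) * \<delta> = T + \<delta>"
  proof -
    show "0 \<le> T" "real (Suc k) * \<delta> = T + \<delta>" using r by (simp_all add: T_def algebra_simps)
    then have "M * T \<le> M * (real (Suc k) * \<delta>)" using r by simp
    then show "M * T \<le> r" using Suc.prems by simp
  qed
  obtain v where v0: "v 0 = w" and v_lip: "(L * M)-lipschitz_on {0..T} v"
    and v_M: "\<And>t. t \<in> {0..T} \<Longrightarrow> norm (v t) \<le> M"
    and node: "\<And>j. j \<le> k \<Longrightarrow> v (real j * \<delta>) \<in> F (\<xi> + integral {0..real (j - 1) * \<delta>} v)"
    using Suc.IH T(2) unfolding T_def by blast
  have v_cont: "continuous_on {0..T} v" by (rule lipschitz_on_continuous_on[OF v_lip])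
  define X where "X t = \<xi> + integral {0..t} v" for t
  have X_diff: "norm (X t - X s) \<le> M * (t - s)" if "0 \<le> s" "s \<le> t" "t \<le> T" for s t
    using integral_diff_norm_le[OF v_cont v_M, of s t] that by (simp add: X_def)
  have X_ball: "X t \<in> cball \<xi> r" if "0 \<le> t" "t \<le> T" for t
  proof -
    have "norm (X t - X 0) \<le> M * t" using X_diff[of 0 t] that by simp
    also have "\<dots> \<le> M * T" using that r by simp
    finally show ?thesis using T(2) by (simp add: X_def dist_norm norm_minus_commute)
  qed
  \<comment> \<open>Truncated subtraction gives \<open>T' = T = 0\<close> for \<open>k = 0\<close>;
    there the starting velocity is itself admissible at the current position.\<close>
  define T' where "T' = real (k - 1) * \<delta>"
  have T': "0 \<le> T'" "T' \<le> T" "T - T' \<le> \<delta>"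
    using r by (cases k; simp add: T'_def T_def algebra_simps)+
  have "v T \<in> F (X T')" using node[of k] by (simp add: T_def T'_def X_def)
  then obtain w' where w': "w' \<in> F (X T)" "norm (v T - w') \<le> L * norm (X T' - X T)"
    using lip[of "X T'" "X T" "v T"] X_ball T' T(1) by auto
  have "L * norm (X T' - X T) \<le> L * (M * \<delta>)"
  proof (rule mult_left_mono)
    have "norm (X T' - X T) \<le> M * (T - T')" using X_diff[of T' T] T' by (simp add: norm_minus_commute)
    also have "\<dots> \<le> M * \<delta>" using T' r by (intro mult_left_mono) auto
    finally show "norm (X T' - X T) \<le> M * \<delta>" .
  qed (use r in auto)
  \<comment> \<open>The position moves by at most \<open>M * \<delta>\<close> per step, so the next
    node value can be chosen within \<open>L * M * \<delta>\<close> of the last one. The slope bound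
    \<open>L * M\<close> does not depend on \<open>\<delta>\<close>.\<close>
  with w'(2) have slope: "norm (w' - v T) \<le> L * M * \<delta>" by (simp add: norm_minus_commute mult.assoc)
  have w'_M: "norm w' \<le> M" using bound[OF X_ball w'(1)] T(1) by simp
  define l where "l t = v T + ((t - T) / \<delta>) *\<^sub>R (w' - v T)" for t
  define u where "u t = (if t \<le> T then v t else l t)" for t
  have "(L * M)-lipschitz_on {T..T + \<delta>} l"
  proof (rule lipschitz_onI)
    fix s t
    have "dist (l s) (l t) = norm (((s - t) / \<delta>) *\<^sub>R (w' - v T))"
      by (simp add: l_def dist_norm diff_divide_distrib scaleR_diff_left[symmetric])
    also have "\<dots> = \<bar>s - t\<bar> / \<delta> * norm (w' - v T)" using r by simp
    also have "\<dots> \<le> \<bar>s - t\<bar> / \<delta> * (L * M * \<delta>)" using slope r by (intro mult_left_mono) auto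
    also have "\<dots> = L * M * dist s t" using r by (simp add: dist_real_def)
    finally show "dist (l s) (l t) \<le> L * M * dist s t" .
  qed (use r in simp)
  then have u_lip: "(L * M)-lipschitz_on {0..T + \<delta>} u"
    unfolding u_def by (intro lipschitz_on_concat v_lip) (simp_all add: l_def)
  have u_M: "norm (u t) \<le> M" if "t \<in> {0..T + \<delta>}" for t
  proof (cases "t \<le> T")
    case False
    define a where "a = (t - T) / \<delta>"
    have a: "0 \<le> a" "a \<le> 1" using False that r by (auto simp: a_def)
    have "l t = (1 - a) *\<^sub>R v T + a *\<^sub>R w'" by (simp add: l_def a_def[symmetric] algebra_simps)
    also have "norm \<dots> \<le> (1 - a) * norm (v T) + a * norm w'"
      using a norm_triangle_ineq[of "(1 - a) *\<^sub>R v T" "a *\<^sub>R w'"] by simp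
    also have "\<dots> \<le> (1 - a) * M + a * M"
      using a v_M[of T] w'_M T(1) by (intro add_mono mult_left_mono) auto
    finally show ?thesis using False by (simp add: u_def algebra_simps)
  qed (use v_M that in \<open>auto simp: u_def\<close>)
  have int_u: "integral {0..t} u = integral {0..t} v" if "t \<le> T" for t
    using that by (intro Henstock_Kurzweil_Integration.integral_cong) (auto simp: u_def)
  have "u (real j * \<delta>) \<in> F (\<xi> + integral {0..real (j - 1) * \<delta>} u)" if "j \<le> Suc k" for j
  proof (cases "j = Suc k")
    case True
    then have "real j * \<delta> = T + \<delta>" "real (j - 1) * \<delta> = T" using T(3) by (simp_all add: T_def)
    then show ?thesis using w'(1) r int_u[of T] by (simp add: u_def l_def X_def)
  next
    case False
    then have "real j * \<delta> \<le> T" "real (j - 1) * \<delta> \<le> T"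
      using that r by (auto simp: T_def)
    then show ?thesis using node[of j] False that int_u by (simp add: u_def)
  qed
  moreover have "u 0 = w" using v0 T(1) by (simp add: u_def)
  ultimately show ?case
    using u_lip u_M unfolding T(3) by blast
qed

text \<open>Velocity polygons for finer and finer meshes share the bound \<open>M\<close> and the
  Lipschitz constant \<open>L * M\<close>, so a subsequence converges uniformly. Node values satisfy
  the inclusion at slightly delayed positions; density of the nodes, the Lipschitz property and
  closedness of \<open>F (x t)\<close> transfer it to the limit.\<close>

lemma local_arc:
  fixes F :: "'a::euclidean_space \<Rightarrow> 'a set"
  assumes closed: "\<And>\<eta>. closed (F \<eta>)" and r: "0 < L" "0 < M" "0 < \<tau>" and w: "w \<in> F \<xi>"
    and lip: "\<And>\<eta> \<zeta> w. \<eta> \<in> cball \<xi> r \<Longrightarrow> \<zeta> \<in> cball \<xi> r \<Longrightarrow> w \<in> F \<eta> \<Longrightarrow>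
           \<exists>w'\<in>F \<zeta>. norm (w - w') \<le> L * norm (\<eta> - \<zeta>)"
    and bound: "\<And>\<eta> w. \<eta> \<in> cball \<xi> r \<Longrightarrow> w \<in> F \<eta> \<Longrightarrow> norm w \<le> M"
    and small: "M * \<tau> \<le> r"
  obtains x v where "arc_on F x v a (a + \<tau>)" and "x a = \<xi>" and "v a = w"
    and "(L * M)-lipschitz_on {a..a + \<tau>} v"
proof -
  define \<delta> where "\<delta> n = \<tau> / real (Suc n)" for n
  have \<delta>: "0 < \<delta> n" "real (Suc n) * \<delta> n = \<tau>" for n using r by (simp_all add: \<delta>_def)
  have "\<exists>v. v 0 = w \<and> (L * M)-lipschitz_on {0..\<tau>} v \<and> (\<forall>t\<in>{0..\<tau>}. norm (v t) \<le> M) \<and>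
    (\<forall>j\<le>Suc n. v (real j * \<delta> n) \<in> F (\<xi> + integral {0..real (j - 1) * \<delta> n} v))" for n
    using delayed_polygon[of L M "\<delta> n" w F \<xi> r "Suc n"] r \<delta>[of n] w lip bound small by simp
  then obtain V where V: "\<And>n. V n 0 = w" "\<And>n. (L * M)-lipschitz_on {0..\<tau>} (V n)"
    "\<And>n t. t \<in> {0..\<tau>} \<Longrightarrow> norm (V n t) \<le> M"
    and node: "\<And>n j. j \<le> Suc n \<Longrightarrow> V n (real j * \<delta> n) \<in> F (\<xi> + integral {0..real (j - 1) * \<delta> n} (V n))"
    by metis
  have V_cont: "continuous_on {0..\<tau>} (V n)" for n by (rule lipschitz_on_continuous_on[OF V(2)])
  obtain g k where g_cont: "continuous_on {0..\<tau>} g" and k: "strict_mono (k :: nat \<Rightarrow> nat)"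
    and conv: "\<And>e. 0 < e \<Longrightarrow> \<exists>N. \<forall>n x. n \<ge> N \<and> x \<in> {0..\<tau>} \<longrightarrow> norm (V (k n) x - g x) < e"
  proof (rule Arzela_Ascoli[of "{0..\<tau>}" V M])
    fix t e :: real assume t: "t \<in> {0..\<tau>}" "0 < e"
    have "norm (V n t - V n s) < e" if "s \<in> {0..\<tau>}" "norm (t - s) < e / (L * M + 1)" for n s
    proof -
      have "norm (V n t - V n s) \<le> L * M * \<bar>t - s\<bar>"
        using lipschitz_onD[OF V(2) t(1) that(1)] by (simp add: dist_norm)
      also have "\<dots> \<le> (L * M + 1) * \<bar>t - s\<bar>" by (intro mult_right_mono) auto
      also have "\<dots> < e" using that(2) r by (simp add: field_simps add_pos_pos)
      finally show ?thesis .
    qed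
    then show "\<exists>d>0. \<forall>n y. y \<in> {0..\<tau>} \<and> norm (t - y) < d \<longrightarrow> norm (V n t - V n y) < e"
      using t r by (intro exI[of _ "e / (L * M + 1)"]) (auto intro!: divide_pos_pos add_pos_pos)
  qed (use V in auto)
  have lim: "(\<lambda>n. V (k n) t) \<longlonglongrightarrow> g t" if "t \<in> {0..\<tau>}" for t
    unfolding LIMSEQ_iff using conv that by meson
  have "g 0 = w" using lim[of 0] V(1) r LIMSEQ_unique[OF tendsto_const] by fastforce
  have g_lip: "(L * M)-lipschitz_on {0..\<tau>} g"
  proof (rule lipschitz_onI)
    fix s t assume st: "s \<in> {0..\<tau>}" "t \<in> {0..\<tau>}"
    show "dist (g s) (g t) \<le> L * M * dist s t"
      using lipschitz_onD[OF V(2) st]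
      by (intro Lim_bounded[OF tendsto_dist[OF lim[OF st(1)] lim[OF st(2)]]]) auto
  qed (use r in simp)
  have g_M: "norm (g t) \<le> M" if "t \<in> {0..\<tau>}" for t
    using V(3)[OF that] by (intro Lim_bounded[OF tendsto_norm[OF lim[OF that]]]) auto
  define x where "x t = \<xi> + integral {0..t} g" for t
  have x_ball: "x t \<in> cball \<xi> r" if "t \<in> {0..\<tau>}" for t
  proof -
    have "norm (x t - \<xi>) \<le> M * t"
      using integral_diff_norm_le[OF g_cont g_M, of 0 t] that by (simp add: x_def)
    also have "\<dots> \<le> r" using small that r by (intro order_trans[OF mult_left_mono small]) auto
    finally show ?thesis by (simp add: dist_norm norm_minus_commute)
  qed
  have x': "(x has_vector_derivative g t) (at t within {0..\<tau>})" if "t \<in> {0..\<tau>}" for t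
    unfolding x_def using integral_has_vector_derivative[OF g_cont that]
    by (auto intro!: derivative_eq_intros)
  have gF: "g t \<in> F (x t)" if t: "t \<in> {0..\<tau>}" for t
  proof -
    \<comment> \<open>Errors in units of \<open>e'\<close>: 1 for \<open>V n t\<close> against
      \<open>g t\<close>, \<open>L * M\<close> for moving from the node \<open>s\<close> to
      \<open>t\<close>, and through \<open>L\<close> the position error, \<open>2 * M\<close> for a
      delay of up to two steps plus \<open>\<tau>\<close> for integrating the velocity
      error.\<close>
    define Q where "Q = 1 + 3 * (L * M) + L * \<tau>"
    have Q: "0 < Q" using r by (simp add: Q_def add_pos_pos)
    have "\<exists>w'\<in>F (x t). dist w' (g t) < e" if "0 < e" for e
    proof -
      define e' where "e' = e / Q"
      have e': "0 < e'" using that Q by (simp add: e'_def)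
      obtain N1 where N1: "\<And>n s. n \<ge> N1 \<Longrightarrow> s \<in> {0..\<tau>} \<Longrightarrow> norm (V (k n) s - g s) < e'"
        using conv[OF e'] by blast
      obtain N2 where N2: "\<tau> / e' < real N2" using reals_Archimedean2 by blast
      define n where "n = k (max N1 N2)"
      have near: "norm (V n s - g s) < e'" if "s \<in> {0..\<tau>}" for s
        using N1[of "max N1 N2" s] that by (simp add: n_def)
      have "N2 \<le> n" using seq_suble[OF k, of "max N1 N2"] by (simp add: n_def)
      have \<delta>_small: "\<delta> n < e'"
      proof -
        have "\<tau> < e' * real N2" using N2 e' by (simp add: field_simps)
        also have "\<dots> < e' * real (Suc n)" using \<open>N2 \<le> n\<close> e' by simp
        finally show ?thesis by (simp add: \<delta>_def field_simps)
      qed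
      \<comment> \<open>The last node not after \<open>t\<close>. Its value is admissible at the
        position of the preceding node, hence at a time at most two steps before
        \<open>t\<close>.\<close>
      define j where "j = nat \<lfloor>t / \<delta> n\<rfloor>"
      have j: "real j * \<delta> n \<le> t" "t < real (Suc j) * \<delta> n"
      proof -
        have "real j = of_int \<lfloor>t / \<delta> n\<rfloor>" using t \<delta>(1)[of n] by (simp add: j_def)
        then have "real j \<le> t / \<delta> n" "t / \<delta> n < real j + 1" by linarith+
        then show "real j * \<delta> n \<le> t" "t < real (Suc j) * \<delta> n"
          using \<delta>(1)[of n] by (simp_all add: field_simps)
      qed
      have "j \<le> Suc n"
      proof -
        have "real j * \<delta> n \<le> real (Suc n) * \<delta> n" using j(1) t \<delta>(2)[of n] by simp
        then show ?thesis using \<delta>(1)[of n] by (simp only: mult_le_cancel_right_pos of_nat_le_iff)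
      qed
      define s s' where "s = real j * \<delta> n" and "s' = real (j - 1) * \<delta> n"
      have s: "0 \<le> s'" "s' \<le> s" "s \<le> t" "t - s \<le> \<delta> n" "t - s' \<le> 2 * \<delta> n"
        using j \<delta>(1)[of n] by (cases j; simp add: s_def s'_def algebra_simps)+
      define p where "p = \<xi> + integral {0..s'} (V n)"
      have "V n s \<in> F p" using node[OF \<open>j \<le> Suc n\<close>] by (simp add: s_def s'_def p_def)
      have "norm (p - \<xi>) \<le> M * s'"
        using integral_diff_norm_le[OF V_cont[of n] V(3)[of _ n], of 0 s'] s t by (simp add: p_def)
      also have "\<dots> \<le> r" using s t r by (intro order_trans[OF mult_left_mono small]) auto
      finally have "p \<in> cball \<xi> r" by (simp add: dist_norm norm_minus_commute)
      then obtain w' where w': "w' \<in> F (x t)" "norm (V n s - w') \<le> L * norm (p - x t)"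
        using lip[OF _ x_ball[OF t] \<open>V n s \<in> F p\<close>] by blast
      have "norm (p - x t) \<le> M * (2 * \<delta> n) + \<tau> * e'"
      proof -
        have "norm (integral {0..t} (V n) - integral {0..s'} (V n)) \<le> M * (t - s')"
          using integral_diff_norm_le[OF V_cont[of n] V(3)[of _ n], of s' t] s t by simp
        also have "\<dots> \<le> M * (2 * \<delta> n)" using s r by (intro mult_left_mono) auto
        finally have "norm (integral {0..t} (V n) - integral {0..s'} (V n)) \<le> M * (2 * \<delta> n)" .
        moreover have "norm (integral {0..t} (V n) - integral {0..t} g) \<le> \<tau> * e'"
        proof -
          have c: "continuous_on {0..t} (V n)" "continuous_on {0..t} g"
            using t by (auto intro: continuous_on_subset[OF V_cont] continuous_on_subset[OF g_cont])
          then have "integral {0..t} (V n) - integral {0..t} g = integral {0..t} (\<lambda>s. V n s - g s)"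
            by (intro Henstock_Kurzweil_Integration.integral_diff[symmetric] integrable_continuous_real)
          also have "norm \<dots> \<le> e' * (t - 0)"
            using t c near by (intro integral_bound continuous_intros) (auto intro: less_imp_le)
          also have "\<dots> \<le> \<tau> * e'" using t e' by (simp add: mult.commute)
          finally show ?thesis .
        qed
        moreover have "p - x t = (integral {0..t} (V n) - integral {0..t} g) - (integral {0..t} (V n) - integral {0..s'} (V n))"
          by (simp add: p_def x_def)
        ultimately show ?thesis using norm_triangle_ineq4 by (smt (verit))
      qed
      moreover have "M * (2 * \<delta> n) \<le> M * (2 * e')" using r \<delta>_small by simp
      ultimately have "norm (p - x t) \<le> M * (2 * e') + \<tau> * e'" by linarith
      then have "L * norm (p - x t) \<le> L * (M * (2 * e') + \<tau> * e')" using r by simp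
      moreover have "norm (V n t - V n s) \<le> L * M * e'"
      proof -
        have "norm (V n t - V n s) \<le> L * M * (t - s)"
          using lipschitz_onD[OF V(2), of t s n] s t by (simp add: dist_norm)
        also have "\<dots> \<le> L * M * e'" using s \<delta>_small r by (intro mult_left_mono) auto
        finally show ?thesis .
      qed
      moreover have "norm (V n t - g t) < e'" using near[OF t] .
      moreover have "dist w' (g t) \<le> norm (V n s - w') + norm (V n t - V n s) + norm (V n t - g t)"
      proof -
        have "w' - g t = - (V n s - w') - (V n t - V n s) + (V n t - g t)" by simp
        then show ?thesis unfolding dist_norm
          using norm_triangle_ineq[of "- (V n s - w') - (V n t - V n s)" "V n t - g t"]
            norm_triangle_ineq4[of "- (V n s - w')" "V n t - V n s"]
          by (simp add: norm_minus_commute)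
      qed
      moreover have "Q * e' = e" using Q by (simp add: e'_def)
      ultimately have "dist w' (g t) < e" using w'(2) by (simp add: Q_def algebra_simps)
      then show ?thesis using w'(1) by blast
    qed
    then have "g t \<in> closure (F (x t))" by (simp add: closure_approachable)
    then show ?thesis using closed by simp
  qed
  have shift: "(\<lambda>t. t - a) ` {a..a + \<tau>} = {0..\<tau>}" by (auto simp: image_iff intro: bexI[of _ "_ + a"])
  define v where "v t = g (t - a)" for t
  have v_lip: "(L * M)-lipschitz_on {a..a + \<tau>} v"
  proof (rule lipschitz_onI)
    fix s t assume "s \<in> {a..a + \<tau>}" "t \<in> {a..a + \<tau>}"
    then show "dist (v s) (v t) \<le> L * M * dist s t"
      using lipschitz_onD[OF g_lip, of "s - a" "t - a"] by (auto simp: v_def dist_real_def)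
  qed (use r in simp)
  show ?thesis
  proof (rule that[of "\<lambda>t. x (t - a)" v])
    have "((\<lambda>t. x (t - a)) has_vector_derivative v t) (at t within {a..a + \<tau>})" if "t \<in> {a..a + \<tau>}" for t
    proof -
      have "((\<lambda>t. t - a) has_vector_derivative 1) (at t within {a..a + \<tau>})"
        by (auto intro!: derivative_eq_intros)
      moreover have "(x has_vector_derivative g (t - a)) (at (t - a) within (\<lambda>t. t - a) ` {a..a + \<tau>})"
        unfolding shift using that by (intro x') auto
      ultimately show ?thesis using vector_diff_chain_within by (fastforce simp: o_def v_def)
    qed
    then show "arc_on F (\<lambda>t. x (t - a)) v a (a + \<tau>)"
      using v_lip gF by (auto simp: arc_on_def v_def)
    show "x (a - a) = \<xi>" by (simp add: x_def)
    show "v a = w" using \<open>g 0 = w\<close> by (simp add: v_def)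
  qed (rule v_lip)
qed

section \<open>Piecewise continuously differentiable trajectories\<close>

text \<open>One function \<open>x\<close> is fixed throughout, so breakpoints and velocities of the
  pieces stay hidden in the derivation. The degenerate case is kept because trajectories of duration
  0 give the lower bound of the Lyapunov function.\<close>

inductive traj :: "('a::euclidean_space \<Rightarrow> 'a set) \<Rightarrow> (real \<Rightarrow> 'a) \<Rightarrow> real \<Rightarrow> real \<Rightarrow> bool"
  for F :: "'a \<Rightarrow> 'a set" and x :: "real \<Rightarrow> 'a" and a :: real where
  refl: "traj F x a a"
| step: "traj F x a b \<Longrightarrow> b < c \<Longrightarrow> arc_on F x v b c \<Longrightarrow> traj F x a c"

lemma traj_le: "traj F x a b \<Longrightarrow> a \<le> b"
  by (induction rule: traj.induct) auto

lemma arc_on_cong: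
  assumes "arc_on F x v a b" and eq: "\<And>t. t \<in> {a..b} \<Longrightarrow> y t = x t"
  shows "arc_on F y v a b"
proof -
  have "(y has_vector_derivative v t) (at t within {a..b})"
    if "t \<in> {a..b}" "(x has_vector_derivative v t) (at t within {a..b})" for t
    by (rule has_vector_derivative_transform[OF that(1) eq that(2)])
  then show ?thesis using assms(1) unfolding arc_on_def by (auto simp: eq)
qed

lemma arc_on_subinterval:
  assumes "arc_on F x v a b" and "a \<le> a'" and "b' \<le> b"
  shows "arc_on F x v a' b'"
proof -
  have sub: "{a'..b'} \<subseteq> {a..b}" using assms(2,3) by auto
  obtain K where "K-lipschitz_on {a..b} v" using assms(1) by (auto simp: arc_on_def)
  then have "K-lipschitz_on {a'..b'} v" using sub by (rule lipschitz_on_subset)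
  moreover have "(x has_vector_derivative v t) (at t within {a'..b'})" if "t \<in> {a'..b'}" for t
    using assms(1) that sub unfolding arc_on_def
    by (intro has_vector_derivative_within_subset[OF _ sub]) auto
  ultimately show ?thesis using assms(1) sub unfolding arc_on_def by blast
qed

lemma arc_on_continuous: "arc_on F x v a b \<Longrightarrow> continuous_on {a..b} x"
  unfolding arc_on_def continuous_on_eq_continuous_within
  by (blast intro: has_vector_derivative_continuous)

lemma arc_on_shift:
  assumes "arc_on F x v a b"
  shows "arc_on F (\<lambda>t. x (t - s)) (\<lambda>t. v (t - s)) (a + s) (b + s)"
proof -
  have img: "(\<lambda>t. t - s) ` {a + s..b + s} = {a..b}"
    by (auto simp: image_iff intro!: bexI[of _ "_ + s"])
  obtain K where K: "K-lipschitz_on {a..b} v" using assms by (auto simp: arc_on_def)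
  have "K-lipschitz_on {a + s..b + s} (\<lambda>t. v (t - s))"
  proof (rule lipschitz_onI)
    fix p q assume "p \<in> {a + s..b + s}" "q \<in> {a + s..b + s}"
    then show "dist (v (p - s)) (v (q - s)) \<le> K * dist p q"
      using lipschitz_onD[OF K, of "p - s" "q - s"] by (auto simp: dist_real_def)
  qed (rule lipschitz_on_nonneg[OF K])
  moreover have "((\<lambda>t. x (t - s)) has_vector_derivative v (t - s)) (at t within {a + s..b + s})"
    if "t \<in> {a + s..b + s}" for t
  proof -
    have "((\<lambda>t. t - s) has_vector_derivative 1) (at t within {a + s..b + s})"
      by (auto intro!: derivative_eq_intros)
    moreover have "(x has_vector_derivative v (t - s)) (at (t - s) within (\<lambda>t. t - s) ` {a + s..b + s})"
      unfolding img using assms that by (auto simp: arc_on_def)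
    ultimately show ?thesis using vector_diff_chain_within by (fastforce simp: o_def)
  qed
  ultimately show ?thesis using assms unfolding arc_on_def by auto
qed

lemma traj_cong:
  assumes "traj F x a b" and "\<And>t. t \<in> {a..b} \<Longrightarrow> y t = x t"
  shows "traj F y a b"
  using assms
proof (induction rule: traj.induct)
  case (step b c v)
  have "traj F y a b" using step by auto
  moreover have "arc_on F y v b c"
    using step traj_le[OF step(1)] by (intro arc_on_cong[OF step(3)]) auto
  ultimately show ?case using step(2) traj.step by blast
qed (rule traj.refl)

lemma traj_trans:
  assumes "traj F x b c" and "traj F x a b"
  shows "traj F x a c"
  using assms by (induction rule: traj.induct) (auto intro: traj.step)

lemma arc_on_imp_traj:
  assumes "arc_on F x v a b" and "a \<le> b"
  shows "traj F x a b"
proof (cases "a = b")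
  case True
  then show ?thesis by (simp add: traj.refl)
next
  case False
  then show ?thesis using assms by (intro traj.step[OF traj.refl _ assms(1)]) simp
qed

lemma traj_shift: "traj F x a b \<Longrightarrow> traj F (\<lambda>t. x (t - s)) (a + s) (b + s)"
  by (induction rule: traj.induct) (auto intro: traj.intros arc_on_shift)

lemma traj_glue:
  assumes "traj F x a b" and "traj F y b c" and "x b = y b"
  shows "traj F (\<lambda>t. if t \<le> b then x t else y t) a c"
proof (rule traj_trans)
  show "traj F (\<lambda>t. if t \<le> b then x t else y t) a b"
    using assms(1) by (rule traj_cong) auto
  show "traj F (\<lambda>t. if t \<le> b then x t else y t) b c"
    using assms(2) by (rule traj_cong) (use assms(3) in auto)
qed

lemma traj_continuous: "traj F x a b \<Longrightarrow> continuous_on {a..b} x"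
proof (induction rule: traj.induct)
  case (step b c v)
  have "{a..c} = {a..b} \<union> {b..c}" using traj_le[OF step(1)] step(2) by auto
  then show ?case
    using step arc_on_continuous[OF step(3)] by (auto intro: continuous_on_closed_Un)
qed simp

lemma vector_derivative_lipschitz_on:
  fixes x :: "real \<Rightarrow> 'a::real_normed_vector"
  assumes "\<And>t. t \<in> {a..b} \<Longrightarrow> (x has_vector_derivative v t) (at t within {a..b})"
    and "\<And>t. t \<in> {a..b} \<Longrightarrow> norm (v t) \<le> M" and "0 \<le> M"
  shows "M-lipschitz_on {a..b} x"
proof (rule lipschitz_onI)
  fix s t assume "s \<in> {a..b}" "t \<in> {a..b}"
  then have "norm (x s - x t) \<le> M * norm (s - t)"
    using assms
    by (intro differentiable_bound[of "{a..b}" x "\<lambda>t h. h *\<^sub>R v t"])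
      (auto simp: has_vector_derivative_def onorm_scaleR_left_lemma onorm_scaleR_left onorm_id bounded_linear_ident)
  then show "dist (x s) (x t) \<le> M * dist s t" by (simp add: dist_norm)
qed (rule assms(3))

lemma arc_on_lipschitz:
  assumes "arc_on F x v a b"
  obtains M where "M-lipschitz_on {a..b} x"
proof -
  obtain K where "K-lipschitz_on {a..b} v" using assms by (auto simp: arc_on_def)
  then have "bounded (v ` {a..b})"
    by (intro compact_imp_bounded compact_continuous_image lipschitz_on_continuous_on) auto
  then obtain M where "0 < M" "\<And>t. t \<in> {a..b} \<Longrightarrow> norm (v t) \<le> M"
    unfolding bounded_pos by auto
  then have "M-lipschitz_on {a..b} x"
    using assms by (intro vector_derivative_lipschitz_on[where v = v]) (auto simp: arc_on_def)
  then show ?thesis by (rule that)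
qed

lemma traj_lipschitz: "traj F x a b \<Longrightarrow> \<exists>L. L-lipschitz_on {a..b} x"
proof (induction rule: traj.induct)
  case refl
  then show ?case by (intro exI[of _ 0] lipschitz_onI) auto
next
  case (step b c v)
  then obtain L M where "L-lipschitz_on {a..b} x" "M-lipschitz_on {b..c} x"
    using arc_on_lipschitz by metis
  then have "(max L M)-lipschitz_on {a..c} (\<lambda>t. if t \<le> b then x t else x t)"
    by (rule lipschitz_on_concat_max) simp
  then show ?case by auto
qed

lemma traj_derivative:
  assumes "traj F x a b"
  shows "\<exists>N. finite N \<and> (\<forall>t\<in>{a<..<b} - N. \<exists>v\<in>F (x t). (x has_vector_derivative v) (at t))"
  using assms
proof (induction rule: traj.induct)
  case (step b c v)
  then obtain N where N: "finite N" "\<forall>t\<in>{a<..<b} - N. \<exists>v\<in>F (x t). (x has_vector_derivative v) (at t)"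
    by blast
  have "\<exists>v\<in>F (x t). (x has_vector_derivative v) (at t)" if "t \<in> {b<..<c}" for t
  proof -
    have "at t within {b..c} = at t" using that by (intro at_within_interior) auto
    then show ?thesis using step(3) that by (force simp: arc_on_def)
  qed
  then show ?case using N by (intro exI[of _ "insert b N"]) force
qed auto

lemma traj_solution:
  assumes "traj F x 0 b" and "0 < b"
  shows "solution F (ereal b) x"
  unfolding solution_def
proof (intro conjI allI impI)
  show "0 < ereal b" using assms(2) by simp
  obtain L where L: "L-lipschitz_on {0..b} x" using traj_lipschitz[OF assms(1)] by blast
  show "abs_cont_on c d x" if "0 \<le> c \<and> c \<le> d \<and> ereal d < ereal b" for c d
    using that by (intro lipschitz_on_imp_abs_cont_on[OF lipschitz_on_subset[OF L]]) auto
  obtain N where N: "finite N" "\<forall>t\<in>{0<..<b} - N. \<exists>v\<in>F (x t). (x has_vector_derivative v) (at t)"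
    using traj_derivative[OF assms(1)] by blast
  show "AE t in lebesgue. t \<in> time_dom (ereal b) \<longrightarrow>
      (\<exists>v\<in>F (x t). (x has_vector_derivative v) (at t within time_dom (ereal b)))"
  proof (rule AE_I')
    \<comment> \<open>The time domain contains 0, whereas derivatives are known only inside the open
      interval.\<close>
    show "insert 0 N \<in> null_sets lebesgue"
      using N(1) by (simp add: negligible_finite flip: negligible_iff_null_sets)
    show "{t \<in> space lebesgue. \<not> (t \<in> time_dom (ereal b) \<longrightarrow>
        (\<exists>v\<in>F (x t). (x has_vector_derivative v) (at t within time_dom (ereal b))))} \<subseteq> insert 0 N"
    proof (intro subsetI, rule ccontr)
      fix t assume t: "t \<in> {t \<in> space lebesgue. \<not> (t \<in> time_dom (ereal b) \<longrightarrow>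
        (\<exists>v\<in>F (x t). (x has_vector_derivative v) (at t within time_dom (ereal b))))}" "t \<notin> insert 0 N"
      then have "t \<in> {0<..<b} - N" by (auto simp: time_dom_def)
      then obtain v where "v \<in> F (x t)" "(x has_vector_derivative v) (at t)" using N(2) by blast
      then show False using t(1) has_vector_derivative_at_within by blast
    qed
  qed
qed

text \<open>Each piece of length \<open>\<delta>\<close> is restarted with the admissible velocity closest to the velocity of the
  reference arc, so the distance grows as in the error analysis of Euler's scheme.\<close>

lemma arc_approximation:
  fixes F :: "'a::euclidean_space \<Rightarrow> 'a set"
  assumes F: "locally_lipschitz_setvalued F" "\<And>\<xi>. compact (F \<xi>)"
    and arc: "arc_on F x v a b" and "a < b" and "0 < \<epsilon>"
  shows "\<exists>d>0. \<forall>\<xi>. norm (\<xi> - x a) < d \<longrightarrow> (\<exists>y. traj F y a b \<and> y a = \<xi> \<and> (\<forall>t\<in>{a..b}. norm (y t - x t) < \<epsilon>))"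
proof -
  define N where "N = x ` {a..b}"
  have "compact N" using arc_on_continuous[OF arc] by (auto simp: N_def intro: compact_continuous_image)
  obtain r L M where r: "0 < r" "0 < L" "0 < M"
    and lip: "\<And>c \<eta> \<zeta> w. c \<in> N \<Longrightarrow> \<eta> \<in> cball c r \<Longrightarrow> \<zeta> \<in> cball c r \<Longrightarrow> w \<in> F \<eta> \<Longrightarrow>
           \<exists>w'\<in>F \<zeta>. norm (w - w') \<le> L * norm (\<eta> - \<zeta>)"
    and bound: "\<And>c \<eta> w. c \<in> N \<Longrightarrow> \<eta> \<in> cball c r \<Longrightarrow> w \<in> F \<eta> \<Longrightarrow> norm w \<le> M"
    by (rule locally_lipschitz_setvalued_compact[OF F \<open>compact N\<close>]) blast
  obtain K where K: "K-lipschitz_on {a..b} v" using arc by (auto simp: arc_on_def)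
  have "0 \<le> K" by (rule lipschitz_on_nonneg[OF K])
  \<comment> \<open>Within a piece of length \<open>\<delta>\<close> the new velocity drifts by at
    most \<open>L * M * \<delta>\<close> and the reference velocity by at most
    \<open>K * \<delta>\<close>.\<close>
  define C where "C = L * M + K"
  have "0 < C" using r \<open>0 \<le> K\<close> by (simp add: C_def add_pos_nonneg)
  define E where "E = exp (L * (b - a))"
  \<comment> \<open>The bound \<open>r / 2\<close> leaves room for a ball of radius
    \<open>r / 2\<close> around the new trajectory inside the ball of radius \<open>r\<close> around
    the reference point, where the constants are valid.\<close>
  define e where "e = min \<epsilon> (r / 2)"
  have e: "0 < e" "e \<le> \<epsilon>" "e \<le> r / 2" using r \<open>0 < \<epsilon>\<close> by (auto simp: e_def)
  define d where "d = e / (2 * E)"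
  have d: "0 < d" "d * E = e / 2" using e by (simp_all add: d_def E_def)
  \<comment> \<open>The first summand makes \<open>M * \<delta> \<le> r / 2\<close>, so that an arc
    of length \<open>\<delta>\<close> exists inside the small ball; the second keeps the accumulated
    drift below \<open>e / 2\<close>.\<close>
  obtain n where n: "(b - a) * (2 * M / r) + 2 * C * (b - a)\<^sup>2 * E / e < real n"
    using reals_Archimedean2 by blast
  have n_parts: "0 \<le> (b - a) * (2 * M / r)" "0 \<le> 2 * C * (b - a)\<^sup>2 * E / e"
    using r e \<open>a < b\<close> \<open>0 < C\<close> by (auto simp: E_def)
  have "0 < real n" using n n_parts by linarith
  define \<delta> where "\<delta> = (b - a) / real n"
  have \<delta>: "0 < \<delta>" "real n * \<delta> = b - a" using \<open>0 < real n\<close> \<open>a < b\<close> by (auto simp: \<delta>_def)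
  have M_\<delta>: "M * \<delta> \<le> r / 2"
  proof -
    have "(b - a) * (2 * M / r) < real n" using n n_parts by linarith
    then show ?thesis using r \<open>0 < real n\<close> by (simp add: \<delta>_def field_simps)
  qed
  have C_\<delta>: "C * \<delta> * (b - a) * E < e / 2"
  proof -
    have "2 * C * (b - a)\<^sup>2 * E / e < real n" using n n_parts by linarith
    then show ?thesis using e \<open>0 < real n\<close> by (simp add: \<delta>_def field_simps power2_eq_square)
  qed
  \<comment> \<open>A discrete Gronwall bound: initial error \<open>d\<close> plus drift
    \<open>C * \<delta>\<close> per unit of time, amplified exponentially. Passing through one piece
    uses \<open>1 + L * h \<le> exp (L * h)\<close>.\<close>
  define B where "B t = (d + C * \<delta> * (t - a)) * exp (L * (t - a))" for t
  have B_le: "B t < e" if "t \<in> {a..b}" for t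
  proof -
    have "B t \<le> (d + C * \<delta> * (b - a)) * E"
      unfolding B_def E_def using that d \<open>0 < C\<close> \<delta> r by (intro mult_mono add_left_mono mult_left_mono) auto
    then show ?thesis using d C_\<delta> by (simp add: distrib_right)
  qed
  show ?thesis
  proof (intro exI[of _ d] conjI allI impI)
    fix \<xi> assume \<xi>: "norm (\<xi> - x a) < d"
    have "\<exists>y. traj F y a (a + real k * \<delta>) \<and> y a = \<xi> \<and> (\<forall>t\<in>{a..a + real k * \<delta>}. norm (y t - x t) \<le> B t)"
      if "k \<le> n" for k
      using that
    proof (induction k)
      case 0
      then show ?case
        using \<xi> by (intro exI[of _ "\<lambda>_. \<xi>"]) (auto simp: B_def intro: traj.refl)
    next
      case (Suc k)
      define s where "s = a + real k * \<delta>"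
      have s: "a \<le> s" "s + \<delta> \<le> b" "a + real (Suc k) * \<delta> = s + \<delta>"
      proof -
        have "real (Suc k) * \<delta> \<le> real n * \<delta>" using Suc.prems \<delta> by (intro mult_right_mono) auto
        then show "s + \<delta> \<le> b" using \<delta> by (simp add: s_def algebra_simps)
      qed (use \<delta> in \<open>auto simp: s_def algebra_simps\<close>)
      then have s_mem: "s \<in> {a..b}" using \<delta> by auto
      obtain y where y: "traj F y a s" "y a = \<xi>" and y_B: "\<And>t. t \<in> {a..s} \<Longrightarrow> norm (y t - x t) \<le> B t"
        using Suc unfolding s_def by auto
      have y_s: "norm (y s - x s) \<le> B s" using y_B s by simp
      then have y_r: "norm (y s - x s) \<le> r / 2" using B_le[OF s_mem] e by linarith
      have "x s \<in> N" using s_mem by (auto simp: N_def)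
      have "v s \<in> F (x s)" using arc s_mem by (auto simp: arc_on_def)
      then obtain w where w: "w \<in> F (y s)" "norm (v s - w) \<le> L * norm (x s - y s)"
        using lip[of "x s" "x s" "y s" "v s"] \<open>x s \<in> N\<close> y_r r by (auto simp: dist_norm norm_minus_commute)
      have sub: "cball (y s) (r / 2) \<subseteq> cball (x s) r"
      proof
        fix \<eta> assume "\<eta> \<in> cball (y s) (r / 2)"
        then show "\<eta> \<in> cball (x s) r"
          using y_r dist_triangle[of "x s" \<eta> "y s"] by (simp add: dist_norm norm_minus_commute)
      qed
      obtain z u where z: "arc_on F z u s (s + \<delta>)" "z s = y s" "u s = w"
        and u_lip: "(L * M)-lipschitz_on {s..s + \<delta>} u"
      proof (rule local_arc[of F L M \<delta> w "y s" "r / 2" s])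
        show "closed (F \<eta>)" for \<eta> using F(2) by (simp add: compact_imp_closed)
        show "\<exists>w'\<in>F \<zeta>. norm (w - w') \<le> L * norm (\<eta> - \<zeta>)"
          if "\<eta> \<in> cball (y s) (r / 2)" "\<zeta> \<in> cball (y s) (r / 2)" "w \<in> F \<eta>" for \<eta> \<zeta> w
          using lip[OF \<open>x s \<in> N\<close>] that sub by blast
        show "norm w \<le> M" if "\<eta> \<in> cball (y s) (r / 2)" "w \<in> F \<eta>" for \<eta> w
          using bound[OF \<open>x s \<in> N\<close>] that sub by blast
      qed (use r \<delta> w M_\<delta> in auto)
      define Q where "Q = L * norm (y s - x s) + C * \<delta>"
      have "0 \<le> Q" using r \<open>0 < C\<close> \<delta> by (simp add: Q_def)
      have "Q-lipschitz_on {s..s + \<delta>} (\<lambda>t. z t - x t)"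
      proof (rule vector_derivative_lipschitz_on)
        fix t assume t: "t \<in> {s..s + \<delta>}"
        have "(z has_vector_derivative u t) (at t within {s..s + \<delta>})" using z(1) t by (simp add: arc_on_def)
        moreover have "(x has_vector_derivative v t) (at t within {s..s + \<delta>})"
          using arc_on_subinterval[OF arc, of s "s + \<delta>"] s t by (simp add: arc_on_def)
        ultimately show "((\<lambda>t. z t - x t) has_vector_derivative u t - v t) (at t within {s..s + \<delta>})"
          by (rule has_vector_derivative_diff)
        have "norm (u t - u s) \<le> L * M * (t - s)"
          using lipschitz_onD[OF u_lip t, of s] t by (auto simp: dist_norm)
        moreover have "norm (v s - v t) \<le> K * (t - s)"
          using lipschitz_onD[OF K, of s t] t s by (auto simp: dist_norm)
        moreover have "(L * M + K) * (t - s) \<le> C * \<delta>"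
          unfolding C_def[symmetric] using t \<open>0 < C\<close> by (intro mult_left_mono) auto
        moreover have "norm (u s - v s) \<le> L * norm (y s - x s)"
          using w(2) z(3) by (simp add: norm_minus_commute)
        moreover have "norm (u t - v t) \<le> norm (u t - u s) + norm (u s - v s) + norm (v s - v t)"
          using norm_triangle_ineq[of "u t - u s" "(u s - v s) + (v s - v t)"]
            norm_triangle_ineq[of "u s - v s" "v s - v t"] by simp
        ultimately show "norm (u t - v t) \<le> Q" by (simp add: Q_def distrib_right)
      qed (rule \<open>0 \<le> Q\<close>)
      have z_B: "norm (z t - x t) \<le> B t" if t: "t \<in> {s..s + \<delta>}" for t
      proof -
        define h where "h = t - s"
        have h: "0 \<le> h" "h \<le> \<delta>" using t by (auto simp: h_def)
        have "norm ((z t - x t) - (z s - x s)) \<le> Q * h"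
          using lipschitz_onD[OF \<open>Q-lipschitz_on _ _\<close> t, of s] t by (auto simp: dist_norm h_def)
        then have "norm (z t - x t) \<le> norm (y s - x s) + Q * h"
          using norm_triangle_ineq[of "(z t - x t) - (z s - x s)" "z s - x s"] z(2) by simp
        also have "\<dots> = norm (y s - x s) * (1 + L * h) + C * \<delta> * h" by (simp add: Q_def algebra_simps)
        also have "\<dots> \<le> B s * exp (L * h) + C * \<delta> * h"
        proof -
          have "norm (y s - x s) * (1 + L * h) \<le> B s * exp (L * h)"
            using y_s exp_ge_add_one_self[of "L * h"] h r order_trans[OF norm_ge_zero y_s]
            by (intro mult_mono) auto
          then show ?thesis by simp
        qed
        also have "\<dots> = (d + C * \<delta> * (s - a)) * exp (L * (t - a)) + C * \<delta> * h"
        proof -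
          have "exp (L * (s - a)) * exp (L * h) = exp (L * (t - a))"
            unfolding exp_add[symmetric] by (simp add: h_def algebra_simps)
          then show ?thesis by (simp add: B_def mult.assoc)
        qed
        also have "\<dots> \<le> (d + C * \<delta> * (s - a)) * exp (L * (t - a)) + C * \<delta> * h * exp (L * (t - a))"
        proof -
          have "1 \<le> exp (L * (t - a))" using t s r by simp
          then have "C * \<delta> * h * 1 \<le> C * \<delta> * h * exp (L * (t - a))"
            using h \<delta> \<open>0 < C\<close> by (intro mult_left_mono) auto
          then show ?thesis by simp
        qed
        also have "\<dots> = B t" by (simp add: B_def h_def algebra_simps)
        finally show ?thesis .
      qed
      have "traj F (\<lambda>t. if t \<le> s then y t else z t) a (s + \<delta>)"
        using y(1) arc_on_imp_traj[OF z(1)] \<delta> z(2) by (intro traj_glue) auto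
      moreover have "norm ((if t \<le> s then y t else z t) - x t) \<le> B t" if "t \<in> {a..s + \<delta>}" for t
        using y_B[of t] z_B[of t] that by auto
      ultimately show ?case
        unfolding s(3) using y(2) s(1) by (intro exI[of _ "\<lambda>t. if t \<le> s then y t else z t"]) auto
    qed
    from this[of n] obtain y where y: "traj F y a b" "y a = \<xi>" "\<And>t. t \<in> {a..b} \<Longrightarrow> norm (y t - x t) \<le> B t"
      using \<delta>(2) by auto
    have "norm (y t - x t) < \<epsilon>" if "t \<in> {a..b}" for t
      using y(3)[OF that] B_le[OF that] e(2) by linarith
    with y(1,2) show "\<exists>y. traj F y a b \<and> y a = \<xi> \<and> (\<forall>t\<in>{a..b}. norm (y t - x t) < \<epsilon>)"
      by blast
  qed (rule d(1))
qed

text \<open>Tolerances are fixed backwards: the last arc determines how accurately its starting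
  point must be met, and this accuracy is demanded from the induction hypothesis.\<close>

lemma traj_approximation:
  fixes F :: "'a::euclidean_space \<Rightarrow> 'a set"
  assumes F: "locally_lipschitz_setvalued F" "\<And>\<xi>. compact (F \<xi>)"
    and "traj F x a b" and "0 < \<epsilon>"
  shows "\<exists>d>0. \<forall>\<xi>. norm (\<xi> - x a) < d \<longrightarrow> (\<exists>y. traj F y a b \<and> y a = \<xi> \<and> (\<forall>t\<in>{a..b}. norm (y t - x t) < \<epsilon>))"
  using assms(3,4)
proof (induction arbitrary: \<epsilon> rule: traj.induct)
  case refl
  then show ?case by (intro exI[of _ \<epsilon>]) (auto intro!: exI[of _ "\<lambda>_. _"] traj.refl)
next
  case (step b c v)
  obtain d where d: "0 < d" "\<And>\<xi>. norm (\<xi> - x b) < d \<Longrightarrow>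
      \<exists>z. traj F z b c \<and> z b = \<xi> \<and> (\<forall>t\<in>{b..c}. norm (z t - x t) < \<epsilon>)"
    using arc_approximation[OF F step(3,2) step(5)] by blast
  obtain d' where d': "0 < d'" "\<And>\<xi>. norm (\<xi> - x a) < d' \<Longrightarrow>
      \<exists>y. traj F y a b \<and> y a = \<xi> \<and> (\<forall>t\<in>{a..b}. norm (y t - x t) < min \<epsilon> d)"
    using step.IH[of "min \<epsilon> d"] d(1) step(5) by auto
  have ab: "a \<le> b" by (rule traj_le[OF step(1)])
  show ?case
  proof (intro exI[of _ d'] conjI allI impI)
    fix \<xi> assume "norm (\<xi> - x a) < d'"
    then obtain y where y: "traj F y a b" "y a = \<xi>" "\<forall>t\<in>{a..b}. norm (y t - x t) < min \<epsilon> d"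
      using d'(2) by blast
    then have "norm (y b - x b) < d" using ab by auto
    then obtain z where z: "traj F z b c" "z b = y b" "\<forall>t\<in>{b..c}. norm (z t - x t) < \<epsilon>"
      using d(2) by blast
    have "traj F (\<lambda>t. if t \<le> b then y t else z t) a c"
      using y z by (intro traj_glue) auto
    then show "\<exists>y. traj F y a c \<and> y a = \<xi> \<and> (\<forall>t\<in>{a..c}. norm (y t - x t) < \<epsilon>)"
      using y z ab by (intro exI[of _ "\<lambda>t. if t \<le> b then y t else z t"]) auto
  qed (rule d'(1))
qed

section \<open>Extension to maximal solutions\<close>

lemma abs_cont_on_cong:
  assumes "abs_cont_on a b f" and "\<And>t. t \<in> {a..b} \<Longrightarrow> u t = f t"
  shows "abs_cont_on a b u"
  using assms by (intro abs_cont_on_dominated[OF assms(1), of 1]) auto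

lemma time_dom_mono: "S \<le> T \<Longrightarrow> time_dom S \<subseteq> time_dom T"
  by (auto simp: time_dom_def)

lemma time_dom_strict:
  assumes "0 < S" and "S < T"
  obtains t where "t \<in> time_dom T" and "t \<notin> time_dom S"
proof -
  obtain r where "S = ereal r" using assms by (cases S) auto
  then show ?thesis using assms by (intro that[of r]) (auto simp: time_dom_def)
qed

text \<open>The end of the domain is excluded, so both domains agree near \<open>t\<close>.
  Derivatives along a solution thus carry over to its extensions.\<close>

lemma at_within_time_dom:
  assumes "t \<in> time_dom S" and "S \<le> T"
  shows "at t within time_dom S = at t within time_dom T"
proof -
  obtain c where c: "ereal t < ereal c" "ereal c < S"
    using assms(1) ereal_dense2[of "ereal t" S] by (auto simp: time_dom_def)
  have "u \<in> time_dom S" if "u \<in> time_dom T" "u < c" for u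
    using that c(2) by (auto simp: time_dom_def intro: less_trans[of "ereal u" "ereal c"])
  then show ?thesis
    using c time_dom_mono[OF assms(2)] by (intro at_within_nhd[of t "{..<c}"]) auto
qed

text \<open>Supplies the upper bound of a chain for Zorn's lemma.\<close>

lemma solution_Sup:
  fixes I :: "(ereal \<times> (real \<Rightarrow> 'a::euclidean_space)) set"
  assumes "I \<noteq> {}" and sol: "\<And>S y. (S, y) \<in> I \<Longrightarrow> solution F S y"
    and agree: "\<And>S y t. (S, y) \<in> I \<Longrightarrow> t \<in> time_dom S \<Longrightarrow> x t = y t"
  shows "solution F (Sup (fst ` I)) x"
  unfolding solution_def
proof (intro conjI allI impI)
  obtain S0 y0 where "(S0, y0) \<in> I" using \<open>I \<noteq> {}\<close> by fastforce
  then have "0 < S0" "S0 \<le> Sup (fst ` I)" using sol by (auto simp: solution_def intro!: Sup_upper image_eqI[of _ fst "(S0, y0)"])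
  then show "0 < Sup (fst ` I)" by simp
  show "abs_cont_on a b x" if ab: "0 \<le> a \<and> a \<le> b \<and> ereal b < Sup (fst ` I)" for a b
  proof -
    obtain S y where Sy: "(S, y) \<in> I" "ereal b < S" using ab by (auto simp: less_Sup_iff)
    have "{a..b} \<subseteq> time_dom S"
      using that le_less_trans[OF _ Sy(2)] by (auto simp: time_dom_def)
    then show ?thesis
      using sol[OF Sy(1)] that Sy by (intro abs_cont_on_cong[of a b y x] agree[OF Sy(1)]) (auto simp: solution_def)
  qed
  \<comment> \<open>The family may be uncountable, and its exceptional sets cannot simply be united.
    A sequence of members whose end times have the same supremum covers the whole domain with
    countably many null sets.\<close>
  obtain f :: "nat \<Rightarrow> ereal" where f: "range f \<subseteq> fst ` I" "Sup (fst ` I) = (SUP n. f n)"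
    using Sup_countable_SUP[of "fst ` I"] \<open>I \<noteq> {}\<close> by auto
  have "\<forall>n. \<exists>y. (f n, y) \<in> I" using f(1) by fastforce
  then obtain y where y: "\<And>n. (f n, y n) \<in> I" by metis
  have "AE t in lebesgue. \<forall>n. t \<in> time_dom (f n) \<longrightarrow>
      (\<exists>v\<in>F (y n t). (y n has_vector_derivative v) (at t within time_dom (f n)))"
    using sol[OF y] unfolding AE_all_countable by (simp add: solution_def)
  then show "AE t in lebesgue. t \<in> time_dom (Sup (fst ` I)) \<longrightarrow>
      (\<exists>v\<in>F (x t). (x has_vector_derivative v) (at t within time_dom (Sup (fst ` I))))"
  proof (rule AE_mp, intro AE_I2 impI)
    fix t assume der: "\<forall>n. t \<in> time_dom (f n) \<longrightarrow>
        (\<exists>v\<in>F (y n t). (y n has_vector_derivative v) (at t within time_dom (f n)))"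
      and t: "t \<in> time_dom (Sup (fst ` I))"
    obtain n where n: "t \<in> time_dom (f n)"
      using t unfolding f(2) by (auto simp: time_dom_def less_SUP_iff)
    then obtain v where v: "v \<in> F (y n t)" "(y n has_vector_derivative v) (at t within time_dom (f n))"
      using der by blast
    have "(x has_vector_derivative v) (at t within time_dom (f n))"
      by (rule has_vector_derivative_transform[OF n agree[OF y] v(2)])
    moreover have "f n \<le> Sup (fst ` I)" unfolding f(2) by (rule SUP_upper) simp
    ultimately show "\<exists>v\<in>F (x t). (x has_vector_derivative v) (at t within time_dom (Sup (fst ` I)))"
      using v(1) agree[OF y n] at_within_time_dom[OF n] by auto
  qed
qed

text \<open>Zorn's lemma is applied to graphs over the time domain: representing functions are
  total, and the graph forgets their arbitrary values outside it. A proper extension enlarges the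
  graph because a longer domain contains a new time.\<close>

lemma maximal_extension:
  fixes F :: "'a::euclidean_space \<Rightarrow> 'a set"
  assumes "solution F T x"
  obtains T' x' where "T \<le> T'" and "maximal_solution F T' x'" and "\<And>t. t \<in> time_dom T \<Longrightarrow> x' t = x t"
proof -
  define graph :: "ereal \<Rightarrow> (real \<Rightarrow> 'a) \<Rightarrow> (real \<times> 'a) set" where "graph S y = (\<lambda>t. (t, y t)) ` time_dom S" for S y
  define ext where "ext S y \<longleftrightarrow> solution F S y \<and> T \<le> S \<and> (\<forall>t\<in>time_dom T. y t = x t)" for S y
  define \<A> where "\<A> = {graph S y | S y. ext S y}"
  have "\<exists>M\<in>\<A>. \<forall>X\<in>\<A>. M \<subseteq> X \<longrightarrow> X = M"
  proof (rule subset_Zorn_nonempty)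
    show "\<A> \<noteq> {}" using assms by (auto simp: \<A>_def ext_def)
    fix \<C> assume "\<C> \<noteq> {}" and chain: "subset.chain \<A> \<C>"
    define I where "I = {(S, y). ext S y \<and> graph S y \<in> \<C>}"
    have C: "\<C> = (\<lambda>(S, y). graph S y) ` I"
      using chain by (fastforce simp: subset_chain_def \<A>_def I_def)
    have same: "y t = z t" if "(S, y) \<in> I" "(R, z) \<in> I" "t \<in> time_dom S" "t \<in> time_dom R" for S y R z t
    proof -
      have "graph S y \<subseteq> graph R z \<or> graph R z \<subseteq> graph S y"
        using chain that(1,2) by (auto simp: subset_chain_def I_def)
      then show ?thesis using that(3,4) by (fastforce simp: graph_def)
    qed
    \<comment> \<open>The choice is immaterial: two members of a chain agree wherever both are
      defined.\<close>
    define X where "X t = (SOME a. \<exists>S y. (S, y) \<in> I \<and> t \<in> time_dom S \<and> a = y t)" for t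
    have X: "X t = y t" if mem: "(S, y) \<in> I" "t \<in> time_dom S" for S y t
    proof -
      have "\<exists>S y. (S, y) \<in> I \<and> t \<in> time_dom S \<and> X t = y t"
        unfolding X_def by (rule someI_ex) (use mem in blast)
      then obtain R z where "(R, z) \<in> I" "t \<in> time_dom R" "X t = z t" by blast
      then show ?thesis using same[OF _ mem(1) _ mem(2)] by simp
    qed
    have "I \<noteq> {}" using \<open>\<C> \<noteq> {}\<close> C by auto
    then obtain S0 y0 where S0: "(S0, y0) \<in> I" by fastforce
    have le: "S \<le> Sup (fst ` I)" if "(S, y) \<in> I" for S y
      using that by (intro Sup_upper) force
    have dom: "time_dom (Sup (fst ` I)) = (\<Union>p\<in>I. time_dom (fst p))"
      by (auto simp: time_dom_def less_Sup_iff)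
    have "solution F (Sup (fst ` I)) X"
      using \<open>I \<noteq> {}\<close> X by (intro solution_Sup) (auto simp: I_def ext_def)
    moreover have "T \<le> Sup (fst ` I)"
      using le[OF S0] S0 by (auto simp: I_def ext_def intro: order_trans)
    moreover have "X t = x t" if "t \<in> time_dom T" for t
    proof -
      have "t \<in> time_dom S0" using that S0 time_dom_mono[of T S0] by (auto simp: I_def ext_def)
      then show ?thesis using X[OF S0] S0 that by (simp add: I_def ext_def)
    qed
    ultimately have "ext (Sup (fst ` I)) X" by (simp add: ext_def)
    moreover have "\<Union>\<C> = graph (Sup (fst ` I)) X"
    proof -
      have "graph (fst p) (snd p) = (\<lambda>t. (t, X t)) ` time_dom (fst p)" if "p \<in> I" for p
        unfolding graph_def using X[of "fst p" "snd p"] that by (intro image_cong) auto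
      then have "\<Union>\<C> = (\<Union>p\<in>I. (\<lambda>t. (t, X t)) ` time_dom (fst p))"
        unfolding C by (simp add: case_prod_unfold)
      then show ?thesis unfolding graph_def dom by (simp add: image_UN)
    qed
    ultimately show "\<Union>\<C> \<in> \<A>" unfolding \<A>_def by blast
  qed
  then obtain M where M: "M \<in> \<A>" "\<And>X. X \<in> \<A> \<Longrightarrow> M \<subseteq> X \<Longrightarrow> X = M" by blast
  obtain T' x' where ext': "ext T' x'" and "M = graph T' x'" using M(1) by (auto simp: \<A>_def)
  then have max: "graph S y = graph T' x'" if "ext S y" "graph T' x' \<subseteq> graph S y" for S y
    using M(2)[of "graph S y"] that by (auto simp: \<A>_def)
  have "maximal_solution F T' x'"
    unfolding maximal_solution_def
  proof (intro conjI notI)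
    show "solution F T' x'" using ext' by (simp add: ext_def)
    assume "\<exists>S y. T' < S \<and> solution F S y \<and> (\<forall>t\<in>time_dom T'. y t = x' t)"
    then obtain S y where S: "T' < S" "solution F S y" "\<forall>t\<in>time_dom T'. y t = x' t" by blast
    have "ext S y"
      using S ext' time_dom_mono[of T T'] by (auto simp: ext_def)
    moreover have "graph T' x' \<subseteq> graph S y"
      using S(3) time_dom_mono[of T' S] S(1) by (force simp: graph_def)
    ultimately have eq: "graph S y = graph T' x'" by (rule max)
    obtain t where "t \<in> time_dom S" "t \<notin> time_dom T'"
      using time_dom_strict[OF _ S(1)] ext' by (auto simp: ext_def solution_def)
    then show False using eq by (auto simp: graph_def)
  qed
  then show ?thesis using ext' by (intro that[of T' x']) (auto simp: ext_def)
qed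

section \<open>The converse theorem\<close>

lemma locally_lipschitz_map_imp_continuous:
  assumes "locally_lipschitz_map f"
  shows "continuous_on UNIV f"
proof -
  have "isCont f \<xi>" for \<xi>
  proof -
    obtain U L where "open U" "\<xi> \<in> U" "L-lipschitz_on U f"
      using assms unfolding locally_lipschitz_map_def by blast
    then show ?thesis
      using lipschitz_on_continuous_on continuous_on_eq_continuous_at by blast
  qed
  then show ?thesis by (simp add: continuous_on_eq_continuous_at)
qed

lemma local_arc_exists:
  fixes F :: "'a::euclidean_space \<Rightarrow> 'a set"
  assumes F: "locally_lipschitz_setvalued F" "\<And>\<xi>. compact (F \<xi>)" and w: "w \<in> F \<xi>"
  obtains x v \<tau> where "0 < \<tau>" and "arc_on F x v a (a + \<tau>)" and "x a = \<xi>" and "v a = w"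
proof -
  obtain r L M where r: "0 < r" "0 < L" "0 < M"
    and lip: "\<And>c \<eta> \<zeta> w. c \<in> {\<xi>} \<Longrightarrow> \<eta> \<in> cball c r \<Longrightarrow> \<zeta> \<in> cball c r \<Longrightarrow> w \<in> F \<eta> \<Longrightarrow>
           \<exists>w'\<in>F \<zeta>. norm (w - w') \<le> L * norm (\<eta> - \<zeta>)"
    and bound: "\<And>c \<eta> w. c \<in> {\<xi>} \<Longrightarrow> \<eta> \<in> cball c r \<Longrightarrow> w \<in> F \<eta> \<Longrightarrow> norm w \<le> M"
    by (rule locally_lipschitz_setvalued_compact[OF F, of "{\<xi>}"]) (simp, blast)
  obtain x v where "arc_on F x v a (a + r / M)" "x a = \<xi>" "v a = w"
    by (rule local_arc[of F L M "r / M" w \<xi> r a])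
      (use r w lip bound F(2) in \<open>auto simp: compact_imp_closed\<close>)
  then show ?thesis using r by (intro that[of "r / M" x v]) auto
qed

text \<open>The trajectory is first prolonged beyond \<open>b\<close> inside the open set \<open>D\<close>: the SIT estimate is
  available only for positive times before the end of the domain of a solution.\<close>

lemma SIT_traj_bound:
  fixes F :: "'a::euclidean_space \<Rightarrow> 'a set"
  assumes F: "locally_lipschitz_setvalued F" "\<And>\<xi>. compact (F \<xi>)" "\<And>\<xi>. F \<xi> \<noteq> {}"
    and "open {\<xi>. norm (h \<xi>) > \<rho> (norm (g \<xi>))}"
    and SIT: "\<forall>T x t1. maximal_solution F T x \<and> 0 < t1 \<and> ereal t1 < T \<and>
        (\<forall>t\<in>{0..t1}. norm (h (x t)) > \<rho> (norm (g (x t)))) \<longrightarrow>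
        (\<forall>t\<in>{0..t1}. norm (h (x t)) \<le> \<beta> (\<omega> (x 0)) t)"
    and x: "traj F x 0 b" and D: "\<And>t. t \<in> {0..b} \<Longrightarrow> norm (h (x t)) > \<rho> (norm (g (x t)))"
  shows "norm (h (x b)) \<le> \<beta> (\<omega> (x 0)) b"
proof -
  define D where "D = {\<xi>. norm (h \<xi>) > \<rho> (norm (g \<xi>))}"
  have "0 \<le> b" by (rule traj_le[OF x])
  obtain w where w: "w \<in> F (x b)" using F(3)[of "x b"] by blast
  obtain z v \<tau> where z: "0 < \<tau>" "arc_on F z v b (b + \<tau>)" "z b = x b"
    by (rule local_arc_exists[OF F(1,2) w, of b]) blast
  have "continuous_on {b..b + \<tau>} z" by (rule arc_on_continuous[OF z(2)])
  moreover have "z b \<in> D" using D[of b] \<open>0 \<le> b\<close> z(3) by (simp add: D_def)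
  ultimately obtain d where d: "0 < d" "\<And>t. t \<in> {b..b + \<tau>} \<Longrightarrow> dist t b < d \<Longrightarrow> z t \<in> D"
  proof -
    obtain e where e: "0 < e" "ball (z b) e \<subseteq> D"
      using assms(4) \<open>z b \<in> D\<close> unfolding D_def[symmetric] by (meson open_contains_ball)
    obtain d where "0 < d" "\<And>t. t \<in> {b..b + \<tau>} \<Longrightarrow> dist t b < d \<Longrightarrow> dist (z t) (z b) < e"
      using \<open>continuous_on {b..b + \<tau>} z\<close> e(1) z(1) unfolding continuous_on_iff
      by (metis atLeastAtMost_iff le_add_same_cancel1 less_imp_le order_refl)
    then show thesis using e(2) by (intro that[of d]) (auto simp: dist_commute subset_eq)
  qed
  \<comment> \<open>Half the minimum keeps \<open>t1\<close> strictly inside the prolonged domain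
    and inside \<open>D\<close>, and \<open>t1\<close> is positive even if
    \<open>b = 0\<close>.\<close>
  define t1 where "t1 = b + min \<tau> d / 2"
  have t1: "b < t1" "t1 < b + \<tau>" "t1 < b + d" using z(1) d(1) by (auto simp: t1_def min_def)
  define y where "y t = (if t \<le> b then x t else z t)" for t
  have "traj F y 0 (b + \<tau>)"
    unfolding y_def using x arc_on_imp_traj[OF z(2)] z by (intro traj_glue) auto
  then have "solution F (ereal (b + \<tau>)) y"
    using \<open>0 \<le> b\<close> z(1) by (intro traj_solution) auto
  then obtain T x' where x': "ereal (b + \<tau>) \<le> T" "maximal_solution F T x'"
    "\<And>t. t \<in> time_dom (ereal (b + \<tau>)) \<Longrightarrow> x' t = y t"
    using maximal_extension by blast
  have eq: "x' t = y t" if "t \<in> {0..t1}" for t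
    using that t1 by (intro x'(3)) (auto simp: time_dom_def)
  have "y t \<in> D" if "t \<in> {0..t1}" for t
    using that D[of t] d(2)[of t] t1 by (auto simp: y_def D_def dist_real_def)
  then have "\<forall>t\<in>{0..t1}. norm (h (x' t)) > \<rho> (norm (g (x' t)))" by (auto simp: eq D_def)
  moreover have "ereal t1 < T" using t1 x'(1) by (intro less_le_trans[OF _ x'(1)]) simp
  ultimately have "norm (h (x' b)) \<le> \<beta> (\<omega> (x' 0)) b"
    using x'(2) t1 \<open>0 \<le> b\<close> SIT[rule_format, of T x' t1 b] by auto
  then show ?thesis using eq[of b] eq[of 0] t1 \<open>0 \<le> b\<close> by (simp add: y_def)
qed

lemma SIT_imp_exp_lyapunov:
  fixes F :: "'a::euclidean_space \<Rightarrow> 'a set"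
  assumes F: "locally_lipschitz_setvalued F" "\<And>\<xi>. compact (F \<xi>)" "\<And>\<xi>. F \<xi> \<noteq> {}"
    and h: "continuous_on UNIV h" and "open {\<xi>. norm (h \<xi>) > \<rho> (norm (g \<xi>))}"
    and \<omega>: "\<And>\<xi>. 0 \<le> \<omega> \<xi>" and "SIT F h g \<omega> \<rho>"
  shows "\<exists>V. lsc_exp_SIT_lyapunov F h g \<omega> \<rho> V"
proof -
  define D where "D = {\<xi>. norm (h \<xi>) > \<rho> (norm (g \<xi>))}"
  have "open D" using assms(5) by (simp add: D_def)
  obtain \<beta> where \<beta>: "class_KL \<beta>" and SIT: "\<forall>T x t1. maximal_solution F T x \<and> 0 < t1 \<and> ereal t1 < T \<and>
        (\<forall>t\<in>{0..t1}. norm (h (x t)) > \<rho> (norm (g (x t)))) \<longrightarrow>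
        (\<forall>t\<in>{0..t1}. norm (h (x t)) \<le> \<beta> (\<omega> (x 0)) t)"
    using \<open>SIT F h g \<omega> \<rho>\<close> unfolding SIT_def by blast
  obtain \<theta>1 \<theta>2 where \<theta>: "class_K_inf \<theta>1" "class_K_inf \<theta>2"
    and \<theta>_le: "\<And>s t. 0 \<le> s \<Longrightarrow> 0 \<le> t \<Longrightarrow> exp t * \<theta>1 (\<beta> s t) \<le> \<theta>2 s"
    using class_KL_exponential[OF \<beta>] by metis
  note K = \<theta>[THEN class_K_inf_imp_class_K]
  define path where "path \<xi> b x \<longleftrightarrow> traj F x 0 b \<and> x 0 = \<xi> \<and> (\<forall>t\<in>{0..b}. x t \<in> D)" for \<xi> b x
  define P where "P b x = exp b * \<theta>1 (norm (h (x b)))" for b and x :: "real \<Rightarrow> 'a"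
  \<comment> \<open>Outside \<open>D\<close> no path exists, since its initial point would have to
    lie in \<open>D\<close>; the inserted 0 is then the value. On \<open>D\<close> it changes
    nothing, as all \<open>P b x\<close> are nonnegative.\<close>
  define V where "V \<xi> = Sup (insert 0 {P b x | b x. path \<xi> b x})" for \<xi>
  have P_le: "P b x \<le> \<theta>2 (\<omega> \<xi>)" if "path \<xi> b x" for \<xi> b x
  proof -
    have "0 \<le> b" using that traj_le by (auto simp: path_def)
    have "norm (h (x b)) \<le> \<beta> (\<omega> (x 0)) b"
    proof (rule SIT_traj_bound[where h = h and g = g and \<rho> = \<rho> and \<beta> = \<beta> and \<omega> = \<omega>, OF F assms(5) SIT])
      show "traj F x 0 b" using that by (simp add: path_def)
      show "\<rho> (norm (g (x t))) < norm (h (x t))" if "t \<in> {0..b}" for t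
        using \<open>path \<xi> b x\<close> that by (auto simp: path_def D_def)
    qed
    then have "P b x \<le> exp b * \<theta>1 (\<beta> (\<omega> \<xi>) b)"
      using that by (auto simp: P_def path_def intro!: class_K_mono[OF K(1)])
    also have "\<dots> \<le> \<theta>2 (\<omega> \<xi>)" by (rule \<theta>_le[OF \<omega> \<open>0 \<le> b\<close>])
    finally show ?thesis .
  qed
  have bdd: "bdd_above (insert 0 {P b x | b x. path \<xi> b x})" for \<xi>
    using P_le[of \<xi>] by (intro bdd_aboveI[of _ "max 0 (\<theta>2 (\<omega> \<xi>))"]) (auto simp: max.coboundedI2)
  have V_nonneg: "0 \<le> V \<xi>" for \<xi> unfolding V_def by (intro cSup_upper bdd) simp
  have V_ge: "P b x \<le> V \<xi>" if "path \<xi> b x" for \<xi> b x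
    unfolding V_def by (rule cSup_upper[OF _ bdd]) (use that in blast)
  have V_least: "V \<xi> \<le> B" if "0 \<le> B" "\<And>b x. path \<xi> b x \<Longrightarrow> P b x \<le> B" for \<xi> B
    unfolding V_def using that by (intro cSup_least) auto
  \<comment> \<open>A path with payoff above \<open>c\<close> has compact image in the open set
    \<open>D\<close>, and its payoff depends continuously on the end point. Paths from nearby
    initial points that follow it closely thus stay in \<open>D\<close> and still pay more than
    \<open>c\<close>.\<close>
  have lsc: "lower_semicontinuous V"
    unfolding lower_semicontinuous_def
  proof (intro allI impI)
    fix \<xi> c assume "c < V \<xi>"
    then obtain s where "s \<in> insert 0 {P b x | b x. path \<xi> b x}" "c < s"
      unfolding V_def using less_cSup_iff[OF _ bdd] by blast
    then consider "c < 0" | b x where "path \<xi> b x" "c < P b x" by blast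
    then show "\<forall>\<^sub>F \<eta> in nhds \<xi>. c < V \<eta>"
    proof cases
      case 1
      then have "c < V \<eta>" for \<eta> using V_nonneg[of \<eta>] by linarith
      then show ?thesis by simp
    next
      case 2
      have x: "traj F x 0 b" "x 0 = \<xi>" "\<And>t. t \<in> {0..b} \<Longrightarrow> x t \<in> D" using 2(1) by (auto simp: path_def)
      have "0 \<le> b" by (rule traj_le[OF x(1)])
      have "compact (x ` {0..b})" using traj_continuous[OF x(1)] by (intro compact_continuous_image) auto
      then obtain e1 where e1: "0 < e1" "(\<Union>p\<in>x ` {0..b}. ball p e1) \<subseteq> D"
        using compact_subset_open_imp_ball_epsilon_subset[OF _ \<open>open D\<close>, of "x ` {0..b}"] x(3) by blast
      have "continuous_on UNIV (\<lambda>\<eta>. exp b * \<theta>1 (norm (h \<eta>)))"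
        using h K(1)
        by (intro continuous_on_mult continuous_on_const continuous_on_norm
            continuous_on_compose2[of "{0..}" \<theta>1 UNIV "\<lambda>\<eta>. norm (h \<eta>)"]) (auto simp: class_K_def)
      then have "open {\<eta>. c < exp b * \<theta>1 (norm (h \<eta>))}"
        by (intro open_Collect_less continuous_on_const)
      moreover have "x b \<in> {\<eta>. c < exp b * \<theta>1 (norm (h \<eta>))}" using 2(2) by (simp add: P_def)
      ultimately obtain e2 where e2: "0 < e2" "ball (x b) e2 \<subseteq> {\<eta>. c < exp b * \<theta>1 (norm (h \<eta>))}"
        by (meson open_contains_ball)
      obtain d where d: "0 < d" "\<And>\<eta>. norm (\<eta> - x 0) < d \<Longrightarrow>
          \<exists>y. traj F y 0 b \<and> y 0 = \<eta> \<and> (\<forall>t\<in>{0..b}. norm (y t - x t) < min e1 e2)"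
        using traj_approximation[OF F(1,2) x(1), of "min e1 e2"] e1(1) e2(1) by auto
      have "c < V \<eta>" if near: "dist \<eta> \<xi> < d" for \<eta>
      proof -
        obtain y where y: "traj F y 0 b" "y 0 = \<eta>" "\<And>t. t \<in> {0..b} \<Longrightarrow> norm (y t - x t) < min e1 e2"
          using d(2)[of \<eta>] near x(2) unfolding dist_norm by blast
        have "y t \<in> D" if "t \<in> {0..b}" for t
          using e1(2) y(3)[OF that] that by (force simp: dist_norm norm_minus_commute)
        then have "path \<eta> b y" using y by (simp add: path_def)
        moreover have "c < P b y"
          using e2(2) y(3)[of b] \<open>0 \<le> b\<close> by (auto simp: P_def dist_norm norm_minus_commute subset_eq)
        ultimately show ?thesis using V_ge by fastforce
      qed
      then show ?thesis unfolding eventually_nhds_metric using d(1) by blast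
    qed
  qed
  have upper: "V \<xi> \<le> \<theta>2 (\<omega> \<xi>)" for \<xi>
    by (rule V_least[OF class_K_nonneg[OF K(2) \<omega>] P_le])
  have lower: "\<theta>1 (norm (h \<xi>)) \<le> V \<xi>" if "\<xi> \<in> D" for \<xi>
    using V_ge[of \<xi> 0 "\<lambda>_. \<xi>"] that by (simp add: path_def P_def traj.refl)
  have "SIT_decrease F h g \<rho> (\<lambda>r. r) V"
    unfolding SIT_decrease_def
  proof (intro allI impI ballI)
    fix \<xi> \<zeta> w assume "norm (h \<xi>) > \<rho> (norm (g \<xi>))" and \<zeta>: "\<zeta> \<in> viscosity_subdifferential V \<xi>" and w: "w \<in> F \<xi>"
    then have "\<xi> \<in> D" by (simp add: D_def)
    \<comment> \<open>The initial velocity is exactly the prescribed \<open>w\<close>, so the right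
      derivative of a test function along this arc is \<open>\<zeta> \<bullet> w\<close>.\<close>
    obtain x v \<tau> where x: "0 < \<tau>" "arc_on F x v 0 (0 + \<tau>)" "x 0 = \<xi>" "v 0 = w"
      by (rule local_arc_exists[OF F(1,2) w, of 0]) blast
    obtain \<phi> where \<phi>: "(\<phi> has_derivative (\<lambda>k. \<zeta> \<bullet> k)) (at 0)" "\<phi> 0 = 0"
      and \<phi>_le: "\<forall>\<^sub>F k in nhds 0. \<phi> k \<le> V (\<xi> + k) - V \<xi>"
      using \<zeta> unfolding viscosity_subdifferential_has_derivative by blast
    have x': "(x has_vector_derivative w) (at_right 0)"
    proof -
      have "(x has_vector_derivative v 0) (at 0 within {0..\<tau>})" using x by (auto simp: arc_on_def)
      then show ?thesis using x(1,4) by (simp add: at_within_Icc_at_right)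
    qed
    then have lim: "(x \<longlongrightarrow> \<xi>) (at_right 0)"
      using has_vector_derivative_continuous[OF x'] x(3) by (simp add: continuous_within)
    have "\<forall>\<^sub>F s in at_right 0. x s \<in> D"
      using lim \<open>open D\<close> \<open>\<xi> \<in> D\<close> by (rule topological_tendstoD)
    then obtain s0 where s0: "0 < s0" "\<And>s. 0 < s \<Longrightarrow> s < s0 \<Longrightarrow> x s \<in> D"
      unfolding eventually_at_right_field by auto
    \<comment> \<open>Dynamic programming: any path from \<open>x s\<close>, prefixed by the arc up
      to time \<open>s\<close>, is a path from \<open>\<xi>\<close> whose payoff is larger by the
      factor \<open>exp s\<close>.\<close>
    have decay: "V (x s) \<le> exp (- s) * V \<xi>" if s: "0 < s" "s < s0" "s \<le> \<tau>" for s
    proof (rule V_least)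
      show "0 \<le> exp (- s) * V \<xi>" using V_nonneg by simp
      fix b y assume y: "path (x s) b y"
      define z where "z t = (if t \<le> s then x t else y (t - s))" for t
      have "traj F x 0 s"
        using arc_on_subinterval[OF x(2), of 0 s] s by (intro arc_on_imp_traj) auto
      moreover have "traj F (\<lambda>t. y (t - s)) s (b + s)"
        using traj_shift[of F y 0 b s] y by (simp add: path_def)
      ultimately have "traj F z 0 (b + s)"
        unfolding z_def using y by (intro traj_glue) (auto simp: path_def)
      moreover have "z t \<in> D" if "t \<in> {0..b + s}" for t
        using that s0(2)[of t] s y x(3) \<open>\<xi> \<in> D\<close> by (cases "t = 0") (auto simp: z_def path_def)
      ultimately have "path \<xi> (b + s) z" using x(3) s by (simp add: path_def z_def)
      then have "P (b + s) z \<le> V \<xi>" by (rule V_ge)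
      moreover have "0 \<le> b" using y traj_le by (auto simp: path_def)
      then have "z (b + s) = y b" using y by (cases "b = 0") (auto simp: z_def path_def)
      then have "P (b + s) z = exp s * P b y" by (simp add: P_def exp_add)
      ultimately have "exp (- s) * (exp s * P b y) \<le> exp (- s) * V \<xi>" by simp
      then show "P b y \<le> exp (- s) * V \<xi>" by (simp flip: mult.assoc exp_add)
    qed
    have "((\<lambda>s. \<phi> (x s - \<xi>)) has_real_derivative \<zeta> \<bullet> w) (at_right 0)"
    proof -
      have "((\<lambda>s. x s - \<xi>) has_derivative (\<lambda>k. k *\<^sub>R w)) (at_right 0)"
        using x' by (auto simp: has_vector_derivative_def intro!: derivative_eq_intros)
      moreover have "(\<phi> has_derivative (\<lambda>k. \<zeta> \<bullet> k)) (at (x 0 - \<xi>))" using \<phi>(1) x(3) by simp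
      ultimately have "((\<lambda>s. \<phi> (x s - \<xi>)) has_derivative (\<lambda>k. \<zeta> \<bullet> (k *\<^sub>R w))) (at_right 0)"
        by (rule has_derivative_compose)
      then show ?thesis by (simp add: has_field_derivative_def mult.commute[of _ "\<zeta> \<bullet> w"])
    qed
    then have lim1: "((\<lambda>s. \<phi> (x s - \<xi>) / s) \<longlongrightarrow> \<zeta> \<bullet> w) (at_right 0)"
      using \<phi>(2) x(3) by (simp add: has_field_derivative_iff)
    have "((\<lambda>s. (exp (- s) - 1) * V \<xi>) has_real_derivative - V \<xi>) (at_right 0)"
      by (auto intro!: derivative_eq_intros)
    then have lim2: "((\<lambda>s. (exp (- s) - 1) * V \<xi> / s) \<longlongrightarrow> - V \<xi>) (at_right 0)"
      by (simp add: has_field_derivative_iff)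
    have "((\<lambda>s. x s - \<xi>) \<longlongrightarrow> 0) (at_right 0)" using lim by (simp add: LIM_zero)
    then have "\<forall>\<^sub>F s in at_right 0. \<phi> (x s - \<xi>) \<le> V (\<xi> + (x s - \<xi>)) - V \<xi>"
      using \<phi>_le unfolding filterlim_iff by blast
    moreover have "\<forall>\<^sub>F s in at_right (0::real). 0 < s \<and> s < min s0 \<tau>"
      using s0(1) x(1) by (simp add: eventually_at_right_field) (metis min_less_iff_conj)
    \<comment> \<open>The test function lies below the increment of \<open>V\<close>, which decay
      along the arc bounds from above. Both difference quotients converge as \<open>s\<close> tends
      to 0, giving the required inequality.\<close>
    ultimately have "\<forall>\<^sub>F s in at_right 0. \<phi> (x s - \<xi>) / s \<le> (exp (- s) - 1) * V \<xi> / s"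
    proof eventually_elim
      case (elim s)
      then have "\<phi> (x s - \<xi>) \<le> (exp (- s) - 1) * V \<xi>" using decay[of s] by (simp add: algebra_simps)
      then show ?case using elim(2) by (intro divide_right_mono) auto
    qed
    then show "\<zeta> \<bullet> w \<le> - V \<xi>" by (intro tendsto_le[OF _ lim2 lim1]) auto
  qed
  moreover have "cont_pos_def (\<lambda>r. r)" by (auto simp: cont_pos_def_def continuous_on_id)
  ultimately show ?thesis
    using lsc V_nonneg lower upper \<theta>
    unfolding lsc_exp_SIT_lyapunov_def lsc_SIT_lyapunov_def D_def by blast
qed

section \<open>Sufficiency\<close>

text \<open>With \<open>\<psi>\<close> the inverse of \<open>\<alpha>1\<close>, the chain
  \<open>\<alpha>1 (norm (h (x t))) \<le> V (x t) \<le> exp (- t) * \<alpha>2 (\<omega> (x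
  0))\<close> dictates the choice
  \<open>\<beta> s t = \<psi> (exp (- t) * \<alpha>2 s)\<close>.\<close>

lemma exp_lyapunov_imp_SIT:
  fixes F :: "'a::euclidean_space \<Rightarrow> 'a set"
  assumes F: "locally_lipschitz_setvalued F" "\<And>\<xi>. compact (F \<xi>)"
    and "open {\<xi>. norm (h \<xi>) > \<rho> (norm (g \<xi>))}"
    and \<omega>: "continuous_on UNIV \<omega>" "\<And>\<xi>. 0 \<le> \<omega> \<xi>" and "lsc_exp_SIT_lyapunov F h g \<omega> \<rho> V"
  shows "SIT F h g \<omega> \<rho>"
proof -
  have V: "lower_semicontinuous V" "\<And>\<xi>. 0 \<le> V \<xi>" and dec: "SIT_decrease F h g \<rho> (\<lambda>r. r) V"
    using assms(6) by (auto simp: lsc_exp_SIT_lyapunov_def lsc_SIT_lyapunov_def)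
  obtain \<alpha>1 \<alpha>2 where \<alpha>: "class_K_inf \<alpha>1" "class_K_inf \<alpha>2"
    and bounds: "\<And>\<xi>. norm (h \<xi>) > \<rho> (norm (g \<xi>)) \<Longrightarrow> \<alpha>1 (norm (h \<xi>)) \<le> V \<xi> \<and> V \<xi> \<le> \<alpha>2 (\<omega> \<xi>)"
    using assms(6) by (auto simp: lsc_exp_SIT_lyapunov_def lsc_SIT_lyapunov_def)
  obtain \<psi> where \<psi>: "class_K_inf \<psi>" "\<And>s. 0 \<le> s \<Longrightarrow> \<psi> (\<alpha>1 s) = s"
    using class_K_inf_inverse[OF \<alpha>(1)] by metis
  note K = \<alpha>[THEN class_K_inf_imp_class_K] class_K_inf_imp_class_K[OF \<psi>(1)]
  define \<beta> where "\<beta> s t = \<psi> (exp (- t) * \<alpha>2 s)" for s t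
  have arg: "0 \<le> exp (- t) * \<alpha>2 s" if "0 \<le> s" for s t using class_K_nonneg[OF K(2) that] by simp
  have "class_KL \<beta>"
    unfolding class_KL_def
  proof (intro conjI allI impI)
    fix t :: real assume "0 \<le> t"
    have "class_K_inf (\<psi> \<circ> (\<lambda>s. exp (- t) * \<alpha>2 s))"
    proof (rule class_K_inf_compose[OF \<psi>(1) class_K_infI])
      show "continuous_on {0..} (\<lambda>s. exp (- t) * \<alpha>2 s)"
        using K(2) by (intro continuous_intros) (simp add: class_K_def)
      show "\<exists>s\<ge>0. M < exp (- t) * \<alpha>2 s" for M
      proof -
        obtain s where "0 \<le> s" "exp t * M < \<alpha>2 s" using \<alpha>(2) by (auto simp: class_K_inf_def)
        then show ?thesis by (intro exI[of _ s]) (simp add: exp_minus field_simps)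
      qed
    qed (use K(2) class_K_less[OF K(2)] in \<open>auto simp: class_K_def\<close>)
    then show "class_K (\<lambda>s. \<beta> s t)"
      using class_K_inf_imp_class_K by (fastforce simp: o_def \<beta>_def)
  next
    fix s :: real assume "0 \<le> s"
    show "antimono_on {0..} (\<beta> s)"
      unfolding \<beta>_def monotone_on_def
    proof (intro ballI impI)
      fix t u :: real assume "t \<le> u"
      then have "exp (- u) * \<alpha>2 s \<le> exp (- t) * \<alpha>2 s"
        using class_K_nonneg[OF K(2) \<open>0 \<le> s\<close>] by (intro mult_right_mono) auto
      then show "\<psi> (exp (- u) * \<alpha>2 s) \<le> \<psi> (exp (- t) * \<alpha>2 s)"
        using arg[OF \<open>0 \<le> s\<close>] by (intro class_K_mono[OF K(3)])
    qed
    have "((\<lambda>t. exp (- t) * \<alpha>2 s) \<longlongrightarrow> 0) at_top"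
      by (intro tendsto_mult_left_zero filterlim_compose[OF exp_at_bot] filterlim_uminus_at_bot_at_top)
    moreover have "\<forall>\<^sub>F t in at_top. exp (- t) * \<alpha>2 s \<in> {0..}" using arg[OF \<open>0 \<le> s\<close>] by simp
    ultimately have "((\<lambda>t. \<psi> (exp (- t) * \<alpha>2 s)) \<longlongrightarrow> \<psi> 0) at_top"
      using K(3) by (intro continuous_on_tendsto_compose[of "{0..}" \<psi>]) (auto simp: class_K_def)
    then show "(\<beta> s \<longlongrightarrow> 0) at_top" using K(3) by (simp add: \<beta>_def[abs_def] class_K_def)
  qed
  moreover have "norm (h (x t)) \<le> \<beta> (\<omega> (x 0)) t"
    if x: "maximal_solution F T x" and t1: "0 < t1" "ereal t1 < T"
      and D: "\<forall>t\<in>{0..t1}. norm (h (x t)) > \<rho> (norm (g (x t)))" and t: "t \<in> {0..t1}" for T x t1 t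
  proof -
    have sol: "solution F T x" using x by (simp add: maximal_solution_def)
    have "exp t * V (x t) \<le> V (x 0)"
    proof (cases "t = 0")
      case False
      have "abs_cont_on 0 t1 x" using sol t1 by (simp add: solution_def)
      \<comment> \<open>A lower semicontinuous \<open>V\<close> may be unbounded above on compact
        sets. The bound required by the decay estimate is taken from the continuous majorant
        \<open>\<alpha>2 (\<omega> (x t))\<close>.\<close>
      then have "continuous_on {0..t1} (\<lambda>t. \<alpha>2 (\<omega> (x t)))"
        using K(2) \<omega> abs_cont_on_imp_continuous_on
        by (intro continuous_on_compose2[of "{0..}" \<alpha>2 "{0..t1}" "\<lambda>t. \<omega> (x t)"]
            continuous_on_compose2[OF \<omega>(1)]) (auto simp: class_K_def)
      then have "bounded ((\<lambda>t. \<alpha>2 (\<omega> (x t))) ` {0..t1})"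
        by (intro compact_imp_bounded compact_continuous_image) auto
      then obtain B where "\<forall>p\<in>(\<lambda>t. \<alpha>2 (\<omega> (x t))) ` {0..t1}. \<bar>p\<bar> \<le> B"
        unfolding bounded_real by blast
      then have "\<alpha>2 (\<omega> (x s)) \<le> B" if "s \<in> {0..t1}" for s
        using that by (auto dest!: bspec[of _ _ s])
      then have B: "V (x s) \<le> B" if "s \<in> {0..t1}" for s using bounds[of "x s"] D that order_trans by blast
      have "ereal t < T" using t t1(2) by (auto intro: le_less_trans[OF _ t1(2)])
      show ?thesis
      proof (rule lsc_lyapunov_decay[where B = B, OF F V assms(3) _ sol _ \<open>ereal t < T\<close>])
        show "\<zeta> \<bullet> v \<le> - V \<xi>" if "\<xi> \<in> {\<xi>. norm (h \<xi>) > \<rho> (norm (g \<xi>))}"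
          "\<zeta> \<in> viscosity_subdifferential V \<xi>" "v \<in> F \<xi>" for \<xi> \<zeta> v
          using dec that unfolding SIT_decrease_def by blast
      qed (use False t D B in auto)
    qed simp
    moreover have "V (x 0) \<le> \<alpha>2 (\<omega> (x 0))" using bounds[of "x 0"] D t1 by auto
    moreover have "\<alpha>1 (norm (h (x t))) \<le> V (x t)" using bounds[of "x t"] D t by blast
    ultimately have "\<alpha>1 (norm (h (x t))) \<le> exp (- t) * \<alpha>2 (\<omega> (x 0))"
      by (simp add: exp_minus field_simps) (meson exp_ge_zero mult_left_mono order_trans)
    then have "\<psi> (\<alpha>1 (norm (h (x t)))) \<le> \<beta> (\<omega> (x 0)) t"
      unfolding \<beta>_def by (intro class_K_mono[OF K(3)] class_K_nonneg[OF K(1)]) auto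
    then show ?thesis using \<psi>(2) by simp
  qed
  ultimately show ?thesis unfolding SIT_def by blast
qed

theorem corollary4p4:
  fixes F :: "real ^ 'n \<Rightarrow> (real ^ 'n) set"
    and h :: "real ^ 'n \<Rightarrow> real ^ 'p"
    and g :: "real ^ 'n \<Rightarrow> real ^ 'q"
    and \<omega> :: "real ^ 'n \<Rightarrow> real"
    and \<rho> :: "real \<Rightarrow> real"
  assumes "\<And>\<xi>. F \<xi> \<noteq> {}"
    and "\<And>\<xi>. compact (F \<xi>)"
    and "locally_lipschitz_setvalued F"
    and "forward_complete F"
    and "locally_lipschitz_map h"
    and "locally_lipschitz_map g"
    and "continuous_on UNIV \<omega>"
    and "\<And>\<xi>. 0 \<le> \<omega> \<xi>"
    and "proper_map euclidean (top_of_set {0..}) \<omega>"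
    and "class_K \<rho>"
  shows "(SIT F h g \<omega> \<rho> \<longleftrightarrow> (\<exists>V. lsc_SIT_lyapunov F h g \<omega> \<rho> V)) \<and>
         ((\<exists>V. lsc_SIT_lyapunov F h g \<omega> \<rho> V) \<longleftrightarrow> (\<exists>V. lsc_exp_SIT_lyapunov F h g \<omega> \<rho> V))"
proof -
  note hg = assms(5,6)[THEN locally_lipschitz_map_imp_continuous]
  have "continuous_on UNIV (\<lambda>\<xi>. \<rho> (norm (g \<xi>)))"
    using assms(10) hg(2)
    by (intro continuous_on_compose2[of "{0..}" \<rho> UNIV "\<lambda>\<xi>. norm (g \<xi>)"] continuous_on_norm)
      (auto simp: class_K_def)
  then have D: "open {\<xi>. norm (h \<xi>) > \<rho> (norm (g \<xi>))}"
    using hg(1) by (intro open_Collect_less continuous_intros)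
  have "\<exists>V. lsc_exp_SIT_lyapunov F h g \<omega> \<rho> V" if "SIT F h g \<omega> \<rho>"
    by (rule SIT_imp_exp_lyapunov[OF assms(3,2,1) hg(1) D assms(8) that])
  moreover have "SIT F h g \<omega> \<rho>" if "lsc_exp_SIT_lyapunov F h g \<omega> \<rho> V" for V
    by (rule exp_lyapunov_imp_SIT[OF assms(3,2) D assms(7,8) that])
  moreover have "\<exists>W. lsc_exp_SIT_lyapunov F h g \<omega> \<rho> W" if "lsc_SIT_lyapunov F h g \<omega> \<rho> V" for V
    by (rule lsc_lyapunov_imp_exp_lyapunov[OF assms(10) that assms(8)])
  moreover have "lsc_SIT_lyapunov F h g \<omega> \<rho> V" if "lsc_exp_SIT_lyapunov F h g \<omega> \<rho> V" for V
    using that by (simp add: lsc_exp_SIT_lyapunov_def)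
  ultimately show ?thesis by blast
qed

end
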